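(* Let $\Psi$ be a growth function of order $p\in(0,1]$. If $f\in H^\Psi(\mathbb{R}^d)$, then its Fourier transform coincides with a continuous function, denoted by $\widehat f$. Moreover, there exists a constant $A_{d,\Psi}>0$, depending only on $\Psi$ and $d$, but not on $f$, such that $$|\widehat f(\xi)|\le A_{d,\Psi}\,\frac{\Psi^{-1}(a_d|\xi|^d)}{a_d|\xi|^d}\,\|f\|_{H^\Psi(\mathbb{R}^d)}$$ for all $\xi\in\mathbb{R}^d\setminus\{0\}$, where $\Psi^{-1}$ denotes the inverse of $\Psi$ and $a_d:=|B(0,1)|^{-1}$, with $|B(0,1)|$ the Lebesgue measure of the unit ball of $\mathbb{R}^d$.
   Context: Growth function of order $p\in(0,1]$: a function $\Psi:[0,\infty)\to[0,\infty)$ that is continuous and (strictly) increasing with $\Psi(0)=0$, $\lim_{t\to\infty}\Psi(t)=\infty$, such that $t\mapsto t^{-1}\Psi(t)$ is non-increasing on $(0,\infty)$, and of lower type $p$: there is $c>0$ with $\Psi(st)\le c\,s^p\,\Psi(t)$ for all $t\ge0$, $s\in(0,1)$. Let $m_\Psi=\lfloor d(1/i_\Psi-1)\rfloor$, where $i_\Psi=\sup\{p\in(0,1]:\Psi\text{ is of lower type }p\}$, and $$\mathcal{F}_{m_\Psi}=\Big\{\phi\in\mathcal{S}(\mathbb{R}^d):\sup_{x}\sup_{|\beta|\le m_\Psi+1}(1+|x|)^{(m_\Psi+2)(d+1)}|\partial^\beta\phi(x)|\le1\Big\}.$$ With $\phi_t(x)=t^{-d}\phi(t^{-1}x)$, for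 a tempered distribution $f$, $$M^*_{\mathcal{F}_{m_\Psi}}[f](x)=\sup_{\phi\in\mathcal{F}_{m_\Psi}}\ \sup_{t>0,\ |x-y|<t}|f*\phi_t(y)|.$$ $H^\Psi(\mathbb{R}^d)$ is the class of tempered distributions $f$ with $\int_{\mathbb{R}^d}\Psi(M^*_{\mathcal{F}_{m_\Psi}}[f](x))\,dx<\infty$, and $\|f\|_{H^\Psi(\mathbb{R}^d)}=\inf\{\lambda>0:\int_{\mathbb{R}^d}\Psi(\lambda^{-1}M^*_{\mathcal{F}_{m_\Psi}}[f](x))\,dx\le1\}$. The Fourier transform is normalised with kernel $e^{-i2\pi x\cdot\xi}$. *)

theory Defs
  imports "HOL-Analysis.Analysis"
begin

section \<open>Growth functions\<close>

definition lower_type :: "real \<Rightarrow> (real \<Rightarrow> real) \<Rightarrow> bool" where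
  "lower_type p \<Psi> \<longleftrightarrow>
    (\<exists>c>0. \<forall>t\<ge>0. \<forall>s\<in>{0<..<1}. \<Psi> (s * t) \<le> c * s powr p * \<Psi> t)"

text \<open>Only the restriction of \<open>\<Psi>\<close> to \<open>[0,\<infinity>)\<close> is meaningful; its values there
  are nonnegative because \<open>\<Psi>\<close> is increasing and vanishes at \<open>0\<close>.\<close>

definition growth_function :: "real \<Rightarrow> (real \<Rightarrow> real) \<Rightarrow> bool" where
  "growth_function p \<Psi> \<longleftrightarrow>
    continuous_on {0..} \<Psi> \<and> strict_mono_on {0..} \<Psi> \<and> \<Psi> 0 = 0 \<and>
    filterlim \<Psi> at_top at_top \<and>
    antimono_on {0<..} (\<lambda>t. \<Psi> t / t) \<and>
    lower_type p \<Psi>"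

definition growth_inv :: "(real \<Rightarrow> real) \<Rightarrow> real \<Rightarrow> real" where
  "growth_inv \<Psi> = the_inv_into {0..} \<Psi>"

text \<open>Extension by \<open>\<Psi>(\<infinity>) = \<infinity>\<close>, needed because the maximal function may be infinite.\<close>

definition growth_ext :: "(real \<Rightarrow> real) \<Rightarrow> ennreal \<Rightarrow> ennreal" where
  "growth_ext \<Psi> u = (if u = \<infinity> then \<infinity> else ennreal (\<Psi> (enn2real u)))"

definition lower_index :: "(real \<Rightarrow> real) \<Rightarrow> real" where
  "lower_index \<Psi> = Sup {p. 0 < p \<and> p \<le> 1 \<and> lower_type p \<Psi>}"

definition moment_order :: "nat \<Rightarrow> (real \<Rightarrow> real) \<Rightarrow> nat" where
  "moment_order d \<Psi> = nat \<lfloor>real d * (1 / lower_index \<Psi> - 1)\<rfloor>"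


section \<open>Schwartz functions and tempered distributions\<close>

definition partial_deriv ::
    "'a::euclidean_space \<Rightarrow> ('a \<Rightarrow> complex) \<Rightarrow> 'a \<Rightarrow> complex" where
  "partial_deriv b \<phi> x = vector_derivative (\<lambda>t. \<phi> (x + t *\<^sub>R b)) (at 0)"

text \<open>A multi-index \<open>\<beta>\<close> is given by a list of basis vectors in which \<open>b\<close> occurs \<open>\<beta>\<^sub>b\<close> times, so
  that \<open>|\<beta>|\<close> is its length. The order of the list is immaterial for the smooth functions below,
  as their partial derivatives commute.\<close>

definition multi_deriv ::
    "'a::euclidean_space list \<Rightarrow> ('a \<Rightarrow> complex) \<Rightarrow> 'a \<Rightarrow> complex" where
  "multi_deriv bs \<phi> = foldr partial_deriv bs \<phi>"

definition multi_indices :: "nat \<Rightarrow> 'a::euclidean_space list set" where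
  "multi_indices N = {bs \<in> lists Basis. length bs \<le> N}"

definition smooth :: "('a::euclidean_space \<Rightarrow> complex) \<Rightarrow> bool" where
  "smooth \<phi> \<longleftrightarrow> (\<forall>bs\<in>lists Basis. \<forall>x. multi_deriv bs \<phi> differentiable (at x))"

definition schwartz_seminorm ::
    "nat \<Rightarrow> nat \<Rightarrow> ('a::euclidean_space \<Rightarrow> complex) \<Rightarrow> ennreal" where
  "schwartz_seminorm k N \<phi> =
    (SUP x. SUP bs\<in>multi_indices N. ennreal ((1 + norm x) ^ k * cmod (multi_deriv bs \<phi> x)))"

definition schwartz :: "('a::euclidean_space \<Rightarrow> complex) set" where
  "schwartz = {\<phi>. smooth \<phi> \<and> (\<forall>k N. schwartz_seminorm k N \<phi> < \<infinity>)}"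

text \<open>A tempered distribution is represented by a total function of which only the restriction to
  \<open>schwartz\<close> is meaningful. Continuity refers to the topology generated by the seminorms: the sets
  of all \<open>\<psi>\<close> with \<open>schwartz_seminorm k N (\<psi> - \<phi>) < \<delta>\<close> form a neighbourhood base at \<open>\<phi>\<close>, since
  the seminorms increase in \<open>k\<close> and \<open>N\<close>.\<close>

definition tempered :: "(('a::euclidean_space \<Rightarrow> complex) \<Rightarrow> complex) \<Rightarrow> bool" where
  "tempered f \<longleftrightarrow>
    (\<forall>\<phi>\<in>schwartz. \<forall>\<psi>\<in>schwartz. f (\<lambda>x. \<phi> x + \<psi> x) = f \<phi> + f \<psi>) \<and>
    (\<forall>c. \<forall>\<phi>\<in>schwartz. f (\<lambda>x. c * \<phi> x) = c * f \<phi>) \<and>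
    (\<forall>\<phi>\<in>schwartz. \<forall>\<epsilon>>0. \<exists>k N. \<exists>\<delta>>0. \<forall>\<psi>\<in>schwartz.
        schwartz_seminorm k N (\<lambda>x. \<psi> x - \<phi> x) < ennreal \<delta> \<longrightarrow> cmod (f \<psi> - f \<phi>) < \<epsilon>)"

definition convolve ::
    "(('a::euclidean_space \<Rightarrow> complex) \<Rightarrow> complex) \<Rightarrow> ('a \<Rightarrow> complex) \<Rightarrow> 'a \<Rightarrow> complex" where
  "convolve f \<phi> y = f (\<lambda>z. \<phi> (y - z))"

definition dilate :: "real \<Rightarrow> ('a::euclidean_space \<Rightarrow> complex) \<Rightarrow> 'a \<Rightarrow> complex" where
  "dilate t \<phi> x = \<phi> (x /\<^sub>R t) / of_real (t ^ DIM('a))"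

definition fourier :: "('a::euclidean_space \<Rightarrow> complex) \<Rightarrow> 'a \<Rightarrow> complex" where
  "fourier \<phi> \<xi> = (LINT x|lborel. exp (- (2 * of_real pi * \<i> * of_real (x \<bullet> \<xi>))) * \<phi> x)"

definition fourier_distr ::
    "(('a::euclidean_space \<Rightarrow> complex) \<Rightarrow> complex) \<Rightarrow> ('a \<Rightarrow> complex) \<Rightarrow> complex" where
  "fourier_distr f \<phi> = f (fourier \<phi>)"

text \<open>Integrability is required explicitly because the integral of a non-integrable function is \<open>0\<close>.\<close>

definition coincides ::
    "(('a::euclidean_space \<Rightarrow> complex) \<Rightarrow> complex) \<Rightarrow> ('a \<Rightarrow> complex) \<Rightarrow> bool" where
  "coincides T g \<longleftrightarrow>
    (\<forall>\<phi>\<in>schwartz. integrable lborel (\<lambda>x. g x * \<phi> x) \<and> T \<phi> = (LINT x|lborel. g x * \<phi> x))"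


section \<open>Hardy--Orlicz spaces\<close>

definition test_functions :: "nat \<Rightarrow> ('a::euclidean_space \<Rightarrow> complex) set" where
  "test_functions m =
    {\<phi> \<in> schwartz. schwartz_seminorm ((m + 2) * (DIM('a) + 1)) (m + 1) \<phi> \<le> 1}"

definition grand_maximal ::
    "nat \<Rightarrow> (('a::euclidean_space \<Rightarrow> complex) \<Rightarrow> complex) \<Rightarrow> 'a \<Rightarrow> ennreal" where
  "grand_maximal m f x =
    (SUP \<phi>\<in>test_functions m. SUP (t, y)\<in>{(t, y). 0 < t \<and> norm (x - y) < t}.
      ennreal (cmod (convolve f (dilate t \<phi>) y)))"

definition hardy_modular ::
    "(real \<Rightarrow> real) \<Rightarrow> real \<Rightarrow> (('a::euclidean_space \<Rightarrow> complex) \<Rightarrow> complex) \<Rightarrow> ennreal" where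
  "hardy_modular \<Psi> r f =
    (\<integral>\<^sup>+x. growth_ext \<Psi> (ennreal (inverse r) * grand_maximal (moment_order DIM('a) \<Psi>) f x)
      \<partial>lborel)"

definition hardy_orlicz ::
    "(real \<Rightarrow> real) \<Rightarrow> (('a::euclidean_space \<Rightarrow> complex) \<Rightarrow> complex) set" where
  "hardy_orlicz \<Psi> = {f. tempered f \<and> hardy_modular \<Psi> 1 f < \<infinity>}"

definition hardy_norm ::
    "(real \<Rightarrow> real) \<Rightarrow> (('a::euclidean_space \<Rightarrow> complex) \<Rightarrow> complex) \<Rightarrow> real" where
  "hardy_norm \<Psi> f = Inf {r. 0 < r \<and> hardy_modular \<Psi> r f \<le> 1}"

end

theory Submission
  imports Defs
begin

text \<open>Write \<open>\<gamma>\<close> for the Gaussian \<open>exp (-\<pi>|x|\<^sup>2)\<close>, \<open>\<gamma>\<^sub>t\<close> for its dilates and \<open>u\<^sub>t = f * \<gamma>\<^sub>t\<close>. Up to a constant,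
  \<open>|u\<^sub>t(y)|\<close> is at most the grand maximal function at every point of the ball \<open>B(y,t)\<close>. If the modular
  of \<open>f\<close> at level \<open>r\<close> is at most \<open>1\<close>, integrating over that ball therefore bounds \<open>|u\<^sub>t|/r\<close> pointwise by
  a multiple of the number \<open>\<tau>\<close> with \<open>\<Psi>(\<tau>) = w := 1/|B(0,t)|\<close>. Below \<open>\<tau>\<close> the monotonicity of
  \<open>\<Psi>(s)/s\<close> gives \<open>s \<le> (\<tau>/w) \<Psi>(s)\<close>, and integrating this over the whole space yields
  \<open>\<parallel>u\<^sub>t\<parallel>\<^sub>1 \<le> K r \<tau>/w\<close> (\<open>orlicz_L1_bound\<close>). The Fourier transform of \<open>u\<^sub>t\<close> is the one of \<open>f\<close>
  times that of \<open>\<gamma>\<close> at \<open>t\<xi>\<close>, and the latter is a positive constant \<open>c exp (-\<pi>)\<close> if \<open>t = 1/|\<xi>|\<close>.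
  For this \<open>t\<close> the number \<open>w\<close> is \<open>a|\<xi>|\<^sup>d\<close>, so that the estimate of the theorem is exactly the \<open>L\<^sup>1\<close>
  bound divided by \<open>c exp (-\<pi>)\<close>.

  The rest of the work gives a meaning to this computation for a distribution. Testing \<open>f\<close> against the
  Fourier transform of \<open>\<psi>(\<xi>) F\<gamma>(t\<xi>)\<close>, which is the convolution of \<open>F\<psi>\<close> and \<open>\<gamma>\<^sub>t\<close>, and moving \<open>f\<close>
  under the convolution integral (\<open>tempered_integral\<close>) turns it into the integral of \<open>\<psi>\<close> against
  \<open>F u\<^sub>t\<close> (\<open>tempered_fourier_gaussian\<close>). Hence \<open>F u\<^sub>t / F\<gamma>(t\<cdot>)\<close> does not depend on \<open>t\<close>
  (\<open>fourier_convolve_consistent\<close>); for \<open>t = 1\<close> it is a continuous function on the whole space, the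
  origin included. It is the Fourier transform of \<open>f\<close>, as one sees by letting \<open>t\<close> tend to \<open>0\<close>: on the side
  of the distribution by \<open>tempered_fourier_limit\<close>, on the side of the function by dominated convergence.
  The latter needs polynomial growth, which follows from the \<open>L\<^sup>1\<close> bound because the lower type of \<open>\<Psi>\<close>
  bounds \<open>\<Psi>\<^sup>-\<^sup>1\<close> by a power (\<open>growth_inv_bound\<close>). The lower type also shows that some level \<open>r\<close> has
  modular at most \<open>1\<close> (\<open>hardy_modular_le_1\<close>), so that one may pass to the infimum over \<open>r\<close>.\<close>

section \<open>Partial derivatives\<close>

lemma partial_deriv_eq:
  assumes "(\<phi> has_derivative \<phi>') (at x)"
  shows "partial_deriv b \<phi> x = \<phi>' b"
proof -
  have "((\<lambda>t. x + t *\<^sub>R b) has_derivative (\<lambda>t. t *\<^sub>R b)) (at 0)"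
    by (auto intro!: derivative_eq_intros)
  moreover have "(\<phi> has_derivative \<phi>') (at (x + 0 *\<^sub>R b))"
    using assms by simp
  ultimately have "((\<lambda>t. \<phi> (x + t *\<^sub>R b)) has_derivative (\<lambda>t. \<phi>' (t *\<^sub>R b))) (at 0)"
    by (rule has_derivative_compose)
  moreover have "\<phi>' (t *\<^sub>R b) = t *\<^sub>R \<phi>' b" for t
    using assms by (meson has_derivative_bounded_linear bounded_linear.linear linear_scale)
  ultimately have "((\<lambda>t. \<phi> (x + t *\<^sub>R b)) has_vector_derivative \<phi>' b) (at 0)"
    by (simp add: has_vector_derivative_def)
  then show ?thesis
    unfolding partial_deriv_def by (rule vector_derivative_at)
qed

lemma has_derivative_partial_deriv:
  fixes \<phi> :: "'a::euclidean_space \<Rightarrow> complex"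
  assumes "\<phi> differentiable at x"
  shows "(\<phi> has_derivative (\<lambda>v. \<Sum>b\<in>Basis. (v \<bullet> b) *\<^sub>R partial_deriv b \<phi> x)) (at x)"
proof -
  obtain \<phi>' where \<phi>': "(\<phi> has_derivative \<phi>') (at x)"
    using assms by (auto simp: differentiable_def)
  then have lin: "linear \<phi>'"
    by (meson has_derivative_bounded_linear bounded_linear.linear)
  have "\<phi>' = (\<lambda>v. \<Sum>b\<in>Basis. (v \<bullet> b) *\<^sub>R partial_deriv b \<phi> x)"
  proof
    fix v
    have "\<phi>' v = \<phi>' (\<Sum>b\<in>Basis. (v \<bullet> b) *\<^sub>R b)"
      by (simp add: euclidean_representation)
    also have "\<dots> = (\<Sum>b\<in>Basis. (v \<bullet> b) *\<^sub>R \<phi>' b)"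
      by (simp add: linear_sum[OF lin] linear_scale[OF lin])
    finally show "\<phi>' v = (\<Sum>b\<in>Basis. (v \<bullet> b) *\<^sub>R partial_deriv b \<phi> x)"
      by (simp add: partial_deriv_eq[OF \<phi>'])
  qed
  with \<phi>' show ?thesis by simp
qed

lemma sum_inner_Basis_scaleR:
  fixes F :: "'a::euclidean_space \<Rightarrow> 'b::real_vector"
  assumes "b \<in> Basis"
  shows "(\<Sum>c\<in>Basis. (b \<bullet> c) *\<^sub>R F c) = F b"
proof -
  have "(\<Sum>c\<in>Basis. (b \<bullet> c) *\<^sub>R F c) = (\<Sum>c\<in>Basis. if c = b then F b else 0)"
    using assms by (intro sum.cong) (auto simp: inner_Basis)
  then show ?thesis using assms by simp
qed

lemma partial_deriv_add:
  assumes "\<phi> differentiable at x" "\<psi> differentiable at x"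
  shows "partial_deriv b (\<lambda>x. \<phi> x + \<psi> x) x = partial_deriv b \<phi> x + partial_deriv b \<psi> x"
proof -
  from assms obtain A B where A: "(\<phi> has_derivative A) (at x)" and B: "(\<psi> has_derivative B) (at x)"
    by (auto simp: differentiable_def)
  show ?thesis
    using partial_deriv_eq[OF has_derivative_add[OF A B]] partial_deriv_eq[OF A] partial_deriv_eq[OF B]
    by simp
qed

lemma partial_deriv_mult:
  assumes "\<phi> differentiable at x" "\<psi> differentiable at x"
  shows "partial_deriv b (\<lambda>x. \<phi> x * \<psi> x) x = partial_deriv b \<phi> x * \<psi> x + \<phi> x * partial_deriv b \<psi> x"
proof -
  from assms obtain A B where A: "(\<phi> has_derivative A) (at x)" and B: "(\<psi> has_derivative B) (at x)"
    by (auto simp: differentiable_def)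
  show ?thesis
    using partial_deriv_eq[OF has_derivative_mult[OF A B]] partial_deriv_eq[OF A] partial_deriv_eq[OF B]
    by (simp add: add.commute)
qed

lemma partial_deriv_const [simp]: "partial_deriv b (\<lambda>x. c) x = 0"
  by (rule partial_deriv_eq) simp

lemma partial_deriv_cmult:
  assumes "\<phi> differentiable at x"
  shows "partial_deriv b (\<lambda>x. c * \<phi> x) x = c * partial_deriv b \<phi> x"
  using partial_deriv_mult[OF _ assms, of "\<lambda>_. c"] by simp

lemma partial_deriv_affine:
  fixes \<phi> :: "'a::euclidean_space \<Rightarrow> complex"
  assumes "\<phi> differentiable at (a + s *\<^sub>R x)"
  shows "(\<lambda>x. \<phi> (a + s *\<^sub>R x)) differentiable at x"
    and "partial_deriv b (\<lambda>x. \<phi> (a + s *\<^sub>R x)) x = of_real s * partial_deriv b \<phi> (a + s *\<^sub>R x)"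
proof -
  have 1: "((\<lambda>x. a + s *\<^sub>R x) has_derivative (\<lambda>v. s *\<^sub>R v)) (at x)"
    by (auto intro!: derivative_eq_intros)
  have "((\<lambda>x. \<phi> (a + s *\<^sub>R x)) has_derivative
      (\<lambda>v. \<Sum>b\<in>Basis. ((s *\<^sub>R v) \<bullet> b) *\<^sub>R partial_deriv b \<phi> (a + s *\<^sub>R x))) (at x)"
    by (rule has_derivative_compose[OF 1 has_derivative_partial_deriv[OF assms]])
  then show "(\<lambda>x. \<phi> (a + s *\<^sub>R x)) differentiable at x"
    by (auto simp: differentiable_def)
  obtain \<phi>' where \<phi>': "(\<phi> has_derivative \<phi>') (at (a + s *\<^sub>R x))"
    using assms by (auto simp: differentiable_def)
  then have lin: "linear \<phi>'"
    by (meson has_derivative_bounded_linear bounded_linear.linear)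
  have "partial_deriv b (\<lambda>x. \<phi> (a + s *\<^sub>R x)) x = \<phi>' (s *\<^sub>R b)"
    by (rule partial_deriv_eq, rule has_derivative_compose[OF 1 \<phi>'])
  then show "partial_deriv b (\<lambda>x. \<phi> (a + s *\<^sub>R x)) x = of_real s * partial_deriv b \<phi> (a + s *\<^sub>R x)"
    by (simp add: linear_scale[OF lin] partial_deriv_eq[OF \<phi>'] scaleR_conv_of_real)
qed

lemma multi_deriv_Nil [simp]: "multi_deriv [] \<phi> = \<phi>"
  and multi_deriv_Cons [simp]: "multi_deriv (b # bs) \<phi> = partial_deriv b (multi_deriv bs \<phi>)"
  and multi_deriv_snoc [simp]: "multi_deriv (bs @ [b]) \<phi> = multi_deriv bs (partial_deriv b \<phi>)"
  by (simp_all add: multi_deriv_def)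

section \<open>Families of Schwartz functions\<close>

text \<open>Families of functions indexed by \<open>i\<close>, with bounds that are uniform in \<open>i\<close>. A family all of whose
  derivatives are \<open>rapid\<close> is a bounded subset of the Schwartz space; a family all of whose derivatives
  are \<open>slow\<close> is a bounded set of multipliers. The Fourier transform and tempered distributions
  preserve boundedness, so errors of the form \<open>\<epsilon>\<close> times a member of a bounded family stay small under both.\<close>

definition rapid :: "('i \<Rightarrow> 'a::euclidean_space \<Rightarrow> complex) \<Rightarrow> bool" where
  "rapid \<Phi> \<longleftrightarrow> (\<forall>k. \<exists>B. \<forall>i x. (1 + norm x) ^ k * cmod (\<Phi> i x) \<le> B)"

definition slow :: "('i \<Rightarrow> 'a::euclidean_space \<Rightarrow> complex) \<Rightarrow> bool" where
  "slow \<Phi> \<longleftrightarrow> (\<exists>k B. \<forall>i x. cmod (\<Phi> i x) \<le> B * (1 + norm x) ^ k)"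

definition smooth_family ::
    "(('i \<Rightarrow> 'a::euclidean_space \<Rightarrow> complex) \<Rightarrow> bool) \<Rightarrow> ('i \<Rightarrow> 'a \<Rightarrow> complex) \<Rightarrow> bool" where
  "smooth_family Q \<Phi> \<longleftrightarrow>
    (\<forall>i. smooth (\<Phi> i)) \<and> (\<forall>bs\<in>lists Basis. Q (\<lambda>i. multi_deriv bs (\<Phi> i)))"

text \<open>The induction over multi-indices is done here once and for all: a class of families that consists of
  differentiable functions of the right growth and that is closed under partial derivatives contains
  only smooth families.\<close>

lemma smooth_family_coinduct [consumes 1, case_names differentiable growth deriv]:
  assumes "P \<Phi>"
    and diff: "\<And>\<Phi> i x. P \<Phi> \<Longrightarrow> \<Phi> i differentiable at x"
    and Q: "\<And>\<Phi>. P \<Phi> \<Longrightarrow> Q \<Phi>"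
    and deriv: "\<And>\<Phi> b. P \<Phi> \<Longrightarrow> b \<in> Basis \<Longrightarrow> P (\<lambda>i. partial_deriv b (\<Phi> i))"
  shows "smooth_family Q \<Phi>"
proof -
  have "P (\<lambda>i. multi_deriv bs (\<Phi> i))" if "bs \<in> lists Basis" for bs
    using that by induction (auto intro: assms(1) deriv)
  then show ?thesis
    unfolding smooth_family_def smooth_def using diff Q by blast
qed

lemma smooth_family_deriv:
  assumes "smooth_family Q \<Phi>" "b \<in> Basis"
  shows "smooth_family Q (\<lambda>i. partial_deriv b (\<Phi> i))"
proof -
  have "bs @ [b] \<in> lists Basis" if "bs \<in> lists Basis" for bs
    using that assms(2) by auto
  then have "(\<forall>i x. multi_deriv bs (partial_deriv b (\<Phi> i)) differentiable at x) \<and>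
      Q (\<lambda>i. multi_deriv bs (partial_deriv b (\<Phi> i)))" if "bs \<in> lists Basis" for bs
    using that assms(1) unfolding smooth_family_def smooth_def multi_deriv_snoc[symmetric] by blast
  then show ?thesis
    unfolding smooth_family_def smooth_def by blast
qed

lemma smooth_family_step:
  assumes "\<And>i x. \<Phi> i differentiable at x" "Q \<Phi>"
    and "\<And>b. b \<in> Basis \<Longrightarrow> smooth_family Q (\<lambda>i. partial_deriv b (\<Phi> i))"
  shows "smooth_family Q \<Phi>"
proof -
  have "(\<forall>i x. multi_deriv bs (\<Phi> i) differentiable at x) \<and> Q (\<lambda>i. multi_deriv bs (\<Phi> i))"
    if "bs \<in> lists Basis" for bs
  proof (cases bs rule: rev_cases)
    case (snoc cs c)
    then show ?thesis
      using that assms(3)[of c] by (auto simp: smooth_family_def smooth_def)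
  qed (use assms in auto)
  then show ?thesis
    by (auto simp: smooth_family_def smooth_def)
qed

lemma smooth_family_differentiable:
  assumes "smooth_family Q \<Phi>"
  shows "\<Phi> i differentiable at x"
proof -
  have "multi_deriv [] (\<Phi> i) differentiable at x"
    using assms unfolding smooth_family_def smooth_def by blast
  then show ?thesis by simp
qed

lemma smooth_family_growth:
  assumes "smooth_family Q \<Phi>"
  shows "Q \<Phi>"
proof -
  have "Q (\<lambda>i. multi_deriv [] (\<Phi> i))"
    using assms unfolding smooth_family_def by blast
  then show ?thesis by simp
qed

lemma rapidE:
  assumes "rapid \<Phi>"
  obtains B where "0 < B" "\<And>i x. (1 + norm x) ^ k * cmod (\<Phi> i x) \<le> B"
proof -
  obtain B where B: "\<And>i x. (1 + norm x) ^ k * cmod (\<Phi> i x) \<le> B"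
    using assms unfolding rapid_def by blast
  show ?thesis
    by (rule that[of "max 1 B"]) (auto simp: le_max_iff_disj B)
qed

lemma rapid_add:
  assumes "rapid \<Phi>" "rapid \<Psi>"
  shows "rapid (\<lambda>i x. \<Phi> i x + \<Psi> i x)"
  unfolding rapid_def
proof
  fix k
  obtain B where B: "\<And>i x. (1 + norm x) ^ k * cmod (\<Phi> i x) \<le> B"
    using assms unfolding rapid_def by blast
  obtain C where C: "\<And>i x. (1 + norm x) ^ k * cmod (\<Psi> i x) \<le> C"
    using assms unfolding rapid_def by blast
  have "(1 + norm x) ^ k * cmod (\<Phi> i x + \<Psi> i x) \<le> B + C" for i x
  proof -
    have "(1 + norm x) ^ k * cmod (\<Phi> i x + \<Psi> i x) \<le> (1 + norm x) ^ k * (cmod (\<Phi> i x) + cmod (\<Psi> i x))"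
      by (intro mult_left_mono norm_triangle_ineq) auto
    with B[of x i] C[of x i] show ?thesis by (simp add: distrib_left)
  qed
  then show "\<exists>B. \<forall>i x. (1 + norm x) ^ k * cmod (\<Phi> i x + \<Psi> i x) \<le> B" by blast
qed

lemma rapid_slow_mult:
  assumes "slow \<Phi>" "rapid \<Psi>"
  shows "rapid (\<lambda>i x. \<Phi> i x * \<Psi> i x)"
  unfolding rapid_def
proof
  fix k
  obtain l B where B: "\<And>i x. cmod (\<Phi> i x) \<le> B * (1 + norm x) ^ l"
    using assms by (auto simp: slow_def)
  have [simp]: "0 \<le> B" using order_trans[OF norm_ge_zero B[of undefined 0]] by simp
  obtain C where C: "\<And>i x. (1 + norm x) ^ (k + l) * cmod (\<Psi> i x) \<le> C"
    using assms unfolding rapid_def by blast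
  have "(1 + norm x) ^ k * cmod (\<Phi> i x * \<Psi> i x) \<le> B * C" for i x
  proof -
    have "(1 + norm x) ^ k * cmod (\<Phi> i x * \<Psi> i x)
        \<le> (1 + norm x) ^ k * ((B * (1 + norm x) ^ l) * cmod (\<Psi> i x))"
      unfolding norm_mult by (intro mult_left_mono mult_right_mono B) auto
    also have "\<dots> = B * ((1 + norm x) ^ (k + l) * cmod (\<Psi> i x))"
      by (simp add: power_add)
    also have "\<dots> \<le> B * C" by (intro mult_left_mono C) auto
    finally show ?thesis .
  qed
  then show "\<exists>B. \<forall>i x. (1 + norm x) ^ k * cmod (\<Phi> i x * \<Psi> i x) \<le> B" by blast
qed

lemma slowE:
  assumes "slow \<Phi>"
  obtains k B where "0 \<le> B" "\<And>i x. cmod (\<Phi> i x) \<le> B * (1 + norm x) ^ k"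
proof -
  obtain k B where B: "\<And>i x. cmod (\<Phi> i x) \<le> B * (1 + norm x) ^ k"
    using assms by (auto simp: slow_def)
  then show ?thesis
    using that[of B k] order_trans[OF norm_ge_zero B[of undefined 0]] by simp
qed

lemma slow_add:
  assumes "slow \<Phi>" "slow \<Psi>"
  shows "slow (\<lambda>i x. \<Phi> i x + \<Psi> i x)"
proof -
  obtain k B where B: "0 \<le> B" "\<And>i x. cmod (\<Phi> i x) \<le> B * (1 + norm x) ^ k"
    using assms slowE by metis
  obtain l C where C: "0 \<le> C" "\<And>i x. cmod (\<Psi> i x) \<le> C * (1 + norm x) ^ l"
    using assms slowE by metis
  have "cmod (\<Phi> i x + \<Psi> i x) \<le> (B + C) * (1 + norm x) ^ (k + l)" for i x
  proof -
    have "B * (1 + norm x) ^ k \<le> B * (1 + norm x) ^ (k + l)"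
      "C * (1 + norm x) ^ l \<le> C * (1 + norm x) ^ (k + l)"
      by (auto intro!: mult_left_mono power_increasing B C)
    with norm_triangle_ineq[of "\<Phi> i x" "\<Psi> i x"] B(2)[of i x] C(2)[of i x] show ?thesis
      by (simp add: distrib_right)
  qed
  then show ?thesis unfolding slow_def by blast
qed

lemma slow_mult:
  assumes "slow \<Phi>" "slow \<Psi>"
  shows "slow (\<lambda>i x. \<Phi> i x * \<Psi> i x)"
proof -
  obtain k B where B: "0 \<le> B" "\<And>i x. cmod (\<Phi> i x) \<le> B * (1 + norm x) ^ k"
    using assms slowE by metis
  obtain l C where C: "0 \<le> C" "\<And>i x. cmod (\<Psi> i x) \<le> C * (1 + norm x) ^ l"
    using assms slowE by metis
  have "cmod (\<Phi> i x * \<Psi> i x) \<le> (B * C) * (1 + norm x) ^ (k + l)" for i x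
  proof -
    have "cmod (\<Phi> i x) * cmod (\<Psi> i x) \<le> (B * (1 + norm x) ^ k) * (C * (1 + norm x) ^ l)"
      by (intro mult_mono B C mult_nonneg_nonneg) auto
    then show ?thesis by (simp add: norm_mult power_add mult_ac)
  qed
  then show ?thesis unfolding slow_def by blast
qed

lemma rapid_imp_slow: "rapid \<Phi> \<Longrightarrow> slow \<Phi>"
proof -
  assume "rapid \<Phi>"
  from rapidE[OF this, of 0] obtain B where B: "\<And>i x. cmod (\<Phi> i x) \<le> B"
    by (metis power_0 mult_1)
  then show "slow \<Phi>"
    unfolding slow_def by (intro exI[of _ 0] exI[of _ B]) auto
qed

text \<open>Products alone are not closed under differentiation; the finite sums of products are, by the product
  rule. This makes them a class to which coinduction applies.\<close>

inductive leibniz_sum ::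
    "(('i \<Rightarrow> 'a::euclidean_space \<Rightarrow> complex) \<Rightarrow> bool) \<Rightarrow> ('i \<Rightarrow> 'a \<Rightarrow> complex) \<Rightarrow> bool" for Q where
  prod: "smooth_family slow \<Phi> \<Longrightarrow> smooth_family Q \<Psi> \<Longrightarrow> leibniz_sum Q (\<lambda>i x. \<Phi> i x * \<Psi> i x)"
| add: "leibniz_sum Q A \<Longrightarrow> leibniz_sum Q B \<Longrightarrow> leibniz_sum Q (\<lambda>i x. A i x + B i x)"

lemma smooth_family_leibniz_sum:
  fixes \<Phi> :: "'i \<Rightarrow> 'a::euclidean_space \<Rightarrow> complex"
  assumes Q_add: "\<And>A B :: 'i \<Rightarrow> 'a \<Rightarrow> complex. Q A \<Longrightarrow> Q B \<Longrightarrow> Q (\<lambda>i x. A i x + B i x)"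
    and Q_mult: "\<And>A B :: 'i \<Rightarrow> 'a \<Rightarrow> complex. slow A \<Longrightarrow> Q B \<Longrightarrow> Q (\<lambda>i x. A i x * B i x)"
    and "leibniz_sum Q \<Phi>"
  shows "smooth_family Q \<Phi>"
proof -
  have *: "(\<forall>i x. \<Phi> i differentiable at x) \<and> Q \<Phi> \<and>
      (\<forall>b\<in>Basis. leibniz_sum Q (\<lambda>i. partial_deriv b (\<Phi> i)))"
    if "leibniz_sum Q \<Phi>" for \<Phi> :: "'i \<Rightarrow> 'a \<Rightarrow> complex"
    using that
  proof induction
    case (prod \<Phi> \<Psi>)
    note d = smooth_family_differentiable[OF prod(1)] smooth_family_differentiable[OF prod(2)]
    have "leibniz_sum Q (\<lambda>i. partial_deriv b (\<lambda>x. \<Phi> i x * \<Psi> i x))" if "b \<in> Basis" for b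
    proof -
      have "leibniz_sum Q (\<lambda>i x. partial_deriv b (\<Phi> i) x * \<Psi> i x + \<Phi> i x * partial_deriv b (\<Psi> i) x)"
        by (intro leibniz_sum.intros smooth_family_deriv prod that)
      moreover have "(\<lambda>i. partial_deriv b (\<lambda>x. \<Phi> i x * \<Psi> i x)) =
          (\<lambda>i x. partial_deriv b (\<Phi> i) x * \<Psi> i x + \<Phi> i x * partial_deriv b (\<Psi> i) x)"
        by (intro ext partial_deriv_mult d)
      ultimately show ?thesis by simp
    qed
    with d show ?case
      using Q_mult[OF smooth_family_growth[OF prod(1)] smooth_family_growth[OF prod(2)]]
      by (auto intro: differentiable_mult)
  next
    case (add A B)
    have "leibniz_sum Q (\<lambda>i. partial_deriv b (\<lambda>x. A i x + B i x))" if "b \<in> Basis" for b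
    proof -
      have "leibniz_sum Q (\<lambda>i x. partial_deriv b (A i) x + partial_deriv b (B i) x)"
        using add that by (intro leibniz_sum.intros) auto
      moreover have "(\<lambda>i. partial_deriv b (\<lambda>x. A i x + B i x)) =
          (\<lambda>i x. partial_deriv b (A i) x + partial_deriv b (B i) x)"
        using add by (auto simp: fun_eq_iff intro!: partial_deriv_add)
      ultimately show ?thesis by simp
    qed
    with add show ?case
      using Q_add[of A B] by (auto intro: differentiable_add)
  qed
  show ?thesis
    by (rule smooth_family_coinduct[of "leibniz_sum Q"]) (use assms(3) * in auto)
qed

lemma rapid_leibniz_sum: "leibniz_sum rapid \<Phi> \<Longrightarrow> smooth_family rapid \<Phi>"
  by (rule smooth_family_leibniz_sum) (auto intro: rapid_add rapid_slow_mult)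

lemma slow_leibniz_sum: "leibniz_sum slow \<Phi> \<Longrightarrow> smooth_family slow \<Phi>"
  by (rule smooth_family_leibniz_sum) (auto intro: slow_add slow_mult)

lemmas smooth_rapid_mult = rapid_leibniz_sum[OF leibniz_sum.prod]
lemmas smooth_slow_mult = slow_leibniz_sum[OF leibniz_sum.prod]

lemma smooth_family_rapid_imp_slow: "smooth_family rapid \<Phi> \<Longrightarrow> smooth_family slow \<Phi>"
  by (auto simp: smooth_family_def rapid_imp_slow)

lemma partial_deriv_inner:
  "(\<lambda>x::'a::euclidean_space. of_real (x \<bullet> v) + c :: complex) differentiable at x"
  "partial_deriv b (\<lambda>x::'a. of_real (x \<bullet> v) + c) x = of_real (b \<bullet> v)"
proof -
  have "((\<lambda>x::'a. of_real (x \<bullet> v) + c :: complex) has_derivative (\<lambda>h. of_real (h \<bullet> v))) (at x)"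
    by (auto intro!: derivative_eq_intros)
  then show "(\<lambda>x::'a. of_real (x \<bullet> v) + c :: complex) differentiable at x"
    "partial_deriv b (\<lambda>x::'a. of_real (x \<bullet> v) + c) x = of_real (b \<bullet> v)"
    by (auto simp: differentiable_def intro: partial_deriv_eq)
qed

lemma smooth_slow_inner:
  "smooth_family slow (\<lambda>i (x::'a::euclidean_space). of_real (x \<bullet> v) + c)"
proof (rule smooth_family_coinduct[of "\<lambda>\<Phi>. \<exists>v c. \<Phi> = (\<lambda>i x. of_real (x \<bullet> v) + c)"])
  fix \<Phi> :: "'b \<Rightarrow> 'a \<Rightarrow> complex"
  assume "\<exists>v c. \<Phi> = (\<lambda>i x. of_real (x \<bullet> v) + c)"
  then obtain v c where \<Phi>: "\<Phi> = (\<lambda>i x. of_real (x \<bullet> v) + c)" by blast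
  show "\<Phi> i differentiable at x" for i x
    unfolding \<Phi> by (rule partial_deriv_inner)
  have "cmod (of_real (x \<bullet> v) + c) \<le> (norm v + cmod c) * (1 + norm x) ^ 1" for x :: 'a
  proof -
    have "cmod (of_real (x \<bullet> v) + c) \<le> norm x * norm v + cmod c"
      using norm_triangle_ineq[of "of_real (x \<bullet> v)" c] Cauchy_Schwarz_ineq2[of x v] by simp
    also have "\<dots> \<le> (norm v + cmod c) * (1 + norm x) ^ 1"
      by (simp add: algebra_simps)
    finally show ?thesis .
  qed
  then show "slow \<Phi>"
    unfolding \<Phi> slow_def by blast
  show "\<exists>w d. (\<lambda>i. partial_deriv b (\<Phi> i)) = (\<lambda>i x. of_real (x \<bullet> w) + d)" for b
    by (intro exI[of _ 0] exI[of _ "of_real (b \<bullet> v)"] ext) (simp add: \<Phi> partial_deriv_inner)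
qed auto

lemma smooth_slow_const: "smooth_family slow (\<lambda>i (x::'a::euclidean_space). c)"
  using smooth_slow_inner[of 0 c] by simp

lemma smooth_slow_coord: "smooth_family slow (\<lambda>i (x::'a::euclidean_space). of_real (x \<bullet> v))"
  using smooth_slow_inner[of v 0] by simp

lemma smooth_rapid_add:
  assumes "smooth_family rapid \<Phi>" "smooth_family rapid \<Psi>"
  shows "smooth_family rapid (\<lambda>i x. \<Phi> i x + \<Psi> i x)"
  using rapid_leibniz_sum[OF leibniz_sum.add[OF leibniz_sum.prod[OF smooth_slow_const assms(1)]
    leibniz_sum.prod[OF smooth_slow_const assms(2)]], of 1 1] by simp

lemma smooth_slow_add:
  assumes "smooth_family slow \<Phi>" "smooth_family slow \<Psi>"
  shows "smooth_family slow (\<lambda>i x. \<Phi> i x + \<Psi> i x)"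
  using slow_leibniz_sum[OF leibniz_sum.add[OF leibniz_sum.prod[OF smooth_slow_const assms(1)]
    leibniz_sum.prod[OF smooth_slow_const assms(2)]], of 1 1] by simp

lemma smooth_rapid_cmult:
  assumes "smooth_family rapid \<Phi>"
  shows "smooth_family rapid (\<lambda>i x. c * \<Phi> i x)"
  by (rule smooth_rapid_mult[OF smooth_slow_const assms])

text \<open>A derivative of \<open>\<phi>(a + s x)\<close> is a multiple of another function of the same form, and
  \<open>1 + |x|\<close> and \<open>1 + |a + s x|\<close> are comparable.\<close>

lemma smooth_rapid_affine:
  fixes \<Phi> :: "'i \<Rightarrow> 'a::euclidean_space \<Rightarrow> complex"
  assumes "smooth_family rapid \<Phi>" and s: "s \<noteq> 0"
  shows "smooth_family rapid (\<lambda>i x. \<Phi> i (a + s *\<^sub>R x))"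
proof (rule smooth_family_coinduct[of
      "\<lambda>\<Phi>'. \<exists>c \<Phi>. smooth_family rapid \<Phi> \<and> \<Phi>' = (\<lambda>i x. c * \<Phi> i (a + s *\<^sub>R x))"])
  show "\<exists>c \<Phi>'. smooth_family rapid \<Phi>' \<and>
      (\<lambda>i x. \<Phi> i (a + s *\<^sub>R x)) = (\<lambda>i x. c * \<Phi>' i (a + s *\<^sub>R x))"
    using assms(1) by (intro exI[of _ 1] exI[of _ \<Phi>]) simp
next
  fix \<Phi>' :: "'i \<Rightarrow> 'a \<Rightarrow> complex"
  assume "\<exists>c \<Phi>. smooth_family rapid \<Phi> \<and> \<Phi>' = (\<lambda>i x. c * \<Phi> i (a + s *\<^sub>R x))"
  then obtain c \<Phi> where \<Phi>: "smooth_family rapid \<Phi>" and \<Phi>': "\<Phi>' = (\<lambda>i x. c * \<Phi> i (a + s *\<^sub>R x))"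
    by blast
  note d = partial_deriv_affine[OF smooth_family_differentiable[OF \<Phi>]]
  show "\<Phi>' i differentiable at x" for i x
    unfolding \<Phi>' by (intro differentiable_mult d) simp
  show "\<exists>c \<Phi>. smooth_family rapid \<Phi> \<and>
      (\<lambda>i. partial_deriv b (\<Phi>' i)) = (\<lambda>i x. c * \<Phi> i (a + s *\<^sub>R x))" if "b \<in> Basis" for b
    using smooth_family_deriv[OF \<Phi> that]
    by (intro exI[of _ "c * of_real s"] exI[of _ "\<lambda>i. partial_deriv b (\<Phi> i)"])
      (simp add: \<Phi>' partial_deriv_cmult d fun_eq_iff)
  define K where "K = 1 + (1 + norm a) / \<bar>s\<bar>"
  have K: "1 \<le> K" by (simp add: K_def)
  have le: "1 + norm x \<le> K * (1 + norm (a + s *\<^sub>R x))" for x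
  proof -
    have "\<bar>s\<bar> * norm x \<le> norm (a + s *\<^sub>R x) + norm a"
      using norm_triangle_ineq4[of "a + s *\<^sub>R x" a] by simp
    then have "norm x \<le> (norm (a + s *\<^sub>R x) + norm a) / \<bar>s\<bar>"
      using s by (simp add: pos_le_divide_eq mult.commute)
    also have "\<dots> \<le> (1 + norm a) / \<bar>s\<bar> * (1 + norm (a + s *\<^sub>R x))"
      using s by (simp add: field_simps)
    finally show ?thesis
      by (simp add: K_def distrib_right) (smt (verit) norm_ge_zero)
  qed
  show "rapid \<Phi>'"
    unfolding rapid_def
  proof
    fix k
    obtain B where B: "0 < B" "\<And>i x. (1 + norm x) ^ k * cmod (\<Phi> i x) \<le> B"
      using rapidE[OF smooth_family_growth[OF \<Phi>]] by metis
    have "(1 + norm x) ^ k * cmod (\<Phi>' i x) \<le> K ^ k * (cmod c * B)" for i x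
    proof -
      have "(1 + norm x) ^ k * cmod (\<Phi>' i x)
          \<le> (K * (1 + norm (a + s *\<^sub>R x))) ^ k * (cmod c * cmod (\<Phi> i (a + s *\<^sub>R x)))"
        unfolding \<Phi>' norm_mult by (intro mult_right_mono power_mono le) auto
      also have "\<dots> = K ^ k * (cmod c * ((1 + norm (a + s *\<^sub>R x)) ^ k * cmod (\<Phi> i (a + s *\<^sub>R x))))"
        by (simp add: power_mult_distrib)
      also have "\<dots> \<le> K ^ k * (cmod c * B)"
        using K by (intro mult_left_mono B) auto
      finally show ?thesis .
    qed
    then show "\<exists>B. \<forall>i x. (1 + norm x) ^ k * cmod (\<Phi>' i x) \<le> B" by blast
  qed
qed

text \<open>The decay of \<open>\<phi>(s i x)\<close> in \<open>x\<close> is not uniform in \<open>i\<close>, since \<open>s i\<close> may be arbitrarily small. But the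
  chain rule only produces factors of modulus at most \<open>1\<close>, so all derivatives stay uniformly bounded.\<close>

lemma smooth_slow_scale:
  fixes \<phi> :: "'a::euclidean_space \<Rightarrow> complex" and s :: "'i \<Rightarrow> real"
  assumes "smooth_family rapid (\<lambda>_::unit. \<phi>)" and s: "\<And>i. \<bar>s i\<bar> \<le> 1"
  shows "smooth_family slow (\<lambda>i x. \<phi> (s i *\<^sub>R x))"
proof (rule smooth_family_coinduct[of "\<lambda>\<Phi>. \<exists>(c::'i \<Rightarrow> complex) \<phi>. smooth_family rapid (\<lambda>_::unit. \<phi>) \<and>
      (\<forall>i. cmod (c i) \<le> 1) \<and> \<Phi> = (\<lambda>i x. c i * \<phi> (s i *\<^sub>R x))"])
  show "\<exists>(c::'i \<Rightarrow> complex) \<psi>. smooth_family rapid (\<lambda>_::unit. \<psi>) \<and>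
      (\<forall>i. cmod (c i) \<le> 1) \<and> (\<lambda>i x. \<phi> (s i *\<^sub>R x)) = (\<lambda>i x. c i * \<psi> (s i *\<^sub>R x))"
    using assms(1) by (intro exI[of _ "\<lambda>_. 1"] exI[of _ \<phi>]) simp
next
  fix \<Phi> :: "'i \<Rightarrow> 'a \<Rightarrow> complex"
  assume "\<exists>(c::'i \<Rightarrow> complex) \<phi>. smooth_family rapid (\<lambda>_::unit. \<phi>) \<and>
      (\<forall>i. cmod (c i) \<le> 1) \<and> \<Phi> = (\<lambda>i x. c i * \<phi> (s i *\<^sub>R x))"
  then obtain c :: "'i \<Rightarrow> complex" and \<phi> where \<phi>: "smooth_family rapid (\<lambda>_::unit. \<phi>)"
    and c: "\<And>i. cmod (c i) \<le> 1" and \<Phi>: "\<Phi> = (\<lambda>i x. c i * \<phi> (s i *\<^sub>R x))" by blast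
  note d = partial_deriv_affine[OF smooth_family_differentiable[OF \<phi>], where a=0, simplified]
  show "\<Phi> i differentiable at x" for i x
    unfolding \<Phi> by (intro differentiable_mult d) simp
  show "\<exists>(c::'i \<Rightarrow> complex) \<phi>. smooth_family rapid (\<lambda>_::unit. \<phi>) \<and> (\<forall>i. cmod (c i) \<le> 1) \<and>
      (\<lambda>i. partial_deriv b (\<Phi> i)) = (\<lambda>i x. c i * \<phi> (s i *\<^sub>R x))" if "b \<in> Basis" for b
    using smooth_family_deriv[OF \<phi> that] c s
    by (intro exI[of _ "\<lambda>i. c i * of_real (s i)"] exI[of _ "partial_deriv b \<phi>"])
      (auto simp: \<Phi> partial_deriv_cmult d fun_eq_iff norm_mult intro: mult_le_one)
  obtain B where B: "0 < B" "\<And>x. cmod (\<phi> x) \<le> B"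
    using rapidE[OF smooth_family_growth[OF \<phi>], of 0] by auto
  have "cmod (\<Phi> i x) \<le> B * (1 + norm x) ^ 0" for i x
    using mult_mono[OF c[of i] B(2)[of "s i *\<^sub>R x"]] by (simp add: \<Phi> norm_mult)
  then show "slow \<Phi>" unfolding slow_def by blast
qed

section \<open>Schwartz functions and tempered distributions\<close>

lemma finite_multi_indices: "finite (multi_indices N :: 'a::euclidean_space list set)"
proof -
  have "multi_indices N = {bs. set bs \<subseteq> (Basis :: 'a set) \<and> length bs \<le> N}"
    by (auto simp: multi_indices_def)
  then show ?thesis
    by (simp add: finite_lists_length_le)
qed

lemma schwartz_seminorm_le_iff:
  assumes "0 \<le> B"
  shows "schwartz_seminorm k N \<phi> \<le> ennreal B \<longleftrightarrow>
    (\<forall>bs\<in>multi_indices N. \<forall>x. (1 + norm x) ^ k * cmod (multi_deriv bs \<phi> x) \<le> B)"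
  using assms by (auto simp: schwartz_seminorm_def SUP_le_iff)

text \<open>There are only finitely many multi-indices of a given order, so finiteness of all seminorms means that
  each weighted derivative is bounded.\<close>

lemma schwartz_iff: "\<phi> \<in> schwartz \<longleftrightarrow> smooth_family rapid (\<lambda>_::unit. \<phi>)"
proof
  assume \<phi>: "\<phi> \<in> schwartz"
  have "rapid (\<lambda>_::unit. multi_deriv bs \<phi>)" if "bs \<in> lists Basis" for bs
    unfolding rapid_def
  proof
    fix k
    have "schwartz_seminorm k (length bs) \<phi> < \<infinity>"
      using \<phi> by (auto simp: schwartz_def)
    then obtain B where "0 \<le> B" "schwartz_seminorm k (length bs) \<phi> = ennreal B"
      by (cases "schwartz_seminorm k (length bs) \<phi>") auto
    then show "\<exists>B. \<forall>(i::unit) x. (1 + norm x) ^ k * cmod (multi_deriv bs \<phi> x) \<le> B"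
      using schwartz_seminorm_le_iff[of B k "length bs" \<phi>] that by (auto simp: multi_indices_def)
  qed
  with \<phi> show "smooth_family rapid (\<lambda>_::unit. \<phi>)"
    by (auto simp: smooth_family_def schwartz_def)
next
  assume \<phi>: "smooth_family rapid (\<lambda>_::unit. \<phi>)"
  have "schwartz_seminorm k N \<phi> < \<infinity>" for k N
  proof -
    have "\<exists>B. \<forall>x. (1 + norm x) ^ k * cmod (multi_deriv bs \<phi> x) \<le> B" if "bs \<in> multi_indices N" for bs
      using \<phi> that by (auto simp: smooth_family_def rapid_def multi_indices_def)
    then obtain B where B: "\<And>bs x. bs \<in> multi_indices N \<Longrightarrow>
        (1 + norm x) ^ k * cmod (multi_deriv bs \<phi> x) \<le> B bs" by metis
    have "(1 + norm x) ^ k * cmod (multi_deriv bs \<phi> x) \<le> (\<Sum>bs\<in>multi_indices N. \<bar>B bs\<bar>)"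
      if "bs \<in> multi_indices N" for bs x
      using B[OF that, of x] member_le_sum[OF that, of "\<lambda>bs. \<bar>B bs\<bar>"] finite_multi_indices[of N]
      by (smt (verit, best) abs_ge_zero)
    then have "schwartz_seminorm k N \<phi> \<le> ennreal (\<Sum>bs\<in>multi_indices N. \<bar>B bs\<bar>)"
      by (subst schwartz_seminorm_le_iff) (auto intro: sum_nonneg)
    then show ?thesis
      using order_le_less_trans by fastforce
  qed
  with \<phi> show "\<phi> \<in> schwartz"
    by (auto simp: smooth_family_def schwartz_def)
qed

lemma smooth_rapid_imp_schwartz:
  assumes "smooth_family rapid \<Phi>"
  shows "\<Phi> i \<in> schwartz"
  using assms unfolding schwartz_iff smooth_family_def rapid_def by blast

lemma schwartz_const_family: "\<phi> \<in> schwartz \<Longrightarrow> smooth_family rapid (\<lambda>_. \<phi>)"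
  unfolding schwartz_iff smooth_family_def rapid_def by blast

lemma schwartz_add: "\<phi> \<in> schwartz \<Longrightarrow> \<psi> \<in> schwartz \<Longrightarrow> (\<lambda>x. \<phi> x + \<psi> x) \<in> schwartz"
  unfolding schwartz_iff by (rule smooth_rapid_add)

lemma schwartz_cmult: "\<phi> \<in> schwartz \<Longrightarrow> (\<lambda>x. c * \<phi> x) \<in> schwartz"
  unfolding schwartz_iff by (rule smooth_rapid_cmult)

lemma schwartz_affine: "\<phi> \<in> schwartz \<Longrightarrow> s \<noteq> 0 \<Longrightarrow> (\<lambda>x. \<phi> (a + s *\<^sub>R x)) \<in> schwartz"
  unfolding schwartz_iff by (rule smooth_rapid_affine)

lemma schwartz_mult: "\<phi> \<in> schwartz \<Longrightarrow> \<psi> \<in> schwartz \<Longrightarrow> (\<lambda>x. \<phi> x * \<psi> x) \<in> schwartz"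
  unfolding schwartz_iff by (intro smooth_rapid_mult smooth_family_rapid_imp_slow)

lemma schwartz_deriv: "\<phi> \<in> schwartz \<Longrightarrow> b \<in> Basis \<Longrightarrow> partial_deriv b \<phi> \<in> schwartz"
  unfolding schwartz_iff by (rule smooth_family_deriv)

lemma schwartz_multi_deriv:
  assumes "\<phi> \<in> schwartz" "bs \<in> lists Basis"
  shows "multi_deriv bs \<phi> \<in> schwartz"
  using assms(2) by induction (auto intro: assms(1) schwartz_deriv)

lemma partial_deriv_const_fun [simp]: "partial_deriv b (\<lambda>x. c) = (\<lambda>x. 0)"
  by (rule ext) simp

lemma schwartz_zero: "(\<lambda>x. 0) \<in> schwartz"
  unfolding schwartz_iff
  by (rule smooth_family_coinduct[of "\<lambda>\<Phi>. \<Phi> = (\<lambda>i x. 0)"])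
     (auto simp: rapid_def)

lemma schwartz_sum:
  assumes "\<And>i. i \<in> I \<Longrightarrow> \<phi> i \<in> schwartz"
  shows "(\<lambda>x. \<Sum>i\<in>I. \<phi> i x) \<in> schwartz"
proof (cases "finite I")
  case True
  then show ?thesis
    using assms by (induction I rule: finite_induct) (auto intro: schwartz_zero schwartz_add)
qed (simp add: schwartz_zero)

lemma schwartz_differentiable: "\<phi> \<in> schwartz \<Longrightarrow> \<phi> differentiable at x"
  unfolding schwartz_iff by (rule smooth_family_differentiable)

lemma schwartz_continuous: "\<phi> \<in> schwartz \<Longrightarrow> continuous_on UNIV \<phi>"
  by (auto simp: continuous_on_eq_continuous_at intro: schwartz_differentiable differentiable_imp_continuous_within)

lemma schwartz_measurable: "\<phi> \<in> schwartz \<Longrightarrow> \<phi> \<in> borel_measurable borel"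
  by (intro borel_measurable_continuous_onI schwartz_continuous)

lemma schwartz_bound:
  assumes "\<phi> \<in> schwartz"
  obtains B where "0 < B" "\<And>x. (1 + norm x) ^ k * cmod (\<phi> x) \<le> B"
  using rapidE[OF smooth_family_growth[OF assms[unfolded schwartz_iff]]] by metis

lemma tempered_add:
  "tempered f \<Longrightarrow> \<phi> \<in> schwartz \<Longrightarrow> \<psi> \<in> schwartz \<Longrightarrow> f (\<lambda>x. \<phi> x + \<psi> x) = f \<phi> + f \<psi>"
  and tempered_cmult: "tempered f \<Longrightarrow> \<phi> \<in> schwartz \<Longrightarrow> f (\<lambda>x. c * \<phi> x) = c * f \<phi>"
  by (auto simp: tempered_def)

lemma tempered_zero: "tempered f \<Longrightarrow> f (\<lambda>x. 0) = 0"
  using tempered_cmult[OF _ schwartz_zero, of f 0] by simp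

lemma tempered_diff:
  assumes "tempered f" "\<phi> \<in> schwartz" "\<psi> \<in> schwartz"
  shows "f (\<lambda>x. \<phi> x - \<psi> x) = f \<phi> - f \<psi>"
  using tempered_add[OF assms(1,2) schwartz_cmult[OF assms(3)], of "-1"]
    tempered_cmult[OF assms(1,3), of "-1"] by simp

lemma tempered_sum:
  assumes "tempered f" "\<And>i. i \<in> I \<Longrightarrow> \<phi> i \<in> schwartz"
  shows "f (\<lambda>x. \<Sum>i\<in>I. \<phi> i x) = (\<Sum>i\<in>I. f (\<phi> i))"
proof (cases "finite I")
  case True
  then show ?thesis
    using assms(2)
    by (induction I rule: finite_induct)
      (simp_all add: tempered_zero[OF assms(1)] tempered_add[OF assms(1)] schwartz_sum)
qed (simp add: tempered_zero assms)

lemma multi_deriv_cmult: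
  assumes "\<phi> \<in> schwartz" "bs \<in> lists Basis"
  shows "multi_deriv bs (\<lambda>x. c * \<phi> x) = (\<lambda>x. c * multi_deriv bs \<phi> x)"
  using assms(2)
proof induction
  case (Cons b bs)
  have "partial_deriv b (\<lambda>x. c * multi_deriv bs \<phi> x) x = c * partial_deriv b (multi_deriv bs \<phi>) x" for x
    by (intro partial_deriv_cmult schwartz_differentiable schwartz_multi_deriv assms(1) Cons(2))
  then show ?case
    unfolding multi_deriv_Cons Cons(3) by (rule ext)
qed simp

text \<open>Continuity at \<open>0\<close> and homogeneity bound a tempered distribution by a multiple of a single seminorm.\<close>

lemma tempered_bound:
  fixes f :: "('a::euclidean_space \<Rightarrow> complex) \<Rightarrow> complex"
  assumes f: "tempered f"
  obtains k N C where "0 < C"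
    "\<And>\<phi> B. \<phi> \<in> schwartz \<Longrightarrow>
      (\<And>bs x. bs \<in> multi_indices N \<Longrightarrow> (1 + norm x) ^ k * cmod (multi_deriv bs \<phi> x) \<le> B) \<Longrightarrow>
      cmod (f \<phi>) \<le> C * B"
proof -
  obtain k N \<delta> where \<delta>: "0 < \<delta>" and cont: "\<And>\<psi>. \<psi> \<in> schwartz \<Longrightarrow>
      schwartz_seminorm k N \<psi> < ennreal \<delta> \<Longrightarrow> cmod (f \<psi>) < 1"
  proof -
    have "\<forall>\<phi>\<in>schwartz. \<forall>\<epsilon>>0. \<exists>k N. \<exists>\<delta>>0. \<forall>\<psi>\<in>schwartz.
        schwartz_seminorm k N (\<lambda>x. \<psi> x - \<phi> x) < ennreal \<delta> \<longrightarrow> cmod (f \<psi> - f \<phi>) < \<epsilon>"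
      using f by (simp add: tempered_def)
    from this[rule_format, OF schwartz_zero, of 1] show ?thesis
      using that by (auto simp: tempered_zero[OF f])
  qed
  have main: "cmod (f \<phi>) \<le> 2 / \<delta> * B" if \<phi>: "\<phi> \<in> schwartz" and B: "0 < B" and
    le: "\<And>bs x. bs \<in> multi_indices N \<Longrightarrow> (1 + norm x) ^ k * cmod (multi_deriv bs \<phi> x) \<le> B" for \<phi> B
  proof -
    define s where "s = \<delta> / (2 * B)"
    have s: "0 < s" using \<delta> B by (simp add: s_def)
    have "schwartz_seminorm k N (\<lambda>x. of_real s * \<phi> x) \<le> ennreal (s * B)"
      using s B le by (subst schwartz_seminorm_le_iff)
        (auto simp: multi_deriv_cmult[OF \<phi>] multi_indices_def norm_mult mult.left_commute intro!: mult_left_mono)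
    also have "\<dots> < ennreal \<delta>"
      using \<delta> B by (intro ennreal_lessI) (auto simp: s_def)
    finally have "cmod (f (\<lambda>x. of_real s * \<phi> x)) < 1"
      by (intro cont schwartz_cmult \<phi>)
    then have "s * cmod (f \<phi>) < 1"
      using s by (simp add: tempered_cmult[OF f \<phi>] norm_mult)
    then show ?thesis
      using \<delta> B by (simp add: s_def field_simps)
  qed
  show ?thesis
  proof (rule that[of "2 / \<delta>" N k])
    show "0 < 2 / \<delta>" using \<delta> by simp
    fix \<phi> :: "'a \<Rightarrow> complex" and B
    assume \<phi>: "\<phi> \<in> schwartz" and
      le: "\<And>bs x. bs \<in> multi_indices N \<Longrightarrow> (1 + norm x) ^ k * cmod (multi_deriv bs \<phi> x) \<le> B"
    have B: "0 \<le> B"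
      using order_trans[OF _ le[of "[]" 0]] by (simp add: multi_indices_def)
    show "cmod (f \<phi>) \<le> 2 / \<delta> * B"
    proof (rule field_le_epsilon)
      fix e :: real assume "0 < e"
      then have "cmod (f \<phi>) \<le> 2 / \<delta> * (B + e * \<delta> / 2)"
        using \<delta> B by (intro main \<phi> order_trans[OF le]) (auto intro: add_nonneg_pos)
      also have "\<dots> = 2 / \<delta> * B + e" using \<delta> by (simp add: field_simps)
      finally show "cmod (f \<phi>) \<le> 2 / \<delta> * B + e" .
    qed
  qed
qed

lemma tempered_bounded_on_family:
  assumes f: "tempered f" and \<Phi>: "smooth_family rapid \<Phi>"
  shows "\<exists>B. \<forall>i. cmod (f (\<Phi> i)) \<le> B"
proof -
  obtain k N C where C: "0 < C" and bound: "\<And>\<phi> B. \<phi> \<in> schwartz \<Longrightarrow>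
      (\<And>bs x. bs \<in> multi_indices N \<Longrightarrow> (1 + norm x) ^ k * cmod (multi_deriv bs \<phi> x) \<le> B) \<Longrightarrow>
      cmod (f \<phi>) \<le> C * B"
    by (rule tempered_bound[OF f]) blast
  have "\<exists>B. \<forall>i x. (1 + norm x) ^ k * cmod (multi_deriv bs (\<Phi> i) x) \<le> B"
    if "bs \<in> multi_indices N" for bs
    using \<Phi> that by (auto simp: smooth_family_def rapid_def multi_indices_def)
  then obtain B where B: "\<And>bs i x. bs \<in> multi_indices N \<Longrightarrow>
        (1 + norm x) ^ k * cmod (multi_deriv bs (\<Phi> i) x) \<le> B bs" by metis
  have "(1 + norm x) ^ k * cmod (multi_deriv bs (\<Phi> i) x) \<le> (\<Sum>bs\<in>multi_indices N. \<bar>B bs\<bar>)"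
    if "bs \<in> multi_indices N" for bs i x
    using B[OF that, of x i] member_le_sum[OF that, of "\<lambda>bs. \<bar>B bs\<bar>"] finite_multi_indices[of N]
    by (smt (verit, best) abs_ge_zero)
  then have "cmod (f (\<Phi> i)) \<le> C * (\<Sum>bs\<in>multi_indices N. \<bar>B bs\<bar>)" for i
    by (intro bound smooth_rapid_imp_schwartz[OF \<Phi>]) blast
  then show ?thesis by blast
qed

section \<open>The Gaussian\<close>

definition gaussian :: "'a::euclidean_space \<Rightarrow> complex" where
  "gaussian x = of_real (exp (- pi * (norm x)\<^sup>2))"

lemma norm_gaussian: "cmod (gaussian x) = exp (- pi * (norm x)\<^sup>2)"
  by (simp add: gaussian_def)

lemma partial_deriv_gaussian:
  "gaussian differentiable at (x::'a::euclidean_space)"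
  "partial_deriv b gaussian x = of_real (x \<bullet> (- (2 * pi) *\<^sub>R b)) * gaussian x"
proof -
  have "((\<lambda>x::'a. complex_of_real (exp (- pi * (x \<bullet> x)))) has_derivative
     (\<lambda>h. complex_of_real (exp (- pi * (x \<bullet> x)) * (- pi * (x \<bullet> h + h \<bullet> x))))) (at x)"
    by (auto intro!: derivative_eq_intros simp: fun_eq_iff)
  then have *: "(gaussian has_derivative
     (\<lambda>h. complex_of_real (exp (- pi * (x \<bullet> x)) * (- pi * (x \<bullet> h + h \<bullet> x))))) (at x)"
    by (simp add: gaussian_def[abs_def] power2_norm_eq_inner)
  then show "gaussian differentiable at x" by (auto simp: differentiable_def)
  show "partial_deriv b gaussian x = of_real (x \<bullet> (- (2 * pi) *\<^sub>R b)) * gaussian x"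
    using partial_deriv_eq[OF *] by (simp add: gaussian_def power2_norm_eq_inner inner_commute)
qed

text \<open>By \<open>1 + r \<le> exp r\<close> and \<open>1 \<le> \<pi>\<close>, the product is at most \<open>exp (k r - r\<^sup>2)\<close>, whose exponent never
  exceeds \<open>k\<^sup>2\<close>.\<close>

lemma rapid_gaussian: "rapid (\<lambda>i (x::'a::euclidean_space). gaussian x)"
  unfolding rapid_def
proof
  fix k
  have "(1 + norm x) ^ k * cmod (gaussian x) \<le> exp (real k ^ 2)" for x :: 'a
  proof -
    have "(1 + norm x) ^ k \<le> exp (real k * norm x)"
      using power_mono[OF exp_ge_add_one_self, of "norm x" k] by (simp add: exp_of_nat_mult)
    then have "(1 + norm x) ^ k * cmod (gaussian x) \<le> exp (real k * norm x) * exp (- pi * (norm x)\<^sup>2)"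
      by (simp add: norm_gaussian mult_right_mono)
    also have "\<dots> = exp (real k * norm x - pi * (norm x)\<^sup>2)"
      by (simp add: exp_add[symmetric])
    also have "\<dots> \<le> exp (real k ^ 2)"
    proof -
      have "1 * (norm x)\<^sup>2 \<le> pi * (norm x)\<^sup>2"
        using pi_ge_two by (intro mult_right_mono) auto
      moreover have "0 \<le> (real k - norm x)\<^sup>2 + real k * norm x"
        by simp
      ultimately show ?thesis
        by (simp add: power2_diff)
    qed
    finally show ?thesis .
  qed
  then show "\<exists>B. \<forall>(i::'b) (x::'a). (1 + norm x) ^ k * cmod (gaussian x) \<le> B" by blast
qed

text \<open>The class of all products of a multiplier with the Gaussian is closed under differentiation, since a
  partial derivative of the Gaussian is a linear function times the Gaussian.\<close>

lemma schwartz_gaussian: "gaussian \<in> schwartz"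
  unfolding schwartz_iff
proof (rule smooth_family_coinduct[of "\<lambda>\<Phi>. \<exists>q. smooth_family slow q \<and> \<Phi> = (\<lambda>i x. q i x * gaussian x)"])
  show "\<exists>q. smooth_family slow q \<and> (\<lambda>_::unit. gaussian) = (\<lambda>i x. q i x * gaussian x)"
    using smooth_slow_const[of 1] by (intro exI[of _ "\<lambda>_ _. 1"]) auto
next
  fix \<Phi> :: "unit \<Rightarrow> 'a \<Rightarrow> complex"
  assume "\<exists>q. smooth_family slow q \<and> \<Phi> = (\<lambda>i x. q i x * gaussian x)"
  then obtain q where q: "smooth_family slow q" and \<Phi>: "\<Phi> = (\<lambda>i x. q i x * gaussian x)" by blast
  show "\<Phi> i differentiable at x" for i x
    unfolding \<Phi> by (intro differentiable_mult smooth_family_differentiable[OF q] partial_deriv_gaussian)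
  show "rapid \<Phi>"
    unfolding \<Phi> by (intro rapid_slow_mult smooth_family_growth[OF q] rapid_gaussian)
  show "\<exists>q. smooth_family slow q \<and> (\<lambda>i. partial_deriv b (\<Phi> i)) = (\<lambda>i x. q i x * gaussian x)"
    if "b \<in> Basis" for b
    using smooth_slow_add[OF smooth_family_deriv[OF q that] smooth_slow_mult[OF q
        smooth_slow_coord[of "- (2 * pi) *\<^sub>R b"]]]
    by (intro exI conjI, assumption)
      (simp add: fun_eq_iff \<Phi> partial_deriv_mult smooth_family_differentiable[OF q]
        partial_deriv_gaussian algebra_simps)
qed

section \<open>Integrals over Euclidean space\<close>

text \<open>The integrand is at most \<open>(n + 1)\<close> to the power \<open>-(d + 2)\<close> on the shell \<open>n \<le> |x| < n + 1\<close>, which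
  lies in a ball of volume proportional to \<open>(n + 1)\<^sup>d\<close>; this leaves the series of \<open>(n + 1)\<close> to the
  power \<open>-2\<close>.\<close>

lemma integrable_inverse_power:
  "integrable lborel (\<lambda>x::'a::euclidean_space. 1 / (1 + norm x) ^ (DIM('a) + 2))"
proof (rule integrableI_bounded)
  let ?d = "DIM('a)"
  let ?V = "unit_ball_vol (real ?d)"
  have le: "ennreal (1 / (1 + norm x) ^ (?d + 2))
      \<le> (\<Sum>n. ennreal (1 / (1 + real n) ^ (?d + 2)) * indicator (ball 0 (1 + real n)) x)" for x :: 'a
  proof -
    define n where "n = nat \<lfloor>norm x\<rfloor>"
    have n: "real n \<le> norm x" "norm x < 1 + real n"
      unfolding n_def by (simp_all add: of_nat_nat) linarith
    have "ennreal (1 / (1 + norm x) ^ (?d + 2)) \<le> ennreal (1 / (1 + real n) ^ (?d + 2)) * indicator (ball 0 (1 + real n)) x"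
    proof -
      have "(1 + real n) ^ (?d + 2) \<le> (1 + norm x) ^ (?d + 2)"
        using n by (intro power_mono) auto
      then have "1 / (1 + norm x) ^ (?d + 2) \<le> 1 / (1 + real n) ^ (?d + 2)"
        by (intro divide_left_mono mult_pos_pos zero_less_power) (auto intro: add_pos_nonneg)
      then show ?thesis
        using n by (simp add: ennreal_leI del: power_Suc add_2_eq_Suc')
    qed
    also have "\<dots> \<le> (\<Sum>n. ennreal (1 / (1 + real n) ^ (?d + 2)) * indicator (ball 0 (1 + real n)) x)"
    proof -
      have "u n \<le> suminf u" for u :: "nat \<Rightarrow> ennreal"
        using sum_le_suminf[of u "{n}"] by simp
      then show ?thesis .
    qed
    finally show ?thesis .
  qed
  have "(\<integral>\<^sup>+(x::'a). ennreal (norm (1 / (1 + norm x) ^ (?d + 2))) \<partial>lborel)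
      = (\<integral>\<^sup>+(x::'a). ennreal (1 / (1 + norm x) ^ (?d + 2)) \<partial>lborel)"
    by simp
  also have "\<dots> \<le> (\<integral>\<^sup>+(x::'a). (\<Sum>n. ennreal (1 / (1 + real n) ^ (?d + 2)) * indicator (ball 0 (1 + real n)) x) \<partial>lborel)"
    by (intro nn_integral_mono le)
  also have "\<dots> = (\<Sum>n. ennreal (1 / (1 + real n) ^ (?d + 2)) * emeasure lborel (ball (0::'a) (1 + real n)))"
    by (subst nn_integral_suminf)
      (measurable, simp_all add: nn_integral_cmult_indicator del: power_Suc add_2_eq_Suc')
  also have "\<dots> = (\<Sum>n. ennreal (?V * (1 / real (Suc n) ^ 2)))"
  proof (intro suminf_cong)
    fix n
    have "1 / w ^ (?d + 2) * (?V * w ^ ?d) = ?V * (1 / w ^ 2)" if "0 < w" for w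
      using that by (simp add: power_add power2_eq_square)
    from this[of "1 + real n"]
    show "ennreal (1 / (1 + real n) ^ (?d + 2)) * emeasure lborel (ball (0::'a) (1 + real n)) =
        ennreal (?V * (1 / real (Suc n) ^ 2))"
      by (simp add: emeasure_ball ennreal_mult[symmetric] add.commute del: power_Suc add_2_eq_Suc')
  qed
  also have "\<dots> < \<infinity>"
  proof -
    have "summable (\<lambda>n. ?V * (1 / real (Suc n) ^ 2))"
      using inverse_power_summable[of 2, where 'a=real]
      by (intro summable_mult) (subst summable_Suc_iff, simp add: field_simps)
    then show ?thesis
      by (subst suminf_ennreal2) auto
  qed
  finally show "(\<integral>\<^sup>+(x::'a). ennreal (norm (1 / (1 + norm x) ^ (?d + 2))) \<partial>lborel) < \<infinity>" .
qed measurable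

lemma schwartz_integrable_weight:
  fixes \<phi> :: "'a::euclidean_space \<Rightarrow> complex"
  assumes \<phi>: "\<phi> \<in> schwartz"
  shows "integrable lborel (\<lambda>x. (1 + norm x) ^ k * cmod (\<phi> x))"
proof -
  note [measurable] = schwartz_measurable[OF \<phi>]
  obtain B where B: "0 < B" "\<And>x. (1 + norm x) ^ (k + (DIM('a) + 2)) * cmod (\<phi> x) \<le> B"
    using schwartz_bound[OF \<phi>] by metis
  show ?thesis
  proof (rule Bochner_Integration.integrable_bound[OF integrable_mult_right[OF integrable_inverse_power, of B]])
    have "(1 + norm x) ^ k * cmod (\<phi> x) \<le> B * (1 / (1 + norm x) ^ (DIM('a) + 2))" for x
      using B(2)[of x]
      by (subst (asm) power_add) (simp add: field_simps add_pos_nonneg del: power_Suc add_2_eq_Suc')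
    then show "AE x in lborel. norm ((1 + norm x) ^ k * cmod (\<phi> x)) \<le> norm (B * (1 / (1 + norm x) ^ (DIM('a) + 2)))"
      using B(1) by (intro AE_I2) (simp add: norm_mult)
  qed measurable
qed

lemma schwartz_integrable: "\<phi> \<in> schwartz \<Longrightarrow> integrable lborel \<phi>"
  using schwartz_integrable_weight[of \<phi> 0] schwartz_measurable[of \<phi>] by (simp add: integrable_norm_iff)

lemma rapid_integral_bound:
  fixes \<Phi> :: "'i \<Rightarrow> 'a::euclidean_space \<Rightarrow> complex"
  assumes "rapid \<Phi>"
  shows "\<exists>B. \<forall>i. (LINT x|lborel. cmod (\<Phi> i x)) \<le> B"
proof -
  obtain B where B: "0 < B" "\<And>i x. (1 + norm x) ^ (DIM('a) + 2) * cmod (\<Phi> i x) \<le> B"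
    using rapidE[OF assms] by metis
  have "cmod (\<Phi> i x) \<le> B * (1 / (1 + norm x) ^ (DIM('a) + 2))" for i x
    using B(2)[of x i] by (simp add: field_simps add_pos_nonneg del: power_Suc)
  then have "(LINT x|lborel. cmod (\<Phi> i x)) \<le> (LINT x|lborel. B * (1 / (1 + norm (x::'a)) ^ (DIM('a) + 2)))" for i
    using B(1)
    by (intro integral_mono_AE' integrable_mult_right[OF integrable_inverse_power]) auto
  then show ?thesis by blast
qed

lemma lborel_integrable_affine:
  fixes g :: "'a::euclidean_space \<Rightarrow> 'b::{banach, second_countable_topology}"
  assumes "integrable lborel g" "s \<noteq> 0"
  shows "integrable lborel (\<lambda>x. g (a + s *\<^sub>R x))"
proof -
  note [measurable] = borel_measurable_integrable[OF assms(1)]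
  have "integrable (density (distr lborel borel (\<lambda>x. a + s *\<^sub>R x)) (\<lambda>_. ennreal (\<bar>s\<bar> ^ DIM('a)))) g"
    using assms lborel_affine[of s a] by (simp add: ennreal_power)
  then have "integrable lborel (\<lambda>x. \<bar>s\<bar> ^ DIM('a) *\<^sub>R g (a + s *\<^sub>R x))"
    using assms(2) by (simp add: integrable_density integrable_distr_eq)
  from integrable_scaleR_right[OF this, of "inverse (\<bar>s\<bar> ^ DIM('a))"] show ?thesis
    using assms(2) by simp
qed

lemma lborel_integral_affine:
  fixes g :: "'a::euclidean_space \<Rightarrow> 'b::{banach, second_countable_topology}"
  assumes [measurable]: "g \<in> borel_measurable borel" and "s \<noteq> 0"
  shows "(LINT x|lborel. g x) = \<bar>s\<bar> ^ DIM('a) *\<^sub>R (LINT x|lborel. g (a + s *\<^sub>R x))"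
proof -
  have "(LINT x|lborel. g x)
      = (LINT x|density (distr lborel borel (\<lambda>x. a + s *\<^sub>R x)) (\<lambda>_. ennreal (\<bar>s\<bar> ^ DIM('a))). g x)"
    using lborel_affine[of s a] assms(2) by (simp add: ennreal_power)
  also have "\<dots> = \<bar>s\<bar> ^ DIM('a) *\<^sub>R (LINT x|lborel. g (a + s *\<^sub>R x))"
    by (simp add: integral_density integral_distr)
  finally show ?thesis .
qed

text \<open>Differentiation under the integral sign. By the mean value inequality the difference quotients are
  dominated by \<open>2 G\<close>, so dominated convergence applies along every sequence \<open>z \<longlonglongrightarrow> z0\<close>.\<close>

lemma has_derivative_integral:
  fixes K :: "'a::euclidean_space \<Rightarrow> 'b \<Rightarrow> complex"
  assumes deriv: "\<And>z y. z \<in> ball z0 1 \<Longrightarrow> ((\<lambda>z. K z y) has_derivative K' z y) (at z)"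
    and int: "\<And>z. integrable M (K z)"
    and meas: "\<And>v. (\<lambda>y. K' z0 y v) \<in> borel_measurable M"
    and bound: "\<And>z y v. z \<in> ball z0 1 \<Longrightarrow> cmod (K' z y v) \<le> G y * norm v"
    and G: "integrable M G"
  shows "((\<lambda>z. LINT y|M. K z y) has_derivative (\<lambda>v. LINT y|M. K' z0 y v)) (at z0)"
    and "\<And>v. integrable M (\<lambda>y. K' z0 y v)"
proof -
  have z0: "z0 \<in> ball z0 1" by simp
  show int': "integrable M (\<lambda>y. K' z0 y v)" for v
  proof (rule Bochner_Integration.integrable_bound[OF integrable_mult_left[OF G, of "norm v"] meas])
    show "AE y in M. norm (K' z0 y v) \<le> norm (G y * norm v)"
      using order_trans[OF bound[OF z0] abs_ge_self] by simp
  qed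
  have lin: "linear (K' z0 y)" for y
    using deriv[OF z0] by (meson has_derivative_bounded_linear bounded_linear.linear)
  show "((\<lambda>z. LINT y|M. K z y) has_derivative (\<lambda>v. LINT y|M. K' z0 y v)) (at z0)"
    unfolding has_derivative_iff_norm
  proof
    have "linear (\<lambda>v. LINT y|M. K' z0 y v)"
      by (rule linearI) (simp_all add: linear_add[OF lin] linear_scale[OF lin] int')
    then show "bounded_linear (\<lambda>v. LINT y|M. K' z0 y v)"
      by (rule linear_conv_bounded_linear[THEN iffD1])
    show "((\<lambda>z. norm ((LINT y|M. K z y) - (LINT y|M. K z0 y) - (LINT y|M. K' z0 y (z - z0))) / norm (z - z0)) \<longlongrightarrow> 0) (at z0)"
      unfolding tendsto_at_iff_sequentially comp_def
    proof (intro allI impI)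
      fix X :: "nat \<Rightarrow> 'a" assume X: "\<forall>i. X i \<in> UNIV - {z0}" "X \<longlonglongrightarrow> z0"
      from X(2) have "eventually (\<lambda>n. X n \<in> ball z0 1) sequentially"
        by (rule topological_tendstoD) auto
      then obtain n0 where n0: "\<And>n. n0 \<le> n \<Longrightarrow> X n \<in> ball z0 1"
        by (auto simp: eventually_sequentially)
      define q where "q n y = (K (X (n + n0)) y - K z0 y - K' z0 y (X (n + n0) - z0)) /\<^sub>R norm (X (n + n0) - z0)" for n y
      have q_int: "integrable M (q n)" for n
        unfolding q_def by (intro integrable_scaleR_right Bochner_Integration.integrable_diff int int')
      have "(\<lambda>n. LINT y|M. q n y) \<longlonglongrightarrow> (LINT y|M. 0)"
      proof (rule integral_dominated_convergence)
        show "integrable M (\<lambda>y. 2 * G y)" using G by simp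
        show "AE y in M. (\<lambda>n. q n y) \<longlonglongrightarrow> 0"
        proof (rule AE_I2)
          fix y
          have "((\<lambda>z. (K z y - K z0 y - K' z0 y (z - z0)) /\<^sub>R norm (z - z0)) \<longlongrightarrow> 0) (at z0)"
            using deriv[OF z0, of y] unfolding has_derivative_at_within by simp
          from this[unfolded tendsto_at_iff_sequentially, rule_format, of X] X
          have "(\<lambda>n. (K (X n) y - K z0 y - K' z0 y (X n - z0)) /\<^sub>R norm (X n - z0)) \<longlonglongrightarrow> 0"
            by (simp add: comp_def)
          then show "(\<lambda>n. q n y) \<longlonglongrightarrow> 0"
            unfolding q_def by (rule LIMSEQ_ignore_initial_segment)
        qed
        show "AE y in M. norm (q n y) \<le> 2 * G y" for n
        proof (rule AE_I2)
          fix y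
          have Xn: "X (n + n0) \<in> ball z0 1" using n0 by simp
          have pos: "0 < norm (X (n + n0) - z0)" using X(1) by simp
          have "cmod (K (X (n + n0)) y - K z0 y) \<le> G y * norm (X (n + n0) - z0)"
          proof (rule differentiable_bound[OF convex_ball _ _ Xn z0])
            fix z assume z: "z \<in> ball z0 1"
            show "((\<lambda>z. K z y) has_derivative K' z y) (at z within ball z0 1)"
              using deriv[OF z] by (rule has_derivative_at_withinI)
            show "onorm (K' z y) \<le> G y"
              using bound[OF z] by (rule onorm_le)
          qed
          with bound[OF z0, of y "X (n + n0) - z0"] norm_triangle_ineq4[of "K (X (n + n0)) y - K z0 y"]
          have "cmod (K (X (n + n0)) y - K z0 y - K' z0 y (X (n + n0) - z0)) \<le> 2 * G y * norm (X (n + n0) - z0)"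
            by (smt (verit) ring_class.ring_distribs)
          then show "norm (q n y) \<le> 2 * G y"
            using pos by (simp add: q_def inverse_eq_divide pos_divide_le_eq)
        qed
      qed (use q_int in auto)
      then have "(\<lambda>n. norm (LINT y|M. q n y)) \<longlonglongrightarrow> 0"
        using tendsto_norm_zero by simp
      moreover have "norm (LINT y|M. q n y) = norm ((LINT y|M. K (X (n + n0)) y) - (LINT y|M. K z0 y)
          - (LINT y|M. K' z0 y (X (n + n0) - z0))) / norm (X (n + n0) - z0)" for n
        by (simp add: q_def int int' norm_divide divide_inverse mult.commute)
      ultimately have "(\<lambda>n. norm ((LINT y|M. K (X (n + n0)) y) - (LINT y|M. K z0 y)
          - (LINT y|M. K' z0 y (X (n + n0) - z0))) / norm (X (n + n0) - z0)) \<longlonglongrightarrow> 0" by simp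
      then show "(\<lambda>n. norm ((LINT y|M. K (X n) y) - (LINT y|M. K z0 y)
          - (LINT y|M. K' z0 y (X n - z0))) / norm (X n - z0)) \<longlonglongrightarrow> 0"
        by (rule LIMSEQ_offset)
    qed
  qed
qed

section \<open>The Fourier transform\<close>

text \<open>The kernel of the Fourier transform. It is symmetric and, in each argument, a multiplier.\<close>

definition wave :: "'a::euclidean_space \<Rightarrow> 'a \<Rightarrow> complex" where
  "wave \<xi> x = exp (- (2 * of_real pi * \<i> * of_real (x \<bullet> \<xi>)))"

lemma fourier_wave: "fourier \<phi> \<xi> = (LINT x|lborel. wave \<xi> x * \<phi> x)"
  by (simp add: fourier_def wave_def)

lemma norm_wave [simp]: "cmod (wave \<xi> x) = 1"
  by (simp add: wave_def)

lemma wave_commute: "wave \<xi> x = wave x \<xi>"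
  by (simp add: wave_def inner_commute)

lemma wave_add: "wave \<xi> (x + y) = wave \<xi> x * wave \<xi> y"
  by (simp add: wave_def inner_add_left algebra_simps flip: exp_add)

lemma wave_scale: "wave \<xi> (s *\<^sub>R x) = wave (s *\<^sub>R \<xi>) x"
  by (simp add: wave_def)

lemma wave_measurable [measurable]:
  assumes [measurable]: "f \<in> M \<rightarrow>\<^sub>M borel" "g \<in> M \<rightarrow>\<^sub>M borel"
  shows "(\<lambda>x. wave (f x) (g x)) \<in> borel_measurable M"
  unfolding wave_def by measurable

lemma has_derivative_wave:
  "((\<lambda>\<xi>. wave \<xi> x) has_derivative (\<lambda>v. - (2 * of_real pi * \<i> * of_real (x \<bullet> v)) * wave \<xi> x)) (at \<xi>)"
proof -
  have "((\<lambda>\<xi>. - (2 * of_real pi * \<i> * of_real (x \<bullet> \<xi>))) has_derivative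
      (\<lambda>v. - (2 * of_real pi * \<i> * of_real (x \<bullet> v)))) (at \<xi>)"
    by (auto intro!: derivative_eq_intros)
  from has_derivative_compose[OF this DERIV_exp[THEN has_field_derivative_imp_has_derivative]]
  show ?thesis
    unfolding wave_def by (simp only: mult.commute)
qed

lemma integrable_wave_mult:
  assumes "integrable lborel u"
  shows "integrable lborel (\<lambda>x. wave \<xi> x * u x)"
proof -
  note [measurable] = borel_measurable_integrable[OF assms]
  show ?thesis
    by (rule Bochner_Integration.integrable_bound[OF assms]) (auto simp: norm_mult)
qed

lemma norm_fourier_le: "cmod (fourier u \<xi>) \<le> (LINT x|lborel. cmod (u x))"
  unfolding fourier_wave
  using integral_norm_bound[of lborel "\<lambda>x. wave \<xi> x * u x"] by (simp add: norm_mult)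

lemma continuous_on_fourier:
  fixes u :: "'a::euclidean_space \<Rightarrow> complex"
  assumes "integrable lborel u"
  shows "continuous_on UNIV (fourier u)"
proof (clarsimp simp: continuous_on_sequentially comp_def)
  fix X :: "nat \<Rightarrow> 'a" and \<xi> assume X: "X \<longlonglongrightarrow> \<xi>"
  note [measurable] = borel_measurable_integrable[OF assms]
  show "(\<lambda>n. fourier u (X n)) \<longlonglongrightarrow> fourier u \<xi>"
    unfolding fourier_wave
  proof (rule integral_dominated_convergence[where w="\<lambda>x. cmod (u x)"])
    show "AE x in lborel. (\<lambda>n. wave (X n) x * u x) \<longlonglongrightarrow> wave \<xi> x * u x"
      unfolding wave_def by (intro AE_I2 tendsto_intros X)
  qed (use assms in \<open>auto simp: norm_mult\<close>)
qed

lemma integral_fourier_mult: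
  fixes u w :: "'a::euclidean_space \<Rightarrow> complex"
  assumes u: "integrable lborel u" and w: "integrable lborel w"
  shows "(LINT \<xi>|lborel. fourier u \<xi> * w \<xi>) = (LINT x|lborel. u x * fourier w x)"
proof -
  note [measurable] = borel_measurable_integrable[OF u] borel_measurable_integrable[OF w]
  have "integrable (lborel \<Otimes>\<^sub>M lborel) (\<lambda>(x, \<xi>). wave \<xi> x * u x * w \<xi>)"
  proof (rule lborel_pair.Fubini_integrable)
    show "integrable lborel (\<lambda>x. LINT \<xi>|lborel. norm (case (x, \<xi>) of (x, \<xi>) \<Rightarrow> wave \<xi> x * u x * w \<xi>))"
      using u by (simp add: norm_mult)
    show "AE x in lborel. integrable lborel (\<lambda>\<xi>. case (x, \<xi>) of (x, \<xi>) \<Rightarrow> wave \<xi> x * u x * w \<xi>)"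
    proof (rule AE_I2)
      fix x
      show "integrable lborel (\<lambda>\<xi>. case (x, \<xi>) of (x, \<xi>) \<Rightarrow> wave \<xi> x * u x * w \<xi>)"
        using integrable_mult_right[OF integrable_wave_mult[OF w, of x], of "u x"]
        by (simp add: wave_commute[of _ x] mult_ac)
    qed
  qed measurable
  from lborel_pair.Fubini_integral[OF this]
  have "(LINT \<xi>|lborel. LINT x|lborel. wave \<xi> x * u x * w \<xi>) = (LINT x|lborel. LINT \<xi>|lborel. wave \<xi> x * u x * w \<xi>)" .
  moreover have "(LINT x|lborel. wave \<xi> x * u x * w \<xi>) = fourier u \<xi> * w \<xi>" for \<xi>
    by (simp add: fourier_wave)
  moreover have "(LINT \<xi>|lborel. wave \<xi> x * u x * w \<xi>) = u x * fourier w x" for x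
    unfolding fourier_wave integral_mult_right_zero[symmetric] by (simp add: wave_commute[of _ x] mult_ac)
  ultimately show ?thesis by (simp only:)
qed

lemma integrable_fourier_mult:
  fixes u w :: "'a::euclidean_space \<Rightarrow> complex"
  assumes u: "integrable lborel u" and w: "integrable lborel w"
  shows "integrable lborel (\<lambda>\<xi>. fourier u \<xi> * w \<xi>)"
proof (rule Bochner_Integration.integrable_bound[OF integrable_mult_right[OF integrable_norm[OF w], of "LINT x|lborel. cmod (u x)"]])
  note [measurable] = borel_measurable_integrable[OF w]
    borel_measurable_continuous_onI[OF continuous_on_fourier[OF u]]
  show "(\<lambda>\<xi>. fourier u \<xi> * w \<xi>) \<in> borel_measurable lborel" by measurable
  show "AE \<xi> in lborel. norm (fourier u \<xi> * w \<xi>) \<le> norm ((LINT x|lborel. cmod (u x)) * norm (w \<xi>))"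
    by (auto simp: norm_mult norm_fourier_le intro!: mult_right_mono AE_I2 order_trans[OF norm_fourier_le abs_ge_self])
qed

lemma partial_deriv_fourier:
  fixes \<phi> :: "'a::euclidean_space \<Rightarrow> complex"
  assumes \<phi>: "\<phi> \<in> schwartz"
  shows "fourier \<phi> differentiable at \<xi>"
    and "partial_deriv b (fourier \<phi>) \<xi> = fourier (\<lambda>x. - (2 * of_real pi * \<i>) * (of_real (x \<bullet> b) * \<phi> x)) \<xi>"
proof -
  note [measurable] = schwartz_measurable[OF \<phi>]
  have "((\<lambda>\<xi>. LINT x|lborel. wave \<xi> x * \<phi> x) has_derivative
      (\<lambda>v. LINT x|lborel. - (2 * of_real pi * \<i> * of_real (x \<bullet> v)) * wave \<xi> x * \<phi> x)) (at \<xi>)"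
  proof (rule has_derivative_integral[where G="\<lambda>x. 2 * pi * ((1 + norm x) ^ 1 * cmod (\<phi> x))"])
    show "((\<lambda>z. wave z x * \<phi> x) has_derivative (\<lambda>v. - (2 * of_real pi * \<i> * of_real (x \<bullet> v)) * wave z x * \<phi> x)) (at z)" for z x
      by (rule has_derivative_mult_left[OF has_derivative_wave])
    show "integrable lborel (\<lambda>x. wave z x * \<phi> x)" for z
      by (intro integrable_wave_mult schwartz_integrable \<phi>)
    show "cmod (- (2 * of_real pi * \<i> * of_real (x \<bullet> v)) * wave z x * \<phi> x)
        \<le> 2 * pi * ((1 + norm x) ^ 1 * cmod (\<phi> x)) * norm v" for z x v
    proof -
      have "\<bar>x \<bullet> v\<bar> \<le> (1 + norm x) * norm v"
        using Cauchy_Schwarz_ineq2[of x v] by (simp add: distrib_right) (smt (verit) norm_ge_zero)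
      then have "2 * pi * cmod (\<phi> x) * \<bar>x \<bullet> v\<bar> \<le> 2 * pi * cmod (\<phi> x) * ((1 + norm x) * norm v)"
        by (intro mult_left_mono) auto
      also have "2 * pi * cmod (\<phi> x) * \<bar>x \<bullet> v\<bar> =
          cmod (- (2 * of_real pi * \<i> * of_real (x \<bullet> v)) * wave z x * \<phi> x)"
        by (simp add: norm_mult)
      also have "2 * pi * cmod (\<phi> x) * ((1 + norm x) * norm v) =
          2 * pi * ((1 + norm x) ^ 1 * cmod (\<phi> x)) * norm v"
        by simp
      finally show ?thesis .
    qed
    show "integrable lborel (\<lambda>x. 2 * pi * ((1 + norm x) ^ 1 * cmod (\<phi> x)))"
      by (intro integrable_mult_right schwartz_integrable_weight \<phi>)
  qed measurable
  then have *: "(fourier \<phi> has_derivative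
      (\<lambda>v. LINT x|lborel. - (2 * of_real pi * \<i> * of_real (x \<bullet> v)) * wave \<xi> x * \<phi> x)) (at \<xi>)"
    by (simp add: fourier_wave[abs_def])
  then show "fourier \<phi> differentiable at \<xi>" by (auto simp: differentiable_def)
  show "partial_deriv b (fourier \<phi>) \<xi> = fourier (\<lambda>x. - (2 * of_real pi * \<i>) * (of_real (x \<bullet> b) * \<phi> x)) \<xi>"
    unfolding partial_deriv_eq[OF *] fourier_wave by (intro Bochner_Integration.integral_cong) (auto simp: mult_ac)
qed

text \<open>The integral of a translate \<open>\<phi>(x + s b)\<close> does not depend on \<open>s\<close>; its derivative at \<open>s = 0\<close>, taken
  under the integral, is the integral of the partial derivative.\<close>

lemma integral_partial_deriv:
  fixes \<phi> :: "'a::euclidean_space \<Rightarrow> complex"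
  assumes \<phi>: "\<phi> \<in> schwartz" and b: "b \<in> Basis"
  shows "(LINT x|lborel. partial_deriv b \<phi> x) = 0"
proof -
  let ?d = "DIM('a) + 2"
  have D\<phi>: "partial_deriv b \<phi> \<in> schwartz" using \<phi> b by (rule schwartz_deriv)
  note [measurable] = schwartz_measurable[OF \<phi>] schwartz_measurable[OF D\<phi>]
  obtain B where B: "0 < B" "\<And>x. (1 + norm x) ^ ?d * cmod (partial_deriv b \<phi> x) \<le> B"
    using schwartz_bound[OF D\<phi>] by metis
  have "((\<lambda>s::real. LINT x|lborel. \<phi> (x + s *\<^sub>R b)) has_derivative
      (\<lambda>v. LINT x|lborel. v *\<^sub>R partial_deriv b \<phi> (x + 0 *\<^sub>R b))) (at 0)"
  proof (rule has_derivative_integral[where G="\<lambda>x. (B * 2 ^ ?d) * (1 / (1 + norm x) ^ ?d)"])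
    show "((\<lambda>s. \<phi> (x + s *\<^sub>R b)) has_derivative (\<lambda>v. v *\<^sub>R partial_deriv b \<phi> (x + s *\<^sub>R b))) (at s)" for s x
    proof -
      have 1: "((\<lambda>s. x + s *\<^sub>R b) has_derivative (\<lambda>v. v *\<^sub>R b)) (at s)"
        by (auto intro!: derivative_eq_intros)
      have "((\<lambda>s. \<phi> (x + s *\<^sub>R b)) has_derivative
          (\<lambda>v. \<Sum>c\<in>Basis. ((v *\<^sub>R b) \<bullet> c) *\<^sub>R partial_deriv c \<phi> (x + s *\<^sub>R b))) (at s)"
        by (rule has_derivative_compose[OF 1 has_derivative_partial_deriv[OF schwartz_differentiable[OF \<phi>]]])
      moreover have "(\<Sum>c\<in>Basis. ((v *\<^sub>R b) \<bullet> c) *\<^sub>R partial_deriv c \<phi> y) = v *\<^sub>R partial_deriv b \<phi> y" for v y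
        using sum_inner_Basis_scaleR[OF b, of "\<lambda>c. partial_deriv c \<phi> y"]
        by (simp add: scaleR_sum_right[symmetric] flip: scaleR_scaleR)
      ultimately show ?thesis by simp
    qed
    show "integrable lborel (\<lambda>x. \<phi> (x + s *\<^sub>R b))" for s
      using lborel_integrable_affine[OF schwartz_integrable[OF \<phi>], of 1 "s *\<^sub>R b"] by (simp add: add.commute)
    show "cmod (v *\<^sub>R partial_deriv b \<phi> (x + s *\<^sub>R b)) \<le> (B * 2 ^ ?d) * (1 / (1 + norm x) ^ ?d) * norm v"
      if "s \<in> ball 0 1" for s x v
    proof -
      have "norm x \<le> norm (x + s *\<^sub>R b) + norm (s *\<^sub>R b)"
        using norm_triangle_ineq4[of "x + s *\<^sub>R b" "s *\<^sub>R b"] by simp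
      then have "1 + norm x \<le> 2 * (1 + norm (x + s *\<^sub>R b))"
        using that b by simp (smt (verit) norm_ge_zero)
      then have "(1 + norm x) ^ ?d \<le> (2 * (1 + norm (x + s *\<^sub>R b))) ^ ?d"
        by (intro power_mono) auto
      then have "(1 + norm x) ^ ?d * cmod (partial_deriv b \<phi> (x + s *\<^sub>R b))
          \<le> (2 * (1 + norm (x + s *\<^sub>R b))) ^ ?d * cmod (partial_deriv b \<phi> (x + s *\<^sub>R b))"
        by (intro mult_right_mono) auto
      also have "\<dots> = 2 ^ ?d * ((1 + norm (x + s *\<^sub>R b)) ^ ?d * cmod (partial_deriv b \<phi> (x + s *\<^sub>R b)))"
        by (simp only: power_mult_distrib mult.assoc)
      also have "\<dots> \<le> 2 ^ ?d * B"
        by (intro mult_left_mono B) auto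
      finally have "cmod (partial_deriv b \<phi> (x + s *\<^sub>R b)) \<le> (B * 2 ^ ?d) * (1 / (1 + norm x) ^ ?d)"
        by (subst times_divide_eq_right, subst pos_le_divide_eq)
          (auto simp: mult_ac intro!: zero_less_power add_pos_nonneg simp del: power_Suc add_2_eq_Suc')
      from mult_left_mono[OF this, of "\<bar>v\<bar>"] show ?thesis by (simp add: mult_ac del: power_Suc add_2_eq_Suc')
    qed
    show "integrable lborel (\<lambda>x::'a. (B * 2 ^ ?d) * (1 / (1 + norm x) ^ ?d))"
      by (intro integrable_mult_right integrable_inverse_power)
  qed measurable
  moreover have "(LINT x|lborel. \<phi> (x + s *\<^sub>R b)) = (LINT x|lborel. \<phi> x)" for s
    using lborel_integral_affine[of \<phi> 1 "s *\<^sub>R b"] by (simp add: add.commute)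
  ultimately have "((\<lambda>s::real. LINT x|lborel. \<phi> x) has_derivative
      (\<lambda>v. LINT x|lborel. v *\<^sub>R partial_deriv b \<phi> (x + 0 *\<^sub>R b))) (at 0)" by simp
  from has_derivative_unique[OF this has_derivative_const]
  have "(LINT x|lborel. 1 *\<^sub>R partial_deriv b \<phi> (x + 0 *\<^sub>R b)) = 0"
    by (rule fun_cong)
  then show ?thesis by simp
qed

lemma partial_deriv_wave:
  "wave \<xi> differentiable at x"
  "partial_deriv b (wave \<xi>) x = - (2 * of_real pi * \<i> * of_real (\<xi> \<bullet> b)) * wave \<xi> x"
proof -
  have *: "(wave \<xi> has_derivative (\<lambda>v. - (2 * of_real pi * \<i> * of_real (\<xi> \<bullet> v)) * wave \<xi> x)) (at x)"
  proof -
    have w: "wave \<xi> = (\<lambda>y. wave y \<xi>)"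
      by (rule ext) (rule wave_commute)
    show ?thesis
      unfolding w by (rule has_derivative_wave)
  qed
  then show "wave \<xi> differentiable at x" by (auto simp: differentiable_def)
  show "partial_deriv b (wave \<xi>) x = - (2 * of_real pi * \<i> * of_real (\<xi> \<bullet> b)) * wave \<xi> x"
    by (rule partial_deriv_eq[OF *])
qed

lemma smooth_slow_wave:
  fixes \<xi> :: "'a::euclidean_space"
  shows "smooth_family slow (\<lambda>_::'b. wave \<xi>)"
proof (rule smooth_family_coinduct[of "\<lambda>\<Phi>. \<exists>c. \<Phi> = (\<lambda>i x. c * wave \<xi> x)"])
  show "\<exists>c. (\<lambda>_::'b. wave \<xi>) = (\<lambda>i x. c * wave \<xi> x)"
    by (rule exI[of _ 1]) simp
next
  fix \<Phi> :: "'b \<Rightarrow> 'a \<Rightarrow> complex"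
  assume "\<exists>c. \<Phi> = (\<lambda>i x. c * wave \<xi> x)"
  then obtain c where \<Phi>: "\<Phi> = (\<lambda>i x. c * wave \<xi> x)" by blast
  show "\<Phi> i differentiable at x" for i x
    unfolding \<Phi> by (intro differentiable_mult partial_deriv_wave) simp
  show "slow \<Phi>"
    unfolding \<Phi> slow_def by (intro exI[of _ 0] exI[of _ "cmod c"]) (simp add: norm_mult)
  show "\<exists>c. (\<lambda>i. partial_deriv b (\<Phi> i)) = (\<lambda>i x. c * wave \<xi> x)" for b
    by (rule exI[of _ "c * (- (2 * of_real pi * \<i> * of_real (\<xi> \<bullet> b)))"])
      (simp add: fun_eq_iff \<Phi> partial_deriv_cmult partial_deriv_wave)
qed

text \<open>Integration by parts: the function \<open>wave \<xi> \<cdot> \<phi>\<close> is a Schwartz function, so the integral of its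
  partial derivative vanishes.\<close>

lemma fourier_partial_deriv:
  assumes \<phi>: "\<phi> \<in> schwartz" and b: "b \<in> Basis"
  shows "fourier (partial_deriv b \<phi>) \<xi> = 2 * of_real pi * \<i> * of_real (\<xi> \<bullet> b) * fourier \<phi> \<xi>"
proof -
  have "(\<lambda>x. wave \<xi> x * \<phi> x) \<in> schwartz"
    using \<phi> unfolding schwartz_iff by (intro smooth_rapid_mult smooth_slow_wave)
  note int = integrable_wave_mult[OF schwartz_integrable[OF \<phi>]]
    integrable_wave_mult[OF schwartz_integrable[OF schwartz_deriv[OF \<phi> b]]]
  from integral_partial_deriv[OF \<open>(\<lambda>x. wave \<xi> x * \<phi> x) \<in> schwartz\<close> b]
  have "0 = (LINT x|lborel. - (2 * of_real pi * \<i> * of_real (\<xi> \<bullet> b)) * (wave \<xi> x * \<phi> x) + wave \<xi> x * partial_deriv b \<phi> x)"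
    by (simp add: partial_deriv_mult partial_deriv_wave schwartz_differentiable[OF \<phi>] mult.assoc)
  also have "\<dots> = - (2 * of_real pi * \<i> * of_real (\<xi> \<bullet> b)) * fourier \<phi> \<xi> + fourier (partial_deriv b \<phi>) \<xi>"
    unfolding fourier_wave
    by (subst Bochner_Integration.integral_add) (simp_all add: int)
  finally show ?thesis by (simp add: algebra_simps)
qed

text \<open>The Fourier transform maps bounded families to bounded families. A derivative of \<open>F\<phi>\<close> is the
  transform of \<open>\<phi>\<close> times a coordinate, hence of another bounded family, and each additional weight
  \<open>1 + |\<xi>| \<le> 1 + \<Sum>|\<xi>\<^sub>b|\<close> can be traded for transforms of partial derivatives.\<close>

lemma smooth_rapid_fourier:
  fixes \<Phi> :: "'i \<Rightarrow> 'a::euclidean_space \<Rightarrow> complex"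
  assumes "smooth_family rapid \<Phi>"
  shows "smooth_family rapid (\<lambda>i. fourier (\<Phi> i))"
proof (rule smooth_family_coinduct[of "\<lambda>\<Phi>. \<exists>\<Psi>. smooth_family rapid \<Psi> \<and> \<Phi> = (\<lambda>i. fourier (\<Psi> i))"])
  show "\<exists>\<Psi>. smooth_family rapid \<Psi> \<and> (\<lambda>i. fourier (\<Phi> i)) = (\<lambda>i. fourier (\<Psi> i))"
    using assms by blast
next
  fix \<Phi> :: "'i \<Rightarrow> 'a \<Rightarrow> complex"
  assume "\<exists>\<Psi>. smooth_family rapid \<Psi> \<and> \<Phi> = (\<lambda>i. fourier (\<Psi> i))"
  then obtain \<Psi> where \<Psi>: "smooth_family rapid \<Psi>" and \<Phi>: "\<Phi> = (\<lambda>i. fourier (\<Psi> i))" by blast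
  note s = smooth_rapid_imp_schwartz[OF \<Psi>]
  show "\<Phi> i differentiable at x" for i x
    unfolding \<Phi> by (intro partial_deriv_fourier s)
  show "\<exists>\<Psi>. smooth_family rapid \<Psi> \<and> (\<lambda>i. partial_deriv b (\<Phi> i)) = (\<lambda>i. fourier (\<Psi> i))" if "b \<in> Basis" for b
    using smooth_rapid_cmult[OF smooth_rapid_mult[OF smooth_slow_coord[of b] \<Psi>], of "- (2 * of_real pi * \<i>)"]
    by (intro exI[of _ "\<lambda>i x. - (2 * of_real pi * \<i>) * (of_real (x \<bullet> b) * \<Psi> i x)"])
      (simp add: fun_eq_iff \<Phi> partial_deriv_fourier s)
  \<comment> \<open>The family is generalised, since the induction on the weight passes to its partial derivatives.\<close>
  have "\<exists>B. \<forall>i \<xi>. (1 + norm \<xi>) ^ k * cmod (fourier (\<Psi> i) \<xi>) \<le> B" if "smooth_family rapid \<Psi>"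
    for k and \<Psi> :: "'i \<Rightarrow> 'a \<Rightarrow> complex"
    using that
  proof (induction k arbitrary: \<Psi>)
    case 0
    obtain B where "\<And>i. (LINT x|lborel. cmod (\<Psi> i x)) \<le> B"
      using rapid_integral_bound[OF smooth_family_growth[OF 0]] by blast
    then have "cmod (fourier (\<Psi> i) \<xi>) \<le> B" for i \<xi>
      using norm_fourier_le order_trans by blast
    then show ?case by auto
  next
    case (Suc k)
    have "\<exists>B. \<forall>i \<xi>. (1 + norm \<xi>) ^ k * cmod (fourier (partial_deriv b (\<Psi> i)) \<xi>) \<le> B"
      if "b \<in> Basis" for b
      by (rule Suc.IH[OF smooth_family_deriv[OF Suc.prems that]])
    then obtain B where B: "\<And>b i \<xi>. b \<in> Basis \<Longrightarrow> (1 + norm \<xi>) ^ k * cmod (fourier (partial_deriv b (\<Psi> i)) \<xi>) \<le> B b"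
      by metis
    obtain B0 where B0: "\<And>i \<xi>. (1 + norm \<xi>) ^ k * cmod (fourier (\<Psi> i) \<xi>) \<le> B0"
      using Suc.IH[OF Suc.prems] by blast
    have "(1 + norm \<xi>) ^ Suc k * cmod (fourier (\<Psi> i) \<xi>) \<le> B0 + (\<Sum>b\<in>Basis. B b)" for i \<xi>
    proof -
      let ?W = "(1 + norm \<xi>) ^ k"
      have "1 + norm \<xi> \<le> 1 + (\<Sum>b\<in>Basis. 2 * pi * \<bar>\<xi> \<bullet> b\<bar>)"
      proof -
        have "norm \<xi> \<le> (\<Sum>b\<in>Basis. \<bar>\<xi> \<bullet> b\<bar>)" by (rule norm_le_l1)
        also have "\<dots> \<le> (\<Sum>b\<in>Basis. 2 * pi * \<bar>\<xi> \<bullet> b\<bar>)"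
        proof (rule sum_mono)
          fix b
          show "\<bar>\<xi> \<bullet> b\<bar> \<le> 2 * pi * \<bar>\<xi> \<bullet> b\<bar>"
            using mult_right_mono[of 1 "2 * pi" "\<bar>\<xi> \<bullet> b\<bar>"] pi_ge_two by simp
        qed
        finally show ?thesis by simp
      qed
      then have "(1 + norm \<xi>) * (?W * cmod (fourier (\<Psi> i) \<xi>))
          \<le> (1 + (\<Sum>b\<in>Basis. 2 * pi * \<bar>\<xi> \<bullet> b\<bar>)) * (?W * cmod (fourier (\<Psi> i) \<xi>))"
        by (intro mult_right_mono) auto
      also have "\<dots> = ?W * cmod (fourier (\<Psi> i) \<xi>)
          + (\<Sum>b\<in>Basis. ?W * cmod (fourier (partial_deriv b (\<Psi> i)) \<xi>))"
      proof -
        have "?W * cmod (fourier (partial_deriv b (\<Psi> i)) \<xi>) =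
            2 * pi * \<bar>\<xi> \<bullet> b\<bar> * (?W * cmod (fourier (\<Psi> i) \<xi>))" if "b \<in> Basis" for b
          by (simp add: fourier_partial_deriv[OF smooth_rapid_imp_schwartz[OF Suc.prems] that] norm_mult)
        then have "(\<Sum>b\<in>Basis. ?W * cmod (fourier (partial_deriv b (\<Psi> i)) \<xi>)) =
            (\<Sum>b\<in>Basis. 2 * pi * \<bar>\<xi> \<bullet> b\<bar> * (?W * cmod (fourier (\<Psi> i) \<xi>)))"
          by (rule sum.cong[OF refl])
        then show ?thesis
          by (simp only: distrib_right sum_distrib_right mult_1)
      qed
      also have "\<dots> \<le> B0 + (\<Sum>b\<in>Basis. B b)"
        by (intro add_mono sum_mono B0 B)
      finally show ?thesis by (simp add: mult.assoc)
    qed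
    then show ?case by blast
  qed
  from this[OF \<Psi>] show "rapid \<Phi>"
    unfolding \<Phi> rapid_def by blast
qed

lemma schwartz_fourier: "\<phi> \<in> schwartz \<Longrightarrow> fourier \<phi> \<in> schwartz"
  unfolding schwartz_iff by (rule smooth_rapid_fourier)

section \<open>Gaussian mollifiers\<close>

text \<open>Both the Gaussian and its transform solve the system \<open>\<partial>\<^sub>b g = -2\<pi> \<xi>\<^sub>b g\<close>, so they are proportional, and
  the factor is the integral of the Gaussian. It is positive.\<close>

lemma fourier_gaussian:
  obtains c where "0 < c" "\<And>\<xi>::'a::euclidean_space. fourier gaussian \<xi> = of_real c * gaussian \<xi>"
proof -
  let ?g = "fourier (gaussian :: 'a \<Rightarrow> complex)"
  \<comment> \<open>The reciprocal of the Gaussian; its product with \<open>?g\<close> has derivative \<open>0\<close>.\<close>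
  let ?G = "\<lambda>\<xi>::'a. complex_of_real (exp (pi * (\<xi> \<bullet> \<xi>)))"
  have D: "partial_deriv b ?g \<xi> = - (2 * of_real pi * of_real (\<xi> \<bullet> b)) * ?g \<xi>" if b: "b \<in> Basis" for b \<xi>
  proof -
    have "partial_deriv b ?g \<xi> = fourier (\<lambda>x. \<i> * partial_deriv b gaussian x) \<xi>"
      unfolding partial_deriv_fourier(2)[OF schwartz_gaussian] partial_deriv_gaussian(2)
      by (simp add: mult_ac)
    also have "\<dots> = \<i> * fourier (partial_deriv b gaussian) \<xi>"
      unfolding fourier_wave integral_mult_right_zero[symmetric] by (simp add: mult_ac)
    also have "\<dots> = - (2 * of_real pi * of_real (\<xi> \<bullet> b)) * ?g \<xi>"
    proof -
      have "\<i> * (2 * of_real pi * \<i> * X * F) = (\<i> * \<i>) * (2 * of_real pi * X * F)" for X F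
        by (simp only: mult_ac)
      then show ?thesis
        unfolding fourier_partial_deriv[OF schwartz_gaussian b] by (simp only:) simp
    qed
    finally show ?thesis .
  qed
  have "((\<lambda>\<xi>. ?g \<xi> * ?G \<xi>) has_derivative (\<lambda>v. 0)) (at \<xi>)" for \<xi>
  proof -
    have 1: "(?g has_derivative (\<lambda>v. \<Sum>b\<in>Basis. (v \<bullet> b) *\<^sub>R partial_deriv b ?g \<xi>)) (at \<xi>)"
      by (intro has_derivative_partial_deriv partial_deriv_fourier schwartz_gaussian)
    have 2: "(?G has_derivative (\<lambda>v. of_real (exp (pi * (\<xi> \<bullet> \<xi>)) * (pi * (\<xi> \<bullet> v + v \<bullet> \<xi>))))) (at \<xi>)"
      by (auto intro!: derivative_eq_intros)
    have 3: "(\<Sum>b\<in>Basis. (v \<bullet> b) *\<^sub>R partial_deriv b ?g \<xi>) = - (2 * of_real pi * of_real (\<xi> \<bullet> v)) * ?g \<xi>" for v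
    proof -
      have "(\<Sum>b\<in>Basis. (v \<bullet> b) *\<^sub>R partial_deriv b ?g \<xi>)
          = (\<Sum>b\<in>Basis. - (2 * of_real pi) * ?g \<xi> * of_real ((\<xi> \<bullet> b) * (v \<bullet> b)))"
        by (intro sum.cong refl) (simp add: D scaleR_conv_of_real)
      also have "\<dots> = - (2 * of_real pi) * ?g \<xi> * of_real (\<xi> \<bullet> v)"
        unfolding euclidean_inner[of \<xi> v] of_real_sum sum_distrib_left ..
      finally show ?thesis by simp
    qed
    show ?thesis
    proof (rule has_derivative_eq_rhs[OF has_derivative_mult[OF 1 2]], rule ext)
      fix v
      show "?g \<xi> * of_real (exp (pi * (\<xi> \<bullet> \<xi>)) * (pi * (\<xi> \<bullet> v + v \<bullet> \<xi>)))
          + (\<Sum>b\<in>Basis. (v \<bullet> b) *\<^sub>R partial_deriv b ?g \<xi>) * ?G \<xi> = 0"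
        unfolding 3 inner_commute[of v \<xi>] by simp
    qed
  qed
  then obtain C where C: "\<And>\<xi>. ?g \<xi> * ?G \<xi> = C"
    using has_derivative_zero_constant[of UNIV "\<lambda>\<xi>. ?g \<xi> * ?G \<xi>"] by auto
  let ?c = "LINT x|lborel. exp (- pi * (norm (x::'a))\<^sup>2)"
  have int: "integrable lborel (\<lambda>x::'a. exp (- pi * (norm x)\<^sup>2))"
    using integrable_norm[OF schwartz_integrable[OF schwartz_gaussian]] by (simp add: norm_gaussian)
  have "C = of_real ?c"
    using C[of 0] by (simp add: fourier_wave wave_def gaussian_def)
  have "0 < ?c"
  proof -
    have "\<not> (AE x in lborel. exp (- pi * (norm (x::'a))\<^sup>2) = 0)"
      by (simp add: eventually_False ae_filter_eq_bot_iff emeasure_lborel_UNIV)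
    then have "?c \<noteq> 0"
      using integral_nonneg_eq_0_iff_AE[OF int] by simp
    moreover have "0 \<le> ?c" by simp
    ultimately show ?thesis by (metis order_le_less)
  qed
  moreover have "?g \<xi> = of_real ?c * gaussian \<xi>" for \<xi>
  proof -
    have "?G \<xi> * gaussian \<xi> = 1"
      by (simp add: gaussian_def power2_norm_eq_inner flip: of_real_mult exp_add)
    then have "?g \<xi> = ?g \<xi> * ?G \<xi> * gaussian \<xi>"
      by (simp add: mult.assoc)
    then show ?thesis
      using C \<open>C = of_real ?c\<close> by simp
  qed
  ultimately show ?thesis using that by blast
qed

lemma dilate_affine: "dilate t \<phi> = (\<lambda>x. (1 / of_real (t ^ DIM('a))) * \<phi> (0 + inverse t *\<^sub>R (x::'a::euclidean_space)))"
  by (simp add: dilate_def fun_eq_iff)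

lemma schwartz_dilate: "\<phi> \<in> schwartz \<Longrightarrow> 0 < t \<Longrightarrow> dilate t \<phi> \<in> schwartz"
  unfolding dilate_affine by (intro schwartz_cmult schwartz_affine) auto

lemma schwartz_shift:
  assumes "\<phi> \<in> schwartz"
  shows "(\<lambda>z. \<phi> (z - y)) \<in> schwartz"
  using schwartz_affine[OF assms, of 1 "- y"] by (simp add: algebra_simps)

lemma schwartz_reflect_shift:
  assumes "\<phi> \<in> schwartz"
  shows "(\<lambda>z. \<phi> (y - z)) \<in> schwartz"
  using schwartz_affine[OF assms, of "-1" y] by (simp add: algebra_simps)

text \<open>The Gaussian is even, so it does not matter whether a convolution reflects it.\<close>

lemma dilate_gaussian_minus: "dilate t gaussian (y - z) = dilate t gaussian (z - y)"
  by (simp add: dilate_def gaussian_def norm_minus_commute)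

lemma fourier_dilate_gaussian:
  fixes z \<xi> :: "'a::euclidean_space"
  assumes t: "0 < t"
  shows "fourier (\<lambda>y. dilate t gaussian (z - y)) \<xi> = wave \<xi> z * fourier gaussian (t *\<^sub>R \<xi>)"
proof -
  note [measurable] = schwartz_measurable[OF schwartz_reflect_shift[OF schwartz_dilate[OF schwartz_gaussian t]]]
  have "fourier (\<lambda>y. dilate t gaussian (z - y)) \<xi>
      = \<bar>t\<bar> ^ DIM('a) *\<^sub>R (LINT x|lborel. wave \<xi> (z + t *\<^sub>R x) * dilate t gaussian (z - (z + t *\<^sub>R x)))"
    unfolding fourier_wave using t by (intro lborel_integral_affine) auto
  also have "\<dots> = (LINT x|lborel. \<bar>t\<bar> ^ DIM('a) *\<^sub>R (wave \<xi> (z + t *\<^sub>R x) * dilate t gaussian (z - (z + t *\<^sub>R x))))"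
    by simp
  also have "\<dots> = (LINT x|lborel. wave \<xi> z * (wave (t *\<^sub>R \<xi>) x * gaussian x))"
    using t by (intro Bochner_Integration.integral_cong refl)
      (simp add: wave_add wave_scale dilate_def gaussian_def scaleR_conv_of_real)
  also have "\<dots> = wave \<xi> z * fourier gaussian (t *\<^sub>R \<xi>)"
    by (simp add: fourier_wave)
  finally show ?thesis .
qed

text \<open>The convolution theorem for \<open>F\<psi>\<close> and a dilated Gaussian, read off from
  \<open>\<integral> F\<psi> w = \<integral> \<psi> Fw\<close> with \<open>w(y) = \<gamma>\<^sub>t(z - y)\<close>.\<close>

lemma fourier_convolve_gaussian:
  fixes \<psi> :: "'a::euclidean_space \<Rightarrow> complex"
  assumes \<psi>: "\<psi> \<in> schwartz" and t: "0 < t"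
  shows "(LINT y|lborel. fourier \<psi> y * dilate t gaussian (z - y))
    = fourier (\<lambda>\<xi>. \<psi> \<xi> * fourier gaussian (t *\<^sub>R \<xi>)) z"
proof -
  have "(LINT y|lborel. fourier \<psi> y * dilate t gaussian (z - y))
      = (LINT \<xi>|lborel. \<psi> \<xi> * fourier (\<lambda>y. dilate t gaussian (z - y)) \<xi>)"
    by (intro integral_fourier_mult schwartz_integrable schwartz_reflect_shift schwartz_dilate schwartz_gaussian \<psi> t)
  then show ?thesis
    by (simp add: fourier_dilate_gaussian[OF t] fourier_wave[of _ z] wave_commute[of _ z] mult_ac)
qed

text \<open>The Gaussians \<open>\<gamma>(n (x - x0))\<close>, normalised, form an approximate identity at \<open>x0\<close>.\<close>

lemma continuous_bounded_eq_0I: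
  fixes u :: "'a::euclidean_space \<Rightarrow> complex"
  assumes cont: "continuous_on UNIV u" and bound: "\<And>x. cmod (u x) \<le> B"
    and zero: "\<And>\<psi>. \<psi> \<in> schwartz \<Longrightarrow> (LINT x|lborel. u x * \<psi> x) = 0"
  shows "u x0 = 0"
proof -
  have [measurable]: "u \<in> borel_measurable borel"
    using cont by (rule borel_measurable_continuous_onI)
  note [measurable] = schwartz_measurable[OF schwartz_gaussian]
  have "(\<lambda>n. LINT w|lborel. u (x0 + inverse (real (Suc n)) *\<^sub>R w) * gaussian w)
      \<longlonglongrightarrow> (LINT w|lborel. u x0 * gaussian (w::'a))"
  proof (rule integral_dominated_convergence[where w="\<lambda>w::'a. B * cmod (gaussian w)"])
    show "integrable lborel (\<lambda>w::'a. B * cmod (gaussian w))"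
      by (intro integrable_mult_right integrable_norm schwartz_integrable schwartz_gaussian)
    show "AE w in lborel. (\<lambda>n. u (x0 + inverse (real (Suc n)) *\<^sub>R w) * gaussian w) \<longlonglongrightarrow> u x0 * gaussian w"
    proof (intro AE_I2 tendsto_mult tendsto_const)
      fix w
      have "(\<lambda>n. x0 + inverse (real (Suc n)) *\<^sub>R w) \<longlonglongrightarrow> x0 + 0 *\<^sub>R w"
        by (intro tendsto_intros LIMSEQ_inverse_real_of_nat)
      then have "(\<lambda>n. x0 + inverse (real (Suc n)) *\<^sub>R w) \<longlonglongrightarrow> x0" by simp
      then show "(\<lambda>n. u (x0 + inverse (real (Suc n)) *\<^sub>R w)) \<longlonglongrightarrow> u x0"
        by (rule isCont_tendsto_compose[rotated]) (use cont in \<open>simp add: continuous_on_eq_continuous_at\<close>)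
    qed
  qed (auto simp: norm_mult intro!: mult_right_mono bound)
  moreover have "(LINT w|lborel. u (x0 + inverse (real (Suc n)) *\<^sub>R w) * gaussian w) = 0" for n
  proof -
    define s where "s = real (Suc n)"
    have s: "0 < s" by (simp add: s_def)
    have \<psi>: "(\<lambda>x. gaussian (- (s *\<^sub>R x0) + s *\<^sub>R x)) \<in> schwartz"
      using s by (intro schwartz_affine schwartz_gaussian) auto
    note [measurable] = schwartz_measurable[OF \<psi>]
    have "0 = \<bar>inverse s\<bar> ^ DIM('a) *\<^sub>R (LINT w|lborel. u (x0 + inverse s *\<^sub>R w)
        * gaussian (- (s *\<^sub>R x0) + s *\<^sub>R (x0 + inverse s *\<^sub>R w)))"
      unfolding zero[OF \<psi>, symmetric] using s by (intro lborel_integral_affine) auto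
    then show ?thesis
      unfolding s_def[symmetric] using s by (simp add: scaleR_add_right)
  qed
  ultimately have "(LINT w|lborel. u x0 * gaussian (w::'a)) = 0"
    by (simp add: LIMSEQ_const_iff)
  moreover obtain c where "0 < c" "\<And>\<xi>::'a. fourier gaussian \<xi> = of_real c * gaussian \<xi>"
    by (rule fourier_gaussian) blast
  then have "(LINT w|lborel. gaussian (w::'a)) = of_real c"
    using \<open>\<And>\<xi>::'a. fourier gaussian \<xi> = of_real c * gaussian \<xi>\<close>[of 0]
    by (simp add: fourier_wave wave_def gaussian_def)
  ultimately show ?thesis
    using \<open>0 < c\<close> by simp
qed

section \<open>Exchanging a tempered distribution with an integral\<close>

lemma multi_deriv_shift:
  assumes "\<phi> \<in> schwartz" "bs \<in> lists Basis"
  shows "multi_deriv bs (\<lambda>z. \<phi> (z - y)) = (\<lambda>z. multi_deriv bs \<phi> (z - y))"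
  using assms(2)
proof induction
  case (Cons b bs)
  have "multi_deriv bs \<phi> differentiable at w" for w
    by (intro schwartz_differentiable schwartz_multi_deriv assms(1) Cons)
  from partial_deriv_affine(2)[OF this, of b "- y" 1]
  have "partial_deriv b (\<lambda>z. multi_deriv bs \<phi> (z - y)) x = partial_deriv b (multi_deriv bs \<phi>) (x - y)" for x
    by simp
  then show ?case
    unfolding multi_deriv_Cons Cons(3) by (rule ext)
qed simp

lemma multi_deriv_diff:
  assumes "\<phi> \<in> schwartz" "\<psi> \<in> schwartz" "bs \<in> lists Basis"
  shows "multi_deriv bs (\<lambda>z. \<phi> z - \<psi> z) = (\<lambda>z. multi_deriv bs \<phi> z - multi_deriv bs \<psi> z)"
  using assms(3)
proof induction
  case (Cons b bs)
  note d = schwartz_differentiable[OF schwartz_multi_deriv[OF assms(1) Cons(2)]]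
    schwartz_differentiable[OF schwartz_multi_deriv[OF assms(2) Cons(2)]]
  have "partial_deriv b (\<lambda>z. multi_deriv bs \<phi> z - multi_deriv bs \<psi> z) x =
      partial_deriv b (multi_deriv bs \<phi>) x - partial_deriv b (multi_deriv bs \<psi>) x" for x
    using partial_deriv_add[OF d(1)[of x] differentiable_minus[OF d(2)[of x]], of b]
      partial_deriv_cmult[OF d(2)[of x], of b "-1"] by simp
  then show ?case
    unfolding multi_deriv_Cons Cons(3) by (rule ext)
qed simp

text \<open>In every seminorm, translates of a Schwartz function depend on the translation vector in a locally
  Lipschitz way, with a constant that grows polynomially. The mean value inequality on the segment
  between \<open>z - y\<close> and \<open>z - y'\<close> gives this, because \<open>1 + |z| \<le> (1 + |w|) (1 + |y| + |y'|)\<close> there.\<close>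

lemma schwartz_shift_lipschitz:
  fixes g :: "'a::euclidean_space \<Rightarrow> complex"
  assumes g: "g \<in> schwartz"
  shows "\<exists>A\<ge>0. \<forall>y y' z. (1 + norm z) ^ k * cmod (g (z - y) - g (z - y'))
    \<le> A * (norm (y - y') * (1 + norm y + norm y') ^ k)"
proof -
  have "\<exists>B. \<forall>w. (1 + norm w) ^ k * cmod (partial_deriv b g w) \<le> B" if "b \<in> Basis" for b
    using schwartz_bound[OF schwartz_deriv[OF g that]] by metis
  then obtain B where B: "\<And>b w. b \<in> Basis \<Longrightarrow> (1 + norm w) ^ k * cmod (partial_deriv b g w) \<le> B b"
    by metis
  define A where "A = (\<Sum>b\<in>Basis. B b)"
  have A: "(1 + norm w) ^ k * (\<Sum>b\<in>Basis. cmod (partial_deriv b g w)) \<le> A" for w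
    unfolding A_def sum_distrib_left by (intro sum_mono B)
  have "0 \<le> A"
    by (rule order_trans[OF _ A[of 0]]) (simp add: sum_nonneg)
  moreover have "(1 + norm z) ^ k * cmod (g (z - y) - g (z - y'))
    \<le> A * (norm (y - y') * (1 + norm y + norm y') ^ k)" for y y' z
  proof -
    define M where "M = A * (1 + norm y + norm y') ^ k / (1 + norm z) ^ k"
    have "cmod (g (z - y) - g (z - y')) \<le> M * norm ((z - y) - (z - y'))"
    proof (rule differentiable_bound[of "closed_segment (z - y) (z - y')"])
      fix w assume "w \<in> closed_segment (z - y) (z - y')"
      then obtain t where t: "0 \<le> t" "t \<le> 1" "w = (1 - t) *\<^sub>R (z - y) + t *\<^sub>R (z - y')"
        by (auto simp: in_segment)
      have "z = w + ((1 - t) *\<^sub>R y + t *\<^sub>R y')"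
        by (simp add: t(3) algebra_simps)
      then have "norm z \<le> norm w + (norm ((1 - t) *\<^sub>R y) + norm (t *\<^sub>R y'))"
        using norm_triangle_ineq[of w "(1 - t) *\<^sub>R y + t *\<^sub>R y'"]
          norm_triangle_ineq[of "(1 - t) *\<^sub>R y" "t *\<^sub>R y'"] by simp
      also have "\<dots> \<le> norm w + (1 * norm y + 1 * norm y')"
        unfolding norm_scaleR using t by (intro add_mono mult_right_mono) auto
      finally have "norm z \<le> norm w + (1 * norm y + 1 * norm y')" .
      moreover have "(1 + norm w) * (1 + norm y + norm y') =
          1 + (norm w + (norm y + norm y')) + norm w * (norm y + norm y')"
        by (simp add: algebra_simps)
      moreover have "0 \<le> norm w * (norm y + norm y')"
        by (intro mult_nonneg_nonneg add_nonneg_nonneg norm_ge_zero)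
      ultimately have "1 + norm z \<le> (1 + norm w) * (1 + norm y + norm y')"
        by linarith
      then have le: "(1 + norm z) ^ k \<le> (1 + norm w) ^ k * (1 + norm y + norm y') ^ k"
        unfolding power_mult_distrib[symmetric] by (intro power_mono) auto
      show "(g has_derivative (\<lambda>v. \<Sum>b\<in>Basis. (v \<bullet> b) *\<^sub>R partial_deriv b g w)) (at w within closed_segment (z - y) (z - y'))"
        by (rule has_derivative_at_withinI[OF has_derivative_partial_deriv[OF schwartz_differentiable[OF g]]])
      let ?S = "\<Sum>b\<in>Basis. cmod (partial_deriv b g w)"
      have "(1 + norm z) ^ k * ?S \<le> ((1 + norm w) ^ k * (1 + norm y + norm y') ^ k) * ?S"
        by (intro mult_right_mono le sum_nonneg) auto
      also have "\<dots> = ((1 + norm w) ^ k * ?S) * (1 + norm y + norm y') ^ k"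
        by (simp add: mult_ac)
      also have "\<dots> \<le> A * (1 + norm y + norm y') ^ k"
        by (intro mult_right_mono A) auto
      finally have S: "?S \<le> M"
        unfolding M_def using zero_less_power[OF add_pos_nonneg[OF zero_less_one norm_ge_zero[of z]], of k]
        by (simp add: pos_le_divide_eq mult.commute)
      show "onorm (\<lambda>v. \<Sum>b\<in>Basis. (v \<bullet> b) *\<^sub>R partial_deriv b g w) \<le> M"
      proof (rule onorm_le)
        fix v
        have "norm (\<Sum>b\<in>Basis. (v \<bullet> b) *\<^sub>R partial_deriv b g w)
            \<le> (\<Sum>b\<in>Basis. norm v * cmod (partial_deriv b g w))"
          by (intro sum_norm_le) (auto intro!: mult_right_mono Basis_le_norm)
        also have "\<dots> = ?S * norm v"
          by (simp add: sum_distrib_left[symmetric] mult.commute)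
        also have "\<dots> \<le> M * norm v"
          by (intro mult_right_mono S) auto
        finally show "norm (\<Sum>b\<in>Basis. (v \<bullet> b) *\<^sub>R partial_deriv b g w) \<le> M * norm v" .
      qed
    qed auto
    also have "norm ((z - y) - (z - y')) = norm (y - y')"
      by (simp add: norm_minus_commute)
    finally have "(1 + norm z) ^ k * cmod (g (z - y) - g (z - y')) \<le> (1 + norm z) ^ k * (M * norm (y - y'))"
      by (intro mult_left_mono) auto
    also have "\<dots> = A * (norm (y - y') * (1 + norm y + norm y') ^ k)"
    proof -
      have "(1 + norm z) ^ k \<noteq> 0" using add_pos_nonneg[OF zero_less_one norm_ge_zero[of z]] by simp
      then show ?thesis by (simp add: M_def)
    qed
    finally show ?thesis .
  qed
  ultimately show ?thesis by blast
qed

text \<open>For \<open>\<sigma> = id\<close> this is the convolution of \<open>h\<close> and \<open>g\<close>; for a simple function \<open>\<sigma>\<close> it is a finite linear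
  combination of translates of \<open>g\<close>, that is, a Riemann sum for the convolution.\<close>

definition average ::
    "('a::euclidean_space \<Rightarrow> 'a) \<Rightarrow> ('a \<Rightarrow> complex) \<Rightarrow> ('a \<Rightarrow> complex) \<Rightarrow> 'a \<Rightarrow> complex" where
  "average \<sigma> h g z = (LINT y|lborel. h y * g (z - \<sigma> y))"

lemma integrable_average:
  assumes h: "h \<in> schwartz" and g: "g \<in> schwartz" and [measurable]: "\<sigma> \<in> borel_measurable borel"
  shows "integrable lborel (\<lambda>y. h y * g (z - \<sigma> y))"
proof -
  note [measurable] = schwartz_measurable[OF h] schwartz_measurable[OF g]
  obtain B where B: "0 < B" "\<And>x. cmod (g x) \<le> B"
    using schwartz_bound[OF g, of 0] by auto
  show ?thesis
  proof (rule Bochner_Integration.integrable_bound[OF integrable_mult_right[OF schwartz_integrable[OF h], of "of_real B"]])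
    show "AE y in lborel. norm (h y * g (z - \<sigma> y)) \<le> norm (of_real B * h y)"
      using B(1) by (intro AE_I2) (simp add: norm_mult mult.commute[of B] mult_left_mono B(2))
  qed measurable
qed

lemma partial_deriv_average:
  fixes h g :: "'a::euclidean_space \<Rightarrow> complex"
  assumes h: "h \<in> schwartz" and g: "g \<in> schwartz" and [measurable]: "\<sigma> \<in> borel_measurable borel"
  shows "average \<sigma> h g differentiable at z"
    and "b \<in> Basis \<Longrightarrow> partial_deriv b (average \<sigma> h g) z = average \<sigma> h (partial_deriv b g) z"
proof -
  note [measurable] = schwartz_measurable[OF h] schwartz_measurable[OF g]
  have [measurable]: "partial_deriv b g \<in> borel_measurable borel" if "b \<in> Basis" for b
    by (intro schwartz_measurable schwartz_deriv g that)
  have "\<exists>B. \<forall>x. cmod (partial_deriv b g x) \<le> B" if "b \<in> Basis" for b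
    using schwartz_bound[OF schwartz_deriv[OF g that], of 0] by auto
  then obtain B where B: "\<And>b x. b \<in> Basis \<Longrightarrow> cmod (partial_deriv b g x) \<le> B b" by metis
  let ?K' = "\<lambda>z y v. h y * (\<Sum>b\<in>Basis. (v \<bullet> b) *\<^sub>R partial_deriv b g (z - \<sigma> y))"
  have "((\<lambda>z. LINT y|lborel. h y * g (z - \<sigma> y)) has_derivative (\<lambda>v. LINT y|lborel. ?K' z y v)) (at z)"
  proof (rule has_derivative_integral[where G="\<lambda>y. (\<Sum>b\<in>Basis. B b) * cmod (h y)"])
    show "((\<lambda>z. h y * g (z - \<sigma> y)) has_derivative ?K' w y) (at w)" for w y
    proof -
      have 1: "((\<lambda>z. z - \<sigma> y) has_derivative (\<lambda>v. v)) (at w)"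
        by (auto intro!: derivative_eq_intros)
      show ?thesis
        by (intro has_derivative_mult_right has_derivative_compose[OF 1 has_derivative_partial_deriv]
            schwartz_differentiable g)
    qed
    show "integrable lborel (\<lambda>y. h y * g (w - \<sigma> y))" for w
      by (intro integrable_average h g) measurable
    show "cmod (?K' w y v) \<le> (\<Sum>b\<in>Basis. B b) * cmod (h y) * norm v" for w y v
    proof -
      have "norm (\<Sum>b\<in>Basis. (v \<bullet> b) *\<^sub>R partial_deriv b g (w - \<sigma> y)) \<le> (\<Sum>b\<in>Basis. norm v * B b)"
        by (intro sum_norm_le) (auto intro!: mult_mono Basis_le_norm B)
      then have "cmod (h y) * norm (\<Sum>b\<in>Basis. (v \<bullet> b) *\<^sub>R partial_deriv b g (w - \<sigma> y))
          \<le> cmod (h y) * (\<Sum>b\<in>Basis. norm v * B b)"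
        by (intro mult_left_mono) auto
      also have "\<dots> = (\<Sum>b\<in>Basis. B b) * cmod (h y) * norm v"
        by (simp add: sum_distrib_left[symmetric])
      finally show ?thesis by (simp add: norm_mult)
    qed
    show "integrable lborel (\<lambda>y. (\<Sum>b\<in>Basis. B b) * cmod (h y))"
      by (intro integrable_mult_right integrable_norm schwartz_integrable h)
  qed measurable
  then have *: "(average \<sigma> h g has_derivative (\<lambda>v. LINT y|lborel. ?K' z y v)) (at z)"
    by (simp add: average_def[abs_def])
  then show "average \<sigma> h g differentiable at z" by (auto simp: differentiable_def)
  assume b: "b \<in> Basis"
  show "partial_deriv b (average \<sigma> h g) z = average \<sigma> h (partial_deriv b g) z"
    unfolding partial_deriv_eq[OF *] by (simp add: average_def sum_inner_Basis_scaleR[OF b])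
qed

lemma multi_deriv_average:
  assumes "h \<in> schwartz" "g \<in> schwartz" "\<sigma> \<in> borel_measurable borel" "bs \<in> lists Basis"
  shows "multi_deriv bs (average \<sigma> h g) = average \<sigma> h (multi_deriv bs g)"
  using assms(4)
proof induction
  case (Cons b bs)
  show ?case
    unfolding multi_deriv_Cons Cons(3)
    by (rule ext) (intro partial_deriv_average assms schwartz_multi_deriv Cons)
qed simp

lemma schwartz_average:
  assumes h: "h \<in> schwartz" and "g \<in> schwartz" and \<sigma>: "\<sigma> \<in> borel_measurable borel"
    and le: "\<And>y. norm (\<sigma> y) \<le> 2 * norm y"
  shows "average \<sigma> h g \<in> schwartz"
  unfolding schwartz_iff
proof (rule smooth_family_coinduct[of "\<lambda>\<Phi>. \<exists>g\<in>schwartz. \<Phi> = (\<lambda>i. average \<sigma> h g)"])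
  show "\<exists>g'\<in>schwartz. (\<lambda>i. average \<sigma> h g) = (\<lambda>i. average \<sigma> h g')"
    using assms by blast
next
  fix \<Phi> :: "unit \<Rightarrow> 'a \<Rightarrow> complex"
  assume "\<exists>g\<in>schwartz. \<Phi> = (\<lambda>i. average \<sigma> h g)"
  then obtain g where g: "g \<in> schwartz" and \<Phi>: "\<Phi> = (\<lambda>i. average \<sigma> h g)" by blast
  note d = partial_deriv_average[OF h g \<sigma>]
  show "\<Phi> i differentiable at x" for i x
    unfolding \<Phi> by (rule d)
  show "\<exists>g\<in>schwartz. (\<lambda>i. partial_deriv b (\<Phi> i)) = (\<lambda>i. average \<sigma> h g)" if "b \<in> Basis" for b
    using schwartz_deriv[OF g that] d(2)[OF that] by (intro bexI) (auto simp: \<Phi> fun_eq_iff)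
  show "rapid \<Phi>"
    unfolding rapid_def
  proof
    fix k
    obtain B where B: "0 < B" "\<And>x. (1 + norm x) ^ k * cmod (g x) \<le> B"
      using schwartz_bound[OF g] by metis
    let ?I = "LINT y|lborel. B * 2 ^ k * ((1 + norm y) ^ k * cmod (h y))"
    have "(1 + norm z) ^ k * cmod (\<Phi> i z) \<le> ?I" for i z
    proof -
      have "(1 + norm z) ^ k * cmod (\<Phi> i z) = cmod (LINT y|lborel. of_real ((1 + norm z) ^ k) * (h y * g (z - \<sigma> y)))"
        by (simp add: \<Phi> average_def norm_mult norm_power flip: of_real_power)
      also have "\<dots> \<le> (LINT y|lborel. cmod (of_real ((1 + norm z) ^ k) * (h y * g (z - \<sigma> y))))"
        by (rule integral_norm_bound)
      also have "\<dots> \<le> ?I"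
      proof (rule integral_mono_AE')
        show "integrable lborel (\<lambda>y. B * 2 ^ k * ((1 + norm y) ^ k * cmod (h y)))"
          by (intro integrable_mult_right schwartz_integrable_weight h)
        have "cmod (of_real ((1 + norm z) ^ k) * (h y * g (z - \<sigma> y)))
            \<le> B * 2 ^ k * ((1 + norm y) ^ k * cmod (h y))" for y
        proof -
          have "norm z \<le> norm (z - \<sigma> y) + 2 * norm y"
            using norm_triangle_ineq[of "z - \<sigma> y" "\<sigma> y"] le[of y] by simp
          moreover have "(1 + norm (z - \<sigma> y)) * (2 * (1 + norm y)) =
              1 + (norm (z - \<sigma> y) + 2 * norm y) + (1 + norm (z - \<sigma> y) + 2 * (norm (z - \<sigma> y) * norm y))"
            by (simp add: algebra_simps)
          moreover have "0 \<le> 1 + norm (z - \<sigma> y) + 2 * (norm (z - \<sigma> y) * norm y)"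
            by (intro add_nonneg_nonneg mult_nonneg_nonneg) auto
          ultimately have "1 + norm z \<le> (1 + norm (z - \<sigma> y)) * (2 * (1 + norm y))"
            by linarith
          then have "(1 + norm z) ^ k \<le> ((1 + norm (z - \<sigma> y)) * (2 * (1 + norm y))) ^ k"
            by (intro power_mono) auto
          then have "(1 + norm z) ^ k * (cmod (h y) * cmod (g (z - \<sigma> y)))
              \<le> ((1 + norm (z - \<sigma> y)) * (2 * (1 + norm y))) ^ k * (cmod (h y) * cmod (g (z - \<sigma> y)))"
            by (intro mult_right_mono) auto
          also have "\<dots> = ((1 + norm (z - \<sigma> y)) ^ k * cmod (g (z - \<sigma> y))) * (2 ^ k * ((1 + norm y) ^ k * cmod (h y)))"
            by (simp only: power_mult_distrib mult_ac)
          also have "\<dots> \<le> B * (2 ^ k * ((1 + norm y) ^ k * cmod (h y)))"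
            by (intro mult_right_mono B) auto
          finally show ?thesis
            by (simp add: norm_mult norm_power mult_ac flip: of_real_power)
        qed
        then show "AE y in lborel. cmod (of_real ((1 + norm z) ^ k) * (h y * g (z - \<sigma> y)))
            \<le> B * 2 ^ k * ((1 + norm y) ^ k * cmod (h y))" by simp
      qed (use B in auto)
      finally show ?thesis .
    qed
    then show "\<exists>B. \<forall>i x. (1 + norm x) ^ k * cmod (\<Phi> i x) \<le> B" by blast
  qed
qed

lemma average_simple:
  assumes h: "h \<in> schwartz" and \<sigma>: "simple_function borel \<sigma>"
  shows "integrable lborel (\<lambda>y. h y * v (\<sigma> y))"
    and "(LINT y|lborel. h y * v (\<sigma> y)) = (\<Sum>c\<in>range \<sigma>. (LINT y|lborel. h y * indicator (\<sigma> -` {c}) y) * v c)"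
proof -
  note [measurable] = schwartz_measurable[OF h]
  have fin: "finite (range \<sigma>)" and [measurable]: "\<sigma> -` {c} \<in> sets borel" for c
    using simple_functionD[OF \<sigma>] by simp_all
  have int: "integrable lborel (\<lambda>y. h y * indicator (\<sigma> -` {c}) y)" for c
    by (rule Bochner_Integration.integrable_bound[OF schwartz_integrable[OF h]])
      (measurable, auto simp: norm_mult indicator_def)
  have eq: "h y * v (\<sigma> y) = (\<Sum>c\<in>range \<sigma>. h y * indicator (\<sigma> -` {c}) y * v c)" for y
    using fin by (subst sum.remove[of _ "\<sigma> y"]) (auto intro!: sum.neutral simp: indicator_def)
  show "integrable lborel (\<lambda>y. h y * v (\<sigma> y))"
    unfolding eq by (intro Bochner_Integration.integrable_sum integrable_mult_left int)
  show "(LINT y|lborel. h y * v (\<sigma> y)) = (\<Sum>c\<in>range \<sigma>. (LINT y|lborel. h y * indicator (\<sigma> -` {c}) y) * v c)"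
    unfolding eq by (simp add: Bochner_Integration.integral_sum int)
qed

text \<open>Simple functions \<open>s n\<close> that converge to the identity, with \<open>|s n y| \<le> 2 |y|\<close>, give Riemann sums for
  which the exchange is just linearity. By the Lipschitz estimate for translates, the seminorm that
  controls \<open>f\<close> and the integrals of \<open>h v\<close> are both off by at most a multiple of the integral of
  \<open>|h(y)| |s n y - y| (1 + |s n y| + |y|)\<^sup>k\<close>, and this tends to \<open>0\<close> by dominated convergence.\<close>

lemma tempered_integral:
  fixes f :: "('a::euclidean_space \<Rightarrow> complex) \<Rightarrow> complex"
  assumes f: "tempered f" and h: "h \<in> schwartz" and g: "g \<in> schwartz"
  defines "v \<equiv> (\<lambda>y. f (\<lambda>z. g (z - y)))"
  shows "continuous_on UNIV v"
    and "f (\<lambda>z. LINT y|lborel. h y * g (z - y)) = (LINT y|lborel. h y * v y)"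
proof -
  note [measurable] = schwartz_measurable[OF h] schwartz_measurable[OF g]
  obtain k N C where C: "0 < C" and bound: "\<And>\<phi> B. \<phi> \<in> schwartz \<Longrightarrow>
      (\<And>bs x. bs \<in> multi_indices N \<Longrightarrow> (1 + norm x) ^ k * cmod (multi_deriv bs \<phi> x) \<le> B) \<Longrightarrow>
      cmod (f \<phi>) \<le> C * B"
    by (rule tempered_bound[OF f]) blast
  have mi: "bs \<in> lists Basis" if "bs \<in> multi_indices N" for bs :: "'a list"
    using that by (simp add: multi_indices_def)
  let ?D = "\<lambda>y y' :: 'a. norm (y - y') * (1 + norm y + norm y') ^ k"
  obtain A where A: "0 \<le> A" "\<And>bs y y' z. bs \<in> multi_indices N \<Longrightarrow>
      (1 + norm z) ^ k * cmod (multi_deriv bs g (z - y) - multi_deriv bs g (z - y')) \<le> A * ?D y y'"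
  proof -
    have "\<forall>bs\<in>multi_indices N. \<exists>A\<ge>0. \<forall>y y' z. (1 + norm z) ^ k * cmod (multi_deriv bs g (z - y) - multi_deriv bs g (z - y'))
      \<le> A * ?D y y'"
      by (intro ballI schwartz_shift_lipschitz schwartz_multi_deriv g mi)
    then obtain A where A: "\<And>bs. bs \<in> multi_indices N \<Longrightarrow> 0 \<le> A bs" "\<And>bs y y' z. bs \<in> multi_indices N \<Longrightarrow>
      (1 + norm z) ^ k * cmod (multi_deriv bs g (z - y) - multi_deriv bs g (z - y')) \<le> A bs * ?D y y'"
      by metis
    have "A bs * ?D y y' \<le> (\<Sum>bs\<in>multi_indices N. A bs) * ?D y y'" if "bs \<in> multi_indices N" for bs y y'
      by (intro mult_right_mono member_le_sum that finite_multi_indices) (auto intro: A)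
    then show ?thesis
      using A(1) by (intro that[of "\<Sum>bs\<in>multi_indices N. A bs"] sum_nonneg) (auto intro: order_trans[OF A(2)])
  qed
  have v_diff: "cmod (v y - v y') \<le> C * (A * ?D y y')" for y y'
    unfolding v_def tempered_diff[OF f schwartz_shift[OF g] schwartz_shift[OF g], symmetric]
  proof (rule bound)
    show "(\<lambda>z. g (z - y) - g (z - y')) \<in> schwartz"
      using schwartz_add[OF schwartz_shift[OF g] schwartz_cmult[OF schwartz_shift[OF g]], of y "-1" y'] by simp
    show "(1 + norm x) ^ k * cmod (multi_deriv bs (\<lambda>z. g (z - y) - g (z - y')) x) \<le> A * ?D y y'"
      if "bs \<in> multi_indices N" for bs x
      using A(2)[OF that]
      by (simp add: multi_deriv_diff schwartz_shift g mi[OF that] multi_deriv_shift)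
  qed
  show cont: "continuous_on UNIV v"
    unfolding continuous_on_def
  proof
    fix y
    have "((\<lambda>y'. C * (A * ?D y y')) \<longlongrightarrow> C * (A * ?D y y)) (at y)"
      by (intro tendsto_intros)
    then have "((\<lambda>y'. C * (A * ?D y y')) \<longlongrightarrow> 0) (at y)" by simp
    then have "((\<lambda>y'. v y - v y') \<longlongrightarrow> 0) (at y)"
      by (rule Lim_null_comparison[rotated]) (intro always_eventually allI v_diff)
    from tendsto_diff[OF tendsto_const[of "v y"] this] show "(v \<longlongrightarrow> v y) (at y)"
      by simp
  qed
  have [measurable]: "v \<in> borel_measurable borel"
    using cont by (rule borel_measurable_continuous_onI)
  let ?W = "\<lambda>y. C * A * 3 ^ Suc k * ((1 + norm y) ^ Suc k * cmod (h y))"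
  have W: "integrable lborel ?W"
    by (intro integrable_mult_right schwartz_integrable_weight h)
  have hW: "cmod (h y) * (C * (A * ?D y' y)) \<le> ?W y" if "norm y' \<le> 2 * norm y" for y y'
  proof -
    have "norm (y' - y) * (1 + norm y' + norm y) ^ k \<le> (3 * (1 + norm y)) * (3 * (1 + norm y)) ^ k"
      using that norm_triangle_ineq4[of y' y] by (intro mult_mono power_mono) auto
    then have "(cmod (h y) * C * A) * ?D y' y \<le> (cmod (h y) * C * A) * ((3 * (1 + norm y)) * (3 * (1 + norm y)) ^ k)"
      using C A by (intro mult_left_mono) auto
    also have "\<dots> = ?W y"
      by (simp only: power_mult_distrib power_Suc mult_ac)
    finally show ?thesis by (simp only: mult_ac)
  qed
  have hv: "integrable lborel (\<lambda>y. h y * v y)"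
  proof (rule Bochner_Integration.integrable_bound)
    show "integrable lborel (\<lambda>y. ?W y + cmod (v 0) * cmod (h y))"
      by (intro Bochner_Integration.integrable_add W integrable_mult_right integrable_norm schwartz_integrable h)
    have "cmod (h y) * cmod (v y) \<le> ?W y + cmod (v 0) * cmod (h y)" for y
    proof -
      have "cmod (v y) \<le> cmod (v 0 - v y) + cmod (v 0)"
        using norm_triangle_ineq4[of "v 0" "v 0 - v y"] by simp
      then have "cmod (v y) \<le> C * (A * ?D 0 y) + cmod (v 0)"
        using v_diff[of 0 y] by simp
      from mult_left_mono[OF this, of "cmod (h y)"] hW[of 0 y] show ?thesis
        by (simp add: distrib_left mult.commute[of "cmod (v 0)"])
    qed
    then show "AE y in lborel. norm (h y * v y) \<le> norm (?W y + cmod (v 0) * cmod (h y))"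
      unfolding norm_mult[of "h _"] real_norm_def by (intro AE_I2 order_trans[OF _ abs_ge_self])
  qed measurable
  obtain s :: "nat \<Rightarrow> 'a \<Rightarrow> 'a" where s: "\<And>n. simple_function borel (s n)" "\<And>y. (\<lambda>n. s n y) \<longlonglongrightarrow> y"
    and s_le: "\<And>n y. norm (s n y) \<le> 2 * norm y"
  proof -
    have "(\<lambda>y::'a. y) \<in> borel_measurable borel" by simp
    from borel_measurable_implies_sequence_metric[OF this, of 0] obtain F where
      "\<forall>i. simple_function borel (F i)" "\<forall>x. (\<lambda>i. F i x) \<longlonglongrightarrow> (x::'a)" "\<forall>i x. norm (F i x) \<le> 2 * norm (x::'a)"
      by (auto simp: dist_norm)
    then show ?thesis
      by (intro that[of F]) blast+
  qed
  have [measurable]: "s n \<in> borel_measurable borel" for n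
    using s(1) by (rule borel_measurable_simple_function)
  \<comment> \<open>A common bound for the error of the Riemann sums on both sides of the claim.\<close>
  define E where "E n = (LINT y|lborel. cmod (h y) * (C * (A * ?D (s n y) y)))" for n
  have E_int: "integrable lborel (\<lambda>y. cmod (h y) * (C * (A * ?D (s n y) y)))" for n
    using C A hW[OF s_le] by (intro Bochner_Integration.integrable_bound[OF W] AE_I2) auto
  have E_lim: "E \<longlonglongrightarrow> 0"
  proof -
    have "E \<longlonglongrightarrow> (LINT y::'a|lborel. 0)"
      unfolding E_def
    proof (rule integral_dominated_convergence[OF _ _ W])
      show "AE y in lborel. (\<lambda>n. cmod (h y) * (C * (A * ?D (s n y) y))) \<longlonglongrightarrow> 0"
      proof (rule AE_I2)
        fix y
        have "(\<lambda>n. cmod (h y) * (C * (A * ?D (s n y) y))) \<longlonglongrightarrow> cmod (h y) * (C * (A * ?D y y))"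
          by (intro tendsto_intros s)
        then show "(\<lambda>n. cmod (h y) * (C * (A * ?D (s n y) y))) \<longlonglongrightarrow> 0" by simp
      qed
      show "AE y in lborel. norm (cmod (h y) * (C * (A * ?D (s n y) y))) \<le> ?W y" for n
        using C A hW[OF s_le] by (intro AE_I2) simp
    qed measurable
    then show ?thesis by simp
  qed
  have idm: "(\<lambda>y::'a. y) \<in> borel_measurable borel" by simp
  have av: "average (s n) h g \<in> schwartz" "average (\<lambda>y. y) h g \<in> schwartz" for n
    by (intro schwartz_average h g s_le; simp)+
  have f_avg: "f (average (s n) h g) = (LINT y|lborel. h y * v (s n y))" for n
  proof -
    have "average (s n) h g = (\<lambda>z. \<Sum>c\<in>range (s n). (LINT y|lborel. h y * indicator (s n -` {c}) y) * g (z - c))"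
      unfolding average_def by (rule ext) (rule average_simple(2)[OF h s(1), of "\<lambda>y. g (_ - y)"])
    then have "f (average (s n) h g) = (\<Sum>c\<in>range (s n). (LINT y|lborel. h y * indicator (s n -` {c}) y) * v c)"
      by (simp add: tempered_sum[OF f] tempered_cmult[OF f] schwartz_cmult schwartz_shift g v_def)
    then show ?thesis
      by (simp add: average_simple(2)[OF h s(1)])
  qed
  have 1: "cmod ((LINT y|lborel. h y * v (s n y)) - (LINT y|lborel. h y * v y)) \<le> E n" for n
  proof -
    have "(LINT y|lborel. h y * v (s n y)) - (LINT y|lborel. h y * v y) = (LINT y|lborel. h y * (v (s n y) - v y))"
      by (simp add: right_diff_distrib average_simple(1)[OF h s(1)] hv)
    also have "cmod \<dots> \<le> (LINT y|lborel. cmod (h y * (v (s n y) - v y)))"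
      by (rule integral_norm_bound)
    also have "\<dots> \<le> E n"
      unfolding E_def using C A
      by (intro integral_mono_AE' E_int AE_I2) (auto simp: norm_mult intro!: mult_left_mono v_diff)
    finally show ?thesis .
  qed
  have 2: "cmod (f (average (s n) h g) - f (average (\<lambda>y. y) h g)) \<le> E n" for n
  proof -
    have "cmod (f (average (s n) h g) - f (average (\<lambda>y. y) h g)) \<le> C * (E n / C)"
      unfolding tempered_diff[OF f av, symmetric]
    proof (rule bound)
      show "(\<lambda>x. average (s n) h g x - average (\<lambda>y. y) h g x) \<in> schwartz"
        using schwartz_add[OF av(1) schwartz_cmult[OF av(2)], of n "-1"] by simp
      fix bs :: "'a list" and x assume bs: "bs \<in> multi_indices N"
      note g' = schwartz_multi_deriv[OF g mi[OF bs]]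
      let ?g = "multi_deriv bs g"
      have "(1 + norm x) ^ k * cmod (multi_deriv bs (\<lambda>x. average (s n) h g x - average (\<lambda>y. y) h g x) x)
          = (1 + norm x) ^ k * cmod (average (s n) h ?g x - average (\<lambda>y. y) h ?g x)"
        by (simp add: multi_deriv_diff av mi[OF bs] multi_deriv_average h g)
      also have "average (s n) h ?g x - average (\<lambda>y. y) h ?g x = (LINT y|lborel. h y * (?g (x - s n y) - ?g (x - y)))"
        using integrable_average[OF h g', of "s n" x] integrable_average[OF h g', of "\<lambda>y. y" x]
        by (simp add: average_def right_diff_distrib)
      also have "(1 + norm x) ^ k * cmod \<dots>
          \<le> (1 + norm x) ^ k * (LINT y|lborel. cmod (h y * (?g (x - s n y) - ?g (x - y))))"
        by (intro mult_left_mono integral_norm_bound) auto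
      also have "\<dots> = (LINT y|lborel. (1 + norm x) ^ k * cmod (h y * (?g (x - s n y) - ?g (x - y))))"
        by simp
      also have "\<dots> \<le> (LINT y|lborel. (cmod (h y) * (C * (A * ?D (s n y) y))) / C)"
      proof (rule integral_mono_AE')
        show "integrable lborel (\<lambda>y. (cmod (h y) * (C * (A * ?D (s n y) y))) / C)"
          by (intro integrable_divide E_int)
        have "(1 + norm x) ^ k * cmod (h y * (?g (x - s n y) - ?g (x - y)))
            \<le> (cmod (h y) * (C * (A * ?D (s n y) y))) / C" for y
          using mult_left_mono[OF A(2)[OF bs, of x "s n y" y], of "cmod (h y)"] C
          by (simp add: norm_mult mult_ac)
        then show "AE y in lborel. (1 + norm x) ^ k * cmod (h y * (?g (x - s n y) - ?g (x - y)))
            \<le> (cmod (h y) * (C * (A * ?D (s n y) y))) / C" by simp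
      qed (use A C in auto)
      also have "\<dots> = E n / C"
        unfolding E_def by (rule integral_divide_zero)
      finally show "(1 + norm x) ^ k * cmod (multi_deriv bs (\<lambda>x. average (s n) h g x - average (\<lambda>y. y) h g x) x)
          \<le> E n / C" .
    qed
    then show ?thesis using C by simp
  qed
  let ?L = "f (average (\<lambda>y. y) h g)" and ?R = "LINT y|lborel. h y * v y"
  have "cmod (?L - ?R) \<le> 2 * E n" for n
    using 1[of n] 2[of n] norm_triangle_ineq4[of "f (average (s n) h g) - ?R" "f (average (s n) h g) - ?L"]
    unfolding f_avg by simp
  moreover have "(\<lambda>n. 2 * E n) \<longlonglongrightarrow> 2 * 0"
    by (intro tendsto_intros E_lim)
  ultimately have "cmod (?L - ?R) \<le> 0"
    by (intro LIMSEQ_le_const[of "\<lambda>n. 2 * E n"]) auto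
  then show "f (\<lambda>z. LINT y|lborel. h y * g (z - y)) = (LINT y|lborel. h y * v y)"
    by (simp add: average_def[abs_def])
qed

section \<open>Mollified distributions\<close>

lemma convolve_dilate_gaussian:
  "convolve f (dilate t gaussian) = (\<lambda>y. f (\<lambda>z. dilate t gaussian (z - y)))"
  by (simp add: convolve_def dilate_gaussian_minus[of _ _ _] fun_eq_iff)

lemma continuous_convolve_gaussian:
  assumes "tempered f" "0 < t"
  shows "continuous_on UNIV (convolve f (dilate t gaussian))"
  unfolding convolve_dilate_gaussian
  by (rule tempered_integral(1)[OF assms(1) schwartz_gaussian schwartz_dilate[OF schwartz_gaussian assms(2)]])

lemma schwartz_fourier_gaussian_scale:
  "t \<noteq> 0 \<Longrightarrow> (\<lambda>\<xi>. fourier gaussian (t *\<^sub>R \<xi>)) \<in> schwartz"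
  using schwartz_affine[OF schwartz_fourier[OF schwartz_gaussian], of t 0] by simp

text \<open>The identity \<open>F(f * \<gamma>\<^sub>t) = Ff \<cdot> F\<gamma>(t\<cdot>)\<close> in the sense of distributions.\<close>

lemma tempered_fourier_gaussian:
  fixes f :: "('a::euclidean_space \<Rightarrow> complex) \<Rightarrow> complex"
  assumes f: "tempered f" and t: "0 < t" and \<psi>: "\<psi> \<in> schwartz"
    and int: "integrable lborel (convolve f (dilate t gaussian))"
  shows "f (fourier (\<lambda>\<xi>. \<psi> \<xi> * fourier gaussian (t *\<^sub>R \<xi>)))
    = (LINT \<xi>|lborel. fourier (convolve f (dilate t gaussian)) \<xi> * \<psi> \<xi>)"
proof -
  have "f (fourier (\<lambda>\<xi>. \<psi> \<xi> * fourier gaussian (t *\<^sub>R \<xi>)))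
      = f (\<lambda>z. LINT y|lborel. fourier \<psi> y * dilate t gaussian (z - y))"
    by (simp add: fourier_convolve_gaussian[OF \<psi> t])
  also have "\<dots> = (LINT y|lborel. fourier \<psi> y * convolve f (dilate t gaussian) y)"
    unfolding convolve_dilate_gaussian
    by (intro tempered_integral(2) f schwartz_fourier schwartz_dilate schwartz_gaussian \<psi> t)
  also have "\<dots> = (LINT \<xi>|lborel. fourier (convolve f (dilate t gaussian)) \<xi> * \<psi> \<xi>)"
    using integral_fourier_mult[OF int schwartz_integrable[OF \<psi>]] by (simp add: mult.commute)
  finally show ?thesis .
qed

text \<open>Tested against \<open>\<psi>\<close>, both sides are the value of \<open>f\<close> at the transform of
  \<open>\<psi>(\<xi>) F\<gamma>(s\<xi>) F\<gamma>(t\<xi>)\<close>, which is symmetric in \<open>s\<close> and \<open>t\<close>.\<close>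

lemma fourier_convolve_consistent:
  fixes f :: "('a::euclidean_space \<Rightarrow> complex) \<Rightarrow> complex"
  assumes f: "tempered f"
    and s: "0 < s" "integrable lborel (convolve f (dilate s gaussian))"
    and t: "0 < t" "integrable lborel (convolve f (dilate t gaussian))"
  shows "fourier (convolve f (dilate s gaussian)) \<xi> * fourier gaussian (t *\<^sub>R \<xi>)
    = fourier (convolve f (dilate t gaussian)) \<xi> * fourier gaussian (s *\<^sub>R \<xi>)"
proof -
  let ?W = "fourier (gaussian :: 'a \<Rightarrow> complex)"
  let ?G = "\<lambda>s. fourier (convolve f (dilate s gaussian))"
  have W: "(\<lambda>\<xi>. ?W (r *\<^sub>R \<xi>)) \<in> schwartz" if "0 < r" for r
    using that by (intro schwartz_fourier_gaussian_scale) simp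
  define u where "u \<xi> = ?G s \<xi> * ?W (t *\<^sub>R \<xi>) - ?G t \<xi> * ?W (s *\<^sub>R \<xi>)" for \<xi>
  have "u \<xi> = 0"
  proof (rule continuous_bounded_eq_0I[of u])
    show "continuous_on UNIV u"
      unfolding u_def
      by (intro continuous_intros continuous_on_fourier s t schwartz_continuous W)
    let ?N = "\<lambda>u. LINT x|lborel. cmod (u x)"
    let ?B = "?N (convolve f (dilate s gaussian)) * ?N (gaussian :: 'a \<Rightarrow> complex)
      + ?N (convolve f (dilate t gaussian)) * ?N (gaussian :: 'a \<Rightarrow> complex)"
    show "cmod (u \<xi>) \<le> ?B" for \<xi>
      unfolding u_def
      by (rule order_trans[OF norm_triangle_ineq4], unfold norm_mult)
        (intro add_mono mult_mono norm_fourier_le; simp)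
    show "(LINT x|lborel. u x * \<psi> x) = 0" if \<psi>: "\<psi> \<in> schwartz" for \<psi>
    proof -
      have 1: "(\<lambda>\<xi>. ?W (r *\<^sub>R \<xi>) * \<psi> \<xi>) \<in> schwartz" if "0 < r" for r
        by (intro schwartz_mult W that \<psi>)
      have "(LINT x|lborel. u x * \<psi> x)
          = (LINT x|lborel. ?G s x * (?W (t *\<^sub>R x) * \<psi> x) - ?G t x * (?W (s *\<^sub>R x) * \<psi> x))"
        by (simp add: u_def algebra_simps)
      also have "\<dots> = (LINT x|lborel. ?G s x * (?W (t *\<^sub>R x) * \<psi> x)) - (LINT x|lborel. ?G t x * (?W (s *\<^sub>R x) * \<psi> x))"
        by (intro Bochner_Integration.integral_diff integrable_fourier_mult s t schwartz_integrable 1)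
      also have "\<dots> = 0"
        unfolding tempered_fourier_gaussian[OF f s(1) 1[OF t(1)] s(2), symmetric]
          tempered_fourier_gaussian[OF f t(1) 1[OF s(1)] t(2), symmetric]
        by (simp add: mult_ac)
      finally show ?thesis .
    qed
  qed
  then show ?thesis by (simp add: u_def)
qed

text \<open>The quotients grow at most linearly because \<open>W\<close> is Lipschitz; their partial derivatives are those of
  \<open>W\<close>, evaluated at \<open>s i x\<close>, since the factors \<open>s i\<close> and its inverse cancel.\<close>

lemma smooth_slow_difference_quotient:
  fixes W :: "'a::euclidean_space \<Rightarrow> complex" and s :: "'i \<Rightarrow> real"
  assumes W: "W \<in> schwartz" and s: "\<And>i. 0 < s i" "\<And>i. s i \<le> 1"
  shows "smooth_family slow (\<lambda>i x. of_real (inverse (s i)) * (W (s i *\<^sub>R x) + - W 0))"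
proof (rule smooth_family_step)
  note d = partial_deriv_affine[OF schwartz_differentiable[OF W], where a=0, simplified]
  show "(\<lambda>x. of_real (inverse (s i)) * (W (s i *\<^sub>R x) + - W 0)) differentiable at x" for i x
    by (intro differentiable_mult differentiable_add d) auto
  show "smooth_family slow (\<lambda>i. partial_deriv b (\<lambda>x. of_real (inverse (s i)) * (W (s i *\<^sub>R x) + - W 0)))"
    if b: "b \<in> Basis" for b
  proof -
    have "partial_deriv b (\<lambda>x. of_real (inverse (s i)) * (W (s i *\<^sub>R x) + - W 0)) x = partial_deriv b W (s i *\<^sub>R x)" for i x
    proof -
      have "(\<lambda>x. W (s i *\<^sub>R x) + - W 0) differentiable at x"
        by (intro differentiable_add d) auto
      then have "partial_deriv b (\<lambda>x. of_real (inverse (s i)) * (W (s i *\<^sub>R x) + - W 0)) x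
          = of_real (inverse (s i)) * partial_deriv b (\<lambda>x. W (s i *\<^sub>R x) + - W 0) x"
        by (rule partial_deriv_cmult)
      also have "partial_deriv b (\<lambda>x. W (s i *\<^sub>R x) + - W 0) x = of_real (s i) * partial_deriv b W (s i *\<^sub>R x)"
        using d(1)[of "s i" x] by (subst partial_deriv_add) (auto simp: d(2))
      finally show ?thesis
        using s(1)[of i] by simp
    qed
    then have "(\<lambda>i. partial_deriv b (\<lambda>x. of_real (inverse (s i)) * (W (s i *\<^sub>R x) + - W 0)))
        = (\<lambda>i x. partial_deriv b W (s i *\<^sub>R x))" by (simp add: fun_eq_iff)
    moreover have "\<bar>s i\<bar> \<le> 1" for i
      using s[of i] by simp
    ultimately show ?thesis
      using smooth_slow_scale[of "partial_deriv b W" s] schwartz_deriv[OF W b] by (simp add: schwartz_iff)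
  qed
  obtain A where A: "0 \<le> A" "\<And>y y' z. cmod (W (z - y) - W (z - y')) \<le> A * norm (y - y')"
    using schwartz_shift_lipschitz[OF W, of 0] by auto
  have "cmod (of_real (inverse (s i)) * (W (s i *\<^sub>R x) + - W 0)) \<le> A * (1 + norm x) ^ 1" for i x
  proof -
    have "cmod (of_real (inverse (s i)) * (W (s i *\<^sub>R x) + - W 0)) = inverse (s i) * cmod (W (s i *\<^sub>R x) - W 0)"
      using s(1)[of i] by (simp add: norm_mult norm_inverse)
    also have "\<dots> \<le> inverse (s i) * (A * (s i * norm x))"
      using s(1)[of i] A(2)[of 0 "- (s i *\<^sub>R x)" 0] by (intro mult_left_mono) auto
    also have "\<dots> = A * norm x"
      using s(1)[of i] by simp
    also have "\<dots> \<le> A * (1 + norm x) ^ 1"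
      using A by (intro mult_left_mono) auto
    finally show ?thesis .
  qed
  then show "slow (\<lambda>i x. of_real (inverse (s i)) * (W (s i *\<^sub>R x) + - W 0))"
    unfolding slow_def by blast
qed

text \<open>The difference \<open>\<psi>(\<xi>) (W(s \<xi>) - W(0))\<close> is \<open>s\<close> times a member of a bounded family, and both the
  Fourier transform and \<open>f\<close> preserve boundedness.\<close>

lemma tempered_fourier_limit:
  fixes f :: "('a::euclidean_space \<Rightarrow> complex) \<Rightarrow> complex"
  assumes f: "tempered f" and \<psi>: "\<psi> \<in> schwartz" and W: "W \<in> schwartz"
  defines "s \<equiv> (\<lambda>n. inverse (real (Suc n)))"
  shows "(\<lambda>n. f (fourier (\<lambda>\<xi>. \<psi> \<xi> * W (s n *\<^sub>R \<xi>)))) \<longlonglongrightarrow> W 0 * f (fourier \<psi>)"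
proof -
  have s: "0 < s n" "s n \<le> 1" for n
    by (auto simp: s_def field_simps)
  define \<Phi> where "\<Phi> n \<xi> = of_real (inverse (s n)) * (W (s n *\<^sub>R \<xi>) + - W 0) * \<psi> \<xi>" for n \<xi>
  have \<Phi>: "smooth_family rapid \<Phi>"
    using smooth_rapid_mult[OF smooth_slow_difference_quotient[of W s, OF W s] schwartz_const_family[OF \<psi>]]
    by (simp add: \<Phi>_def[abs_def])
  obtain B where B: "\<And>n. cmod (f (fourier (\<Phi> n))) \<le> B"
    using tempered_bounded_on_family[OF f smooth_rapid_fourier[OF \<Phi>]] by blast
  have "f (fourier (\<lambda>\<xi>. \<psi> \<xi> * W (s n *\<^sub>R \<xi>))) = of_real (s n) * f (fourier (\<Phi> n)) + W 0 * f (fourier \<psi>)" for n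
  proof -
    note S = smooth_rapid_imp_schwartz[OF \<Phi>, of n]
    have "\<psi> \<xi> * W (s n *\<^sub>R \<xi>) = of_real (s n) * \<Phi> n \<xi> + W 0 * \<psi> \<xi>" for \<xi>
      using s(1)[of n] by (simp add: \<Phi>_def algebra_simps)
    then have "fourier (\<lambda>\<xi>. \<psi> \<xi> * W (s n *\<^sub>R \<xi>)) x = of_real (s n) * fourier (\<Phi> n) x + W 0 * fourier \<psi> x" for x
      using integrable_wave_mult[OF schwartz_integrable[OF S], of x] integrable_wave_mult[OF schwartz_integrable[OF \<psi>], of x]
      by (simp add: fourier_wave distrib_left mult.left_commute[of "wave _ _"])
    then have "fourier (\<lambda>\<xi>. \<psi> \<xi> * W (s n *\<^sub>R \<xi>)) = (\<lambda>x. of_real (s n) * fourier (\<Phi> n) x + W 0 * fourier \<psi> x)"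
      by (rule ext)
    then show ?thesis
      by (simp add: tempered_add[OF f] tempered_cmult[OF f] schwartz_cmult schwartz_fourier S \<psi>)
  qed
  moreover have lim: "(\<lambda>n. of_real (s n) * f (fourier (\<Phi> n))) \<longlonglongrightarrow> 0"
  proof (rule Lim_null_comparison)
    show "\<forall>\<^sub>F n in sequentially. cmod (of_real (s n) * f (fourier (\<Phi> n))) \<le> s n * B"
      using s(1) by (intro always_eventually allI) (simp add: norm_mult abs_of_pos mult_left_mono B)
    show "(\<lambda>n. s n * B) \<longlonglongrightarrow> 0"
      unfolding s_def using tendsto_mult[OF LIMSEQ_inverse_real_of_nat tendsto_const[of B]] by simp
  qed
  ultimately show ?thesis
    using tendsto_add[OF lim tendsto_const[of "W 0 * f (fourier \<psi>)"]] by simp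
qed

section \<open>Growth functions and the grand maximal function\<close>

lemma growth_function_le_iff:
  assumes "growth_function p \<Psi>" "0 \<le> s" "0 \<le> t"
  shows "\<Psi> s \<le> \<Psi> t \<longleftrightarrow> s \<le> t"
  using assms strict_mono_on_less_eq[of "{0..}" \<Psi> s t] by (simp add: growth_function_def)

lemma growth_function_nonneg: "growth_function p \<Psi> \<Longrightarrow> 0 \<le> s \<Longrightarrow> 0 \<le> \<Psi> s"
  using growth_function_le_iff[of p \<Psi> 0 s] by (simp add: growth_function_def)

lemma growth_inv:
  assumes \<Psi>: "growth_function p \<Psi>" and w: "0 \<le> w"
  shows "0 \<le> growth_inv \<Psi> w" "\<Psi> (growth_inv \<Psi> w) = w"
proof -
  have inj: "inj_on \<Psi> {0..}"
    using \<Psi> by (auto simp: growth_function_def intro: strict_mono_on_imp_inj_on)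
  have "eventually (\<lambda>t. w \<le> \<Psi> t \<and> 0 \<le> t) at_top"
    using \<Psi> by (intro eventually_conj) (auto simp: growth_function_def filterlim_at_top eventually_ge_at_top)
  then obtain T where T: "w \<le> \<Psi> T" "0 \<le> T"
    by (auto dest: eventually_happens)
  have "\<exists>t\<ge>0. t \<le> T \<and> \<Psi> t = w"
    using \<Psi> T w by (intro IVT') (auto simp: growth_function_def intro: continuous_on_subset)
  then have "w \<in> \<Psi> ` {0..}" by auto
  then show "0 \<le> growth_inv \<Psi> w" "\<Psi> (growth_inv \<Psi> w) = w"
    unfolding growth_inv_def using the_inv_into_into[OF inj _ order_refl] f_the_inv_into_f[OF inj] by auto
qed

lemma growth_inv_pos:
  assumes \<Psi>: "growth_function p \<Psi>" and w: "0 < w"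
  shows "0 < growth_inv \<Psi> w"
  using growth_inv[OF \<Psi>, of w] w \<Psi> by (cases "growth_inv \<Psi> w = 0") (auto simp: growth_function_def)

text \<open>If \<open>\<tau> > 1\<close>, the lower type, applied to \<open>1 = (1/\<tau>) \<tau>\<close>, gives \<open>\<tau>\<^sup>p \<le> (c/\<Psi>(1)) \<Psi>(\<tau>)\<close>.\<close>

lemma growth_inv_bound:
  assumes \<Psi>: "growth_function p \<Psi>" and p: "0 < p"
  obtains C k where "0 < C" "\<And>w. 0 \<le> w \<Longrightarrow> growth_inv \<Psi> w \<le> (C * (1 + w)) ^ k"
proof -
  obtain c where c: "0 < c" "\<And>t s. 0 \<le> t \<Longrightarrow> s \<in> {0<..<1} \<Longrightarrow> \<Psi> (s * t) \<le> c * s powr p * \<Psi> t"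
    using \<Psi> by (auto simp: growth_function_def lower_type_def)
  have \<Psi>1: "0 < \<Psi> 1"
    using \<Psi> strict_mono_onD[of "{0..}" \<Psi> 0 1] by (auto simp: growth_function_def)
  define C where "C = max 1 (c / \<Psi> 1)"
  define k where "k = nat \<lceil>1 / p\<rceil>"
  have k: "1 / p \<le> real k" unfolding k_def by linarith
  have C: "1 \<le> C" "c / \<Psi> 1 \<le> C" by (auto simp: C_def)
  have "growth_inv \<Psi> w \<le> (C * (1 + w)) ^ k" if w: "0 \<le> w" for w
  proof -
    define \<tau> where "\<tau> = growth_inv \<Psi> w"
    note \<tau> = growth_inv[OF \<Psi> w, folded \<tau>_def]
    have Cw: "1 \<le> C * (1 + w)"
      using mult_mono[of 1 C 1 "1 + w"] C w by simp
    have "\<tau> \<le> (C * (1 + w)) ^ k"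
    proof (cases "\<tau> \<le> 1")
      case True
      then show ?thesis using one_le_power[OF Cw, of k] by simp
    next
      case False
      then have "\<Psi> 1 \<le> c * (1 / \<tau>) powr p * w"
        using c(2)[of \<tau> "1 / \<tau>"] \<tau> by simp
      then have "\<tau> powr p \<le> c / \<Psi> 1 * w"
        using False \<Psi>1 by (simp add: powr_divide field_simps)
      also have "\<dots> \<le> C * (1 + w)"
        using C w \<Psi>1 c by (intro mult_mono) auto
      finally have "(\<tau> powr p) powr (1 / p) \<le> (C * (1 + w)) powr (1 / p)"
        using p by (intro powr_mono2) auto
      also have "\<dots> \<le> (C * (1 + w)) powr real k"
        using k Cw by (intro powr_mono) auto
      also have "\<dots> = (C * (1 + w)) ^ k"
        using Cw by (intro powr_realpow) auto
      finally show ?thesis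
        using p False by (simp add: powr_powr)
    qed
    then show ?thesis by (simp add: \<tau>_def)
  qed
  then show ?thesis
    using that[of C k] C by auto
qed

lemma growth_ext_ge:
  assumes \<Psi>: "growth_function p \<Psi>" and "0 \<le> s" "ennreal s \<le> U"
  shows "ennreal (\<Psi> s) \<le> growth_ext \<Psi> U"
proof (cases U)
  case (real u)
  with assms show ?thesis
    by (simp add: growth_ext_def ennreal_leI growth_function_le_iff[OF \<Psi>])
qed (simp add: growth_ext_def)

text \<open>A suitable multiple \<open>1/K\<close> of the Gaussian belongs to the class of test functions.\<close>

lemma grand_maximal_ge:
  fixes m :: nat
  obtains K where "0 < K"
    "\<And>f t x y. tempered f \<Longrightarrow> 0 < t \<Longrightarrow> norm (x - y) < t \<Longrightarrow>
      ennreal (cmod (convolve f (dilate t gaussian) y) / K) \<le> grand_maximal m f (x::'a::euclidean_space)"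
proof -
  let ?k = "(m + 2) * (DIM('a) + 1)"
  have "schwartz_seminorm ?k (m + 1) (gaussian :: 'a \<Rightarrow> complex) < \<infinity>"
    using schwartz_gaussian by (auto simp: schwartz_def)
  then obtain K0 where K0: "0 \<le> K0" "schwartz_seminorm ?k (m + 1) (gaussian :: 'a \<Rightarrow> complex) \<le> ennreal K0"
    by (cases "schwartz_seminorm ?k (m + 1) (gaussian :: 'a \<Rightarrow> complex)") auto
  define K where "K = K0 + 1"
  have K: "0 < K" "K0 \<le> K" using K0 by (auto simp: K_def)
  let ?\<phi> = "\<lambda>x::'a. of_real (1 / K) * gaussian x"
  have "?\<phi> \<in> schwartz" by (intro schwartz_cmult schwartz_gaussian)
  moreover have "schwartz_seminorm ?k (m + 1) ?\<phi> \<le> ennreal 1"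
  proof (subst schwartz_seminorm_le_iff, simp, intro ballI allI)
    fix bs :: "'a list" and x assume bs: "bs \<in> multi_indices (m + 1)"
    have "(1 + norm x) ^ ?k * cmod (multi_deriv bs gaussian x) \<le> K0"
      using K0(2) bs unfolding schwartz_seminorm_le_iff[OF K0(1)] by blast
    then have "(1 + norm x) ^ ?k * cmod (multi_deriv bs gaussian x) / K \<le> 1"
      using K by (simp add: field_simps)
    then show "(1 + norm x) ^ ?k * cmod (multi_deriv bs ?\<phi> x) \<le> 1"
      using K bs by (subst multi_deriv_cmult[OF schwartz_gaussian])
        (auto simp: multi_indices_def norm_mult norm_divide)
  qed
  ultimately have \<phi>: "?\<phi> \<in> test_functions m"
    by (simp add: test_functions_def)
  have "ennreal (cmod (convolve f (dilate t gaussian) y) / K) \<le> grand_maximal m f x"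
    if f: "tempered f" and t: "0 < t" "norm (x - y) < t" for f t and x y :: 'a
  proof -
    have "convolve f (dilate t ?\<phi>) y = f (\<lambda>z. of_real (1 / K) * dilate t gaussian (y - z))"
      by (simp add: convolve_def dilate_def)
    also have "\<dots> = of_real (1 / K) * convolve f (dilate t gaussian) y"
      unfolding convolve_def
      by (intro tempered_cmult f schwartz_reflect_shift schwartz_dilate schwartz_gaussian t)
    finally have "cmod (convolve f (dilate t gaussian) y) / K = cmod (convolve f (dilate t ?\<phi>) y)"
      using K by (simp add: norm_mult norm_divide)
    also have "ennreal (cmod (convolve f (dilate t ?\<phi>) y)) \<le> grand_maximal m f x"
      unfolding grand_maximal_def using t by (intro SUP_upper2[OF \<phi>] SUP_upper2[of "(t, y)"]) auto
    finally show ?thesis .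
  qed
  with K(1) show ?thesis using that by blast
qed

text \<open>The analytic core. The hypothesis says that \<open>N\<close> dominates \<open>|u(y)|/R\<close> on the whole ball \<open>B(y,t)\<close>. It
  is used twice: integrated over the ball, it bounds \<open>|u|/R\<close> by the value \<open>\<tau>\<close> of the inverse of
  \<open>\<Psi>\<close> at \<open>w = 1/|B(0,t)|\<close>; used at the centre only, it bounds the integral of \<open>\<Psi>(|u|/R)\<close> by \<open>1\<close>. On
  \<open>[0,\<tau>]\<close> the function \<open>\<Psi>\<close> lies above the chord \<open>s w/\<tau>\<close>, which connects the two bounds.\<close>

lemma orlicz_L1_bound:
  fixes u :: "'a::euclidean_space \<Rightarrow> complex"
  assumes \<Psi>: "growth_function p \<Psi>" and [measurable]: "u \<in> borel_measurable borel"
    and R: "0 < R" and t: "0 < t"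
    and N: "\<And>x y. norm (x - y) < t \<Longrightarrow> ennreal (cmod (u y) / R) \<le> N x"
    and modular: "(\<integral>\<^sup>+x. growth_ext \<Psi> (N x) \<partial>lborel) \<le> 1"
  defines "w \<equiv> 1 / (measure lborel (ball (0::'a) 1) * t ^ DIM('a))"
  shows "integrable lborel u"
    and "(LINT y|lborel. cmod (u y)) \<le> R * (growth_inv \<Psi> w / w)"
proof -
  let ?V = "unit_ball_vol (real DIM('a))"
  define \<tau> where "\<tau> = growth_inv \<Psi> w"
  define s where "s y = cmod (u y) / R" for y
  have V: "0 < ?V * t ^ DIM('a)" using t by simp
  have w: "w = 1 / (?V * t ^ DIM('a))" "0 < w"
    using V by (simp_all add: w_def content_ball)
  have \<tau>: "0 < \<tau>" "\<Psi> \<tau> = w"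
    using growth_inv_pos[OF \<Psi> w(2)] growth_inv[OF \<Psi>, of w] w(2) by (auto simp: \<tau>_def)
  have s0: "0 \<le> s y" for y using R by (simp add: s_def)
  have \<Psi>_le: "ennreal (\<Psi> (s y)) \<le> growth_ext \<Psi> (N x)" if "norm (x - y) < t" for x y
    by (rule growth_ext_ge[OF \<Psi> s0]) (use N[OF that] in \<open>simp add: s_def\<close>)
  have s_le: "s y \<le> \<tau>" for y
  proof -
    have "ennreal (\<Psi> (s y) * (?V * t ^ DIM('a))) = (\<integral>\<^sup>+x. ennreal (\<Psi> (s y)) * indicator (ball y t) x \<partial>lborel)"
      using t growth_function_nonneg[OF \<Psi> s0]
      by (simp add: nn_integral_cmult_indicator emeasure_ball ennreal_mult)
    also have "\<dots> \<le> (\<integral>\<^sup>+x. growth_ext \<Psi> (N x) \<partial>lborel)"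
      by (intro nn_integral_mono) (auto simp: indicator_def dist_norm norm_minus_commute intro: \<Psi>_le)
    also have "\<dots> \<le> ennreal 1" using modular by simp
    finally have "\<Psi> (s y) * (?V * t ^ DIM('a)) \<le> 1" by (subst (asm) ennreal_le_iff) auto
    then have "\<Psi> (s y) \<le> \<Psi> \<tau>"
      unfolding \<tau>(2) w(1) using V by (simp add: pos_le_divide_eq)
    then show ?thesis
      using growth_function_le_iff[OF \<Psi> s0, of \<tau> y] \<tau>(1) by simp
  qed
  have u_le: "cmod (u y) \<le> (R * (\<tau> / w)) * \<Psi> (s y)" for y
  proof (cases "s y = 0")
    case True
    then show ?thesis
      using R \<tau>(1) w(2) growth_function_nonneg[OF \<Psi> s0, of y] by (simp add: s_def)
  next
    case False
    then have s_pos: "0 < s y" using s0[of y] by simp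
    have "\<Psi> \<tau> / \<tau> \<le> \<Psi> (s y) / s y"
      using \<Psi> s_pos \<tau>(1) s_le[of y] monotone_onD[of "{0<..}" "(\<le>)" "(\<ge>)" "\<lambda>t. \<Psi> t / t" "s y" \<tau>]
      by (simp add: growth_function_def)
    then have "s y \<le> \<tau> / w * \<Psi> (s y)"
      using s_pos \<tau> w(2) by (simp add: field_simps)
    then have "R * s y \<le> R * (\<tau> / w * \<Psi> (s y))"
      using R by (intro mult_left_mono) auto
    then show ?thesis using R by (simp add: s_def)
  qed
  have "(\<integral>\<^sup>+y. ennreal (cmod (u y)) \<partial>lborel) \<le> ennreal (R * (\<tau> / w)) * 1"
  proof -
    have "continuous_on UNIV (\<lambda>x. \<Psi> (max 0 x))"
    proof (rule continuous_on_compose2[of "{0..}" \<Psi>])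
      show "continuous_on {0..} \<Psi>" using \<Psi> by (simp add: growth_function_def)
      show "continuous_on UNIV (max (0::real))"
        by (intro continuous_on_max continuous_on_const continuous_on_id)
    qed auto
    then have "(\<lambda>x. \<Psi> (max 0 x)) \<in> borel_measurable borel"
      by (rule borel_measurable_continuous_onI)
    then have "(\<lambda>y. \<Psi> (max 0 (s y))) \<in> borel_measurable borel"
      by (rule measurable_compose[rotated]) (simp add: s_def)
    then have [measurable]: "(\<lambda>y. \<Psi> (s y)) \<in> borel_measurable borel"
      using s0 by (simp add: max_def)
    have "(\<integral>\<^sup>+y. ennreal (cmod (u y)) \<partial>lborel) \<le> (\<integral>\<^sup>+y. ennreal (R * (\<tau> / w)) * ennreal (\<Psi> (s y)) \<partial>lborel)"
      using R \<tau>(1) w(2) growth_function_nonneg[OF \<Psi> s0] u_le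
      by (intro nn_integral_mono) (simp add: ennreal_mult[symmetric] ennreal_leI)
    also have "\<dots> = ennreal (R * (\<tau> / w)) * (\<integral>\<^sup>+y. ennreal (\<Psi> (s y)) \<partial>lborel)"
      by (rule nn_integral_cmult) measurable
    also have "\<dots> \<le> ennreal (R * (\<tau> / w)) * (\<integral>\<^sup>+y. growth_ext \<Psi> (N y) \<partial>lborel)"
      using t by (intro mult_left_mono nn_integral_mono \<Psi>_le) auto
    also have "\<dots> \<le> ennreal (R * (\<tau> / w)) * 1"
      by (intro mult_left_mono modular) auto
    finally show ?thesis .
  qed
  then have nn: "(\<integral>\<^sup>+y. ennreal (cmod (u y)) \<partial>lborel) \<le> ennreal (R * (\<tau> / w))" by simp
  then show int: "integrable lborel u"
    by (intro integrableI_bounded) (auto intro: le_less_trans)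
  have "ennreal (LINT y|lborel. cmod (u y)) \<le> ennreal (R * (\<tau> / w))"
    using nn int by (simp add: nn_integral_eq_integral)
  then show "(LINT y|lborel. cmod (u y)) \<le> R * (growth_inv \<Psi> w / w)"
    using R \<tau>(1) w(2) by (simp add: ennreal_le_iff \<tau>_def)
qed

text \<open>For integrands that may fail to be measurable, such as the maximal function under \<open>growth_ext \<Psi>\<close>,
  linearity of the integral is not at hand. But the integral is a supremum over the simple functions
  below the integrand, and these can be rescaled.\<close>

lemma nn_integral_le_cmult:
  assumes c: "0 < c" and le: "\<And>x. g x \<le> ennreal c * f x"
  shows "(\<integral>\<^sup>+x. g x \<partial>M) \<le> ennreal c * (\<integral>\<^sup>+x. f x \<partial>M)"
  unfolding nn_integral_def[of M g]
proof (rule SUP_least, clarify)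
  fix s assume s: "simple_function M s" "s \<le> g"
  have [measurable]: "s \<in> borel_measurable M"
    using s(1) by (rule borel_measurable_simple_function)
  have "(\<integral>\<^sup>+x. ennreal (1 / c) * s x \<partial>M) \<le> (\<integral>\<^sup>+x. f x \<partial>M)"
  proof (rule nn_integral_mono)
    fix x
    have "ennreal (1 / c) * s x \<le> ennreal (1 / c) * (ennreal c * f x)"
      using s(2) le[of x] by (intro mult_left_mono) (auto simp: le_fun_def intro: order_trans)
    also have "\<dots> = f x"
      using c by (simp add: mult.assoc[symmetric] ennreal_mult[symmetric])
    finally show "ennreal (1 / c) * s x \<le> f x" .
  qed
  then have "ennreal c * (ennreal (1 / c) * (\<integral>\<^sup>+x. s x \<partial>M)) \<le> ennreal c * (\<integral>\<^sup>+x. f x \<partial>M)"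
    by (intro mult_left_mono) (simp_all add: nn_integral_cmult)
  moreover have "ennreal c * (ennreal (1 / c) * (\<integral>\<^sup>+x. s x \<partial>M)) = integral\<^sup>S M s"
    using c by (simp add: mult.assoc[symmetric] ennreal_mult[symmetric] nn_integral_eq_simple_integral[OF s(1)])
  ultimately show "integral\<^sup>S M s \<le> ennreal c * (\<integral>\<^sup>+x. f x \<partial>M)" by simp
qed

text \<open>By the lower type, the modular at level \<open>r\<close> is at most \<open>c\<close> times \<open>r\<close> to the power \<open>-p\<close> times the
  modular at level \<open>1\<close>.\<close>

lemma hardy_modular_le_1:
  fixes f :: "('a::euclidean_space \<Rightarrow> complex) \<Rightarrow> complex"
  assumes \<Psi>: "growth_function p \<Psi>" and p: "0 < p" and fin: "hardy_modular \<Psi> 1 f < \<infinity>"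
  shows "\<exists>r>0. hardy_modular \<Psi> r f \<le> 1"
proof -
  obtain c where c: "0 < c" "\<And>t s. 0 \<le> t \<Longrightarrow> s \<in> {0<..<1} \<Longrightarrow> \<Psi> (s * t) \<le> c * s powr p * \<Psi> t"
    using \<Psi> by (auto simp: growth_function_def lower_type_def)
  obtain J where J: "0 \<le> J" "hardy_modular \<Psi> 1 f = ennreal J"
    using fin by (cases "hardy_modular \<Psi> 1 f") auto
  \<comment> \<open>The power makes \<open>c J r\<^sup>-\<^sup>p \<le> 1\<close>; the summand \<open>1\<close> makes \<open>1/r < 1\<close>, where the lower type applies.\<close>
  define r where "r = 1 + (c * J + 1) powr (1 / p)"
  have cJ: "0 \<le> c * J" using c J by simp
  have r: "1 < r" using cJ by (simp add: r_def)
  have "((c * J + 1) powr (1 / p)) powr p \<le> r powr p"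
    using p by (intro powr_mono2) (auto simp: r_def)
  then have rp: "c * J + 1 \<le> r powr p"
    using p cJ by (simp add: powr_powr)
  let ?q = "c * inverse r powr p"
  let ?M = "grand_maximal (moment_order DIM('a) \<Psi>) f"
  have q: "0 < ?q" using c r by simp
  have "growth_ext \<Psi> (ennreal (inverse r) * ?M x) \<le> ennreal ?q * growth_ext \<Psi> (ennreal (inverse 1) * ?M x)" for x
  proof (cases "?M x")
    case (real v)
    have "\<Psi> (inverse r * v) \<le> ?q * \<Psi> v"
      using real(1) r by (intro c(2)) (auto simp: inverse_less_1_iff)
    moreover have "0 \<le> inverse r * v" using r real(1) by simp
    ultimately show ?thesis
      using real q r growth_function_nonneg[OF \<Psi> real(1)]
      by (simp add: growth_ext_def ennreal_mult[symmetric] ennreal_leI)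
  next
    case top
    then show ?thesis using q c(1) r by (simp add: growth_ext_def ennreal_mult_top)
  qed
  then have "hardy_modular \<Psi> r f \<le> ennreal ?q * hardy_modular \<Psi> 1 f"
    unfolding hardy_modular_def by (intro nn_integral_le_cmult q)
  also have "\<dots> = ennreal (?q * J)"
    using q J by (simp add: ennreal_mult)
  also have "\<dots> \<le> ennreal 1"
  proof (rule ennreal_leI)
    have "?q * J = c * J / r powr p"
      using r by (simp add: powr_divide inverse_eq_divide)
    also have "\<dots> \<le> 1"
      using rp cJ by (subst pos_divide_le_eq) auto
    finally show "?q * J \<le> 1" .
  qed
  finally show ?thesis using r by (intro exI[of _ r]) simp
qed

section \<open>The Fourier transform on Hardy--Orlicz spaces\<close>

text \<open>The constants \<open>c\<close> and \<open>K\<close> come from \<open>fourier_gaussian\<close> and \<open>grand_maximal_ge\<close>. They are parameters in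
  order that the final constant \<open>K exp \<pi> / c\<close> is visibly independent of \<open>f\<close>.\<close>

lemma hardy_orlicz_fourier:
  fixes f :: "('a::euclidean_space \<Rightarrow> complex) \<Rightarrow> complex"
  defines "a \<equiv> 1 / measure lborel (ball (0::'a) 1)"
  assumes \<Psi>: "growth_function p \<Psi>" and p: "0 < p" and f: "f \<in> hardy_orlicz \<Psi>"
    and c: "0 < c" "\<And>\<xi>::'a. fourier gaussian \<xi> = of_real c * gaussian \<xi>"
    and K: "0 < K" "\<And>f t x y. tempered f \<Longrightarrow> 0 < t \<Longrightarrow> norm (x - y) < t \<Longrightarrow>
      ennreal (cmod (convolve f (dilate t gaussian) y) / K)
        \<le> grand_maximal (moment_order DIM('a) \<Psi>) f (x::'a)"
  shows "\<exists>fhat. continuous_on UNIV fhat \<and> coincides (fourier_distr f) fhat \<and>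
      (\<forall>\<xi>. \<xi> \<noteq> 0 \<longrightarrow> cmod (fhat \<xi>) \<le>
        (K * exp pi / c) * (growth_inv \<Psi> (a * norm \<xi> ^ DIM('a)) / (a * norm \<xi> ^ DIM('a))) * hardy_norm \<Psi> f)"
proof -
  let ?W = "fourier (gaussian :: 'a \<Rightarrow> complex)"
  have tf: "tempered f" and fin: "hardy_modular \<Psi> 1 f < \<infinity>"
    using f by (auto simp: hardy_orlicz_def)
  define u where "u t = convolve f (dilate t gaussian)" for t
  have V: "0 < measure lborel (ball (0::'a) 1)" by (simp add: content_ball)
  have a: "0 < a" using V by (simp add: a_def)
  have L1: "integrable lborel (u t)"
    "(LINT y|lborel. cmod (u t y)) \<le> K * r * (growth_inv \<Psi> (a / t ^ DIM('a)) / (a / t ^ DIM('a)))"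
    if t: "0 < t" and r: "0 < r" "hardy_modular \<Psi> r f \<le> 1" for t r
  proof -
    have m: "u t \<in> borel_measurable borel"
      unfolding u_def by (intro borel_measurable_continuous_onI continuous_convolve_gaussian tf t)
    have Kr: "0 < K * r" using K(1) r(1) by simp
    let ?N = "\<lambda>x. ennreal (inverse r) * grand_maximal (moment_order DIM('a) \<Psi>) f x"
    have "ennreal (cmod (u t y) / (K * r)) \<le> ?N x" if "norm (x - y) < t" for x y
    proof -
      have "ennreal (cmod (u t y) / (K * r)) = ennreal (inverse r) * ennreal (cmod (u t y) / K)"
        using r K by (simp add: ennreal_mult[symmetric] field_simps)
      also have "\<dots> \<le> ?N x"
        unfolding u_def by (intro mult_left_mono K(2) tf t that) auto
      finally show ?thesis .
    qed
    note * = orlicz_L1_bound[OF \<Psi> m Kr t this r(2)[unfolded hardy_modular_def]]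
    show "integrable lborel (u t)" by (rule *(1))
    show "(LINT y|lborel. cmod (u t y)) \<le> K * r * (growth_inv \<Psi> (a / t ^ DIM('a)) / (a / t ^ DIM('a)))"
      using *(2) by (simp add: a_def)
  qed
  obtain r0 where r0: "0 < r0" "hardy_modular \<Psi> r0 f \<le> 1"
    using hardy_modular_le_1[OF \<Psi> p fin] by blast
  have int: "integrable lborel (u t)" if "0 < t" for t
    by (rule L1(1)[OF that r0])
  have W_nz: "?W \<xi> \<noteq> 0" for \<xi>
    using c by (simp add: gaussian_def)
  \<comment> \<open>Any \<open>t\<close> would define the same function; \<open>t = 1\<close> makes continuity at the origin evident.\<close>
  define fhat where "fhat \<xi> = fourier (u 1) \<xi> / ?W \<xi>" for \<xi>
  have fhat: "fourier (u t) \<xi> = fhat \<xi> * ?W (t *\<^sub>R \<xi>)" if "0 < t" for t \<xi>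
    using fourier_convolve_consistent[OF tf _ _ that, of 1 \<xi>] int[of 1] int[OF that] W_nz[of \<xi>]
    by (simp add: fhat_def u_def field_simps)
  have cont: "continuous_on UNIV fhat"
    unfolding fhat_def using W_nz
    by (intro continuous_on_divide continuous_on_fourier int schwartz_integrable schwartz_gaussian) auto
  have bound: "cmod (fhat \<xi>) \<le> (K * exp pi / c) * (growth_inv \<Psi> (a * norm \<xi> ^ DIM('a)) / (a * norm \<xi> ^ DIM('a))) * r"
    if \<xi>: "\<xi> \<noteq> 0" and r: "0 < r" "hardy_modular \<Psi> r f \<le> 1" for \<xi> r
  proof -
    \<comment> \<open>At this scale \<open>t \<xi>\<close> is a unit vector, and the volume of the ball of radius \<open>t\<close> is \<open>1/(a|\<xi>|\<^sup>d)\<close>.\<close>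
    let ?t = "inverse (norm \<xi>)"
    let ?Q = "growth_inv \<Psi> (a * norm \<xi> ^ DIM('a)) / (a * norm \<xi> ^ DIM('a))"
    have t: "0 < ?t" using \<xi> by simp
    have "norm (?t *\<^sub>R \<xi>) = 1" using \<xi> by simp
    then have W: "cmod (?W (?t *\<^sub>R \<xi>)) = c * exp (- pi)"
      unfolding c(2) norm_mult norm_gaussian using c(1) by simp
    have "a / ?t ^ DIM('a) = a * norm \<xi> ^ DIM('a)"
      by (simp add: power_inverse divide_inverse)
    then have "(LINT y|lborel. cmod (u ?t y)) \<le> K * r * ?Q"
      using L1(2)[OF t r] by simp
    then have "cmod (fhat \<xi>) * (c * exp (- pi)) \<le> K * r * ?Q"
      using order_trans[OF norm_fourier_le[of "u ?t" \<xi>]] unfolding fhat[OF t] norm_mult W by blast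
    then have "cmod (fhat \<xi>) \<le> K * r * ?Q / (c * exp (- pi))"
      using c(1) by (subst pos_le_divide_eq) auto
    also have "\<dots> = (K * exp pi / c) * ?Q * r"
      by (simp add: exp_minus field_simps)
    finally show ?thesis .
  qed
  have norm_bound: "cmod (fhat \<xi>) \<le> (K * exp pi / c) * (growth_inv \<Psi> (a * norm \<xi> ^ DIM('a)) / (a * norm \<xi> ^ DIM('a))) * hardy_norm \<Psi> f"
    if \<xi>: "\<xi> \<noteq> 0" for \<xi>
  proof -
    define Q where "Q = (K * exp pi / c) * (growth_inv \<Psi> (a * norm \<xi> ^ DIM('a)) / (a * norm \<xi> ^ DIM('a)))"
    have w: "0 < a * norm \<xi> ^ DIM('a)" using a \<xi> by simp
    have Q: "0 < Q"
      using growth_inv_pos[OF \<Psi> w] w K(1) c(1) by (simp add: Q_def)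
    have "cmod (fhat \<xi>) / Q \<le> hardy_norm \<Psi> f"
      unfolding hardy_norm_def
    proof (rule cInf_greatest)
      show "{r. 0 < r \<and> hardy_modular \<Psi> r f \<le> 1} \<noteq> {}" using r0 by blast
      fix r assume "r \<in> {r. 0 < r \<and> hardy_modular \<Psi> r f \<le> 1}"
      then show "cmod (fhat \<xi>) / Q \<le> r"
        using bound[OF \<xi>, of r, folded Q_def] Q by (simp add: pos_divide_le_eq mult.commute[of r])
    qed
    then show ?thesis
      unfolding Q_def[symmetric] using Q by (simp add: pos_divide_le_eq mult.commute[of "hardy_norm \<Psi> f"])
  qed
  have fhat_slow: "\<exists>B k. \<forall>\<xi>. cmod (fhat \<xi>) \<le> B * (1 + norm \<xi>) ^ k"
  proof -
    obtain C k where C: "0 < C" "\<And>w. 0 \<le> w \<Longrightarrow> growth_inv \<Psi> w \<le> (C * (1 + w)) ^ k"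
      by (rule growth_inv_bound[OF \<Psi> p]) blast
    have "bounded (fhat ` cball 0 1)"
      by (intro compact_imp_bounded compact_continuous_image continuous_on_subset[OF cont]) auto
    then obtain B0 where "\<forall>\<xi>\<in>cball 0 1. cmod (fhat \<xi>) \<le> B0"
      by (auto simp: bounded_iff)
    then have B0: "cmod (fhat \<xi>) \<le> B0" if "norm \<xi> \<le> 1" for \<xi>
      using that by simp
    let ?D = "K * exp pi / c * r0"
    define E where "E = ?D * ((C * (1 + a)) ^ k / a)"
    let ?B = "\<bar>B0\<bar> + E"
    have D: "0 \<le> E" using K(1) c(1) r0(1) C(1) a by (simp add: E_def)
    have "cmod (fhat \<xi>) \<le> ?B * (1 + norm \<xi>) ^ (DIM('a) * k)" for \<xi>
    proof (cases "norm \<xi> \<le> 1")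
      case True
      have "cmod (fhat \<xi>) \<le> ?B * 1"
        using B0[OF True] D abs_ge_self[of B0] by simp
      also have "\<dots> \<le> ?B * (1 + norm \<xi>) ^ (DIM('a) * k)"
        using D by (intro mult_left_mono one_le_power) auto
      finally show ?thesis .
    next
      case False
      let ?n = "norm \<xi> ^ DIM('a)"
      have n: "1 \<le> ?n" using False by (intro one_le_power) auto
      have "1 + a * ?n \<le> (1 + a) * (1 + norm \<xi>) ^ DIM('a)"
        unfolding distrib_right mult_1_left
        by (intro add_mono one_le_power mult_left_mono power_mono) (use a in auto)
      then have "(C * (1 + a * ?n)) ^ k \<le> (C * ((1 + a) * (1 + norm \<xi>) ^ DIM('a))) ^ k"
        using C(1) a by (intro power_mono mult_left_mono) auto
      with C(2)[of "a * ?n"] a have g: "growth_inv \<Psi> (a * ?n) \<le> (C * ((1 + a) * (1 + norm \<xi>) ^ DIM('a))) ^ k"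
        by simp
      have "growth_inv \<Psi> (a * ?n) / (a * ?n) \<le> (C * ((1 + a) * (1 + norm \<xi>) ^ DIM('a))) ^ k / (a * 1)"
        using a n growth_inv(1)[OF \<Psi>, of "a * ?n"] C(1)
        by (intro frac_le g mult_left_mono) auto
      then have "?D * (growth_inv \<Psi> (a * ?n) / (a * ?n)) \<le> ?D * ((C * ((1 + a) * (1 + norm \<xi>) ^ DIM('a))) ^ k / (a * 1))"
        using K(1) c(1) r0(1) by (intro mult_left_mono) auto
      also have "\<dots> = E * (1 + norm \<xi>) ^ (DIM('a) * k)"
        by (simp add: E_def power_mult_distrib power_mult)
      also have "\<dots> \<le> ?B * (1 + norm \<xi>) ^ (DIM('a) * k)"
        by (intro mult_right_mono) auto
      finally have "?D * (growth_inv \<Psi> (a * ?n) / (a * ?n)) \<le> ?B * (1 + norm \<xi>) ^ (DIM('a) * k)" .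
      moreover have "\<xi> \<noteq> 0" using False by auto
      from bound[OF this r0] have "cmod (fhat \<xi>) \<le> ?D * (growth_inv \<Psi> (a * ?n) / (a * ?n))"
        by (simp add: mult_ac)
      ultimately show ?thesis by linarith
    qed
    then show ?thesis by blast
  qed
  have fhat_int: "integrable lborel (\<lambda>\<xi>. fhat \<xi> * \<psi> \<xi>)" if \<psi>: "\<psi> \<in> schwartz" for \<psi>
  proof -
    obtain B k where B: "\<And>\<xi>. cmod (fhat \<xi>) \<le> B * (1 + norm \<xi>) ^ k"
      using fhat_slow by blast
    note [measurable] = schwartz_measurable[OF \<psi>] borel_measurable_continuous_onI[OF cont]
    show ?thesis
    proof (rule Bochner_Integration.integrable_bound)
      show "integrable lborel (\<lambda>\<xi>. B * ((1 + norm \<xi>) ^ k * cmod (\<psi> \<xi>)))"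
        by (intro integrable_mult_right schwartz_integrable_weight \<psi>)
      have "cmod (fhat \<xi>) * cmod (\<psi> \<xi>) \<le> B * ((1 + norm \<xi>) ^ k * cmod (\<psi> \<xi>))" for \<xi>
        using mult_right_mono[OF B, of "cmod (\<psi> \<xi>)" \<xi>] by (simp add: mult.assoc)
      then show "AE \<xi> in lborel. norm (fhat \<xi> * \<psi> \<xi>) \<le> norm (B * ((1 + norm \<xi>) ^ k * cmod (\<psi> \<xi>)))"
        unfolding norm_mult[of "fhat _"] real_norm_def by (intro AE_I2 order_trans[OF _ abs_ge_self])
    qed measurable
  qed
  have "f (fourier \<psi>) = (LINT \<xi>|lborel. fhat \<xi> * \<psi> \<xi>)" if \<psi>: "\<psi> \<in> schwartz" for \<psi>
  proof -
    let ?s = "\<lambda>n. inverse (real (Suc n))"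
    have cont_W: "continuous_on UNIV ?W"
      by (intro schwartz_continuous schwartz_fourier schwartz_gaussian)
    note [measurable] = schwartz_measurable[OF \<psi>] borel_measurable_continuous_onI[OF cont]
      borel_measurable_continuous_onI[OF cont_W]
    have W_le: "cmod (?W \<xi>) \<le> c" for \<xi>
      using c(1) by (simp add: c(2) norm_mult norm_gaussian)
    have "(\<lambda>n. LINT \<xi>|lborel. fhat \<xi> * \<psi> \<xi> * ?W (?s n *\<^sub>R \<xi>)) \<longlonglongrightarrow> (LINT \<xi>|lborel. fhat \<xi> * \<psi> \<xi> * ?W 0)"
    proof (rule integral_dominated_convergence)
      show "integrable lborel (\<lambda>\<xi>. c * cmod (fhat \<xi> * \<psi> \<xi>))"
        by (intro integrable_mult_right integrable_norm fhat_int \<psi>)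
      show "AE \<xi> in lborel. (\<lambda>n. fhat \<xi> * \<psi> \<xi> * ?W (?s n *\<^sub>R \<xi>)) \<longlonglongrightarrow> fhat \<xi> * \<psi> \<xi> * ?W 0"
      proof (intro AE_I2 tendsto_mult tendsto_const)
        fix \<xi> :: 'a
        have "(\<lambda>n. ?s n *\<^sub>R \<xi>) \<longlonglongrightarrow> 0 *\<^sub>R \<xi>"
          by (intro tendsto_intros LIMSEQ_inverse_real_of_nat)
        then have "(\<lambda>n. ?s n *\<^sub>R \<xi>) \<longlonglongrightarrow> 0" by simp
        then show "(\<lambda>n. ?W (?s n *\<^sub>R \<xi>)) \<longlonglongrightarrow> ?W 0"
          by (rule isCont_tendsto_compose[rotated])
            (use cont_W in \<open>simp add: continuous_on_eq_continuous_at\<close>)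
      qed
      show "AE \<xi> in lborel. norm (fhat \<xi> * \<psi> \<xi> * ?W (?s n *\<^sub>R \<xi>)) \<le> c * cmod (fhat \<xi> * \<psi> \<xi>)" for n
        unfolding norm_mult[of "fhat _ * \<psi> _" "?W _"]
        by (intro AE_I2, subst mult.commute, intro mult_right_mono W_le norm_ge_zero)
    qed measurable
    moreover have "(LINT \<xi>|lborel. fhat \<xi> * \<psi> \<xi> * ?W (?s n *\<^sub>R \<xi>)) = f (fourier (\<lambda>\<xi>. \<psi> \<xi> * ?W (?s n *\<^sub>R \<xi>)))" for n
    proof -
      have s: "0 < ?s n" by simp
      show ?thesis
        using tempered_fourier_gaussian[OF tf s \<psi> int[OF s, unfolded u_def], folded u_def]
        unfolding fhat[OF s] by (simp only: mult_ac)
    qed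
    ultimately have "(\<lambda>n. f (fourier (\<lambda>\<xi>. \<psi> \<xi> * ?W (?s n *\<^sub>R \<xi>)))) \<longlonglongrightarrow> (LINT \<xi>|lborel. fhat \<xi> * \<psi> \<xi>) * ?W 0"
      by simp
    from LIMSEQ_unique[OF this tempered_fourier_limit[OF tf \<psi> schwartz_fourier[OF schwartz_gaussian]]]
    show ?thesis using W_nz[of 0] by simp
  qed
  then have "coincides (fourier_distr f) fhat"
    using fhat_int by (simp add: coincides_def fourier_distr_def)
  with cont norm_bound show ?thesis by blast
qed

theorem proposition24:
  fixes \<Psi> :: "real \<Rightarrow> real" and p a :: real
  defines "a \<equiv> 1 / measure lborel (ball (0::'a::euclidean_space) 1)"
  assumes "0 < p" and "p \<le> 1" and "growth_function p \<Psi>"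
  shows "\<exists>A>0. \<forall>f \<in> (hardy_orlicz \<Psi> :: (('a \<Rightarrow> complex) \<Rightarrow> complex) set).
    \<exists>fhat. continuous_on UNIV fhat \<and> coincides (fourier_distr f) fhat \<and>
      (\<forall>\<xi>. \<xi> \<noteq> 0 \<longrightarrow>
        cmod (fhat \<xi>) \<le>
          A * (growth_inv \<Psi> (a * norm \<xi> ^ DIM('a)) / (a * norm \<xi> ^ DIM('a))) * hardy_norm \<Psi> f)"
proof -
  obtain c where c: "0 < c" "\<And>\<xi>::'a. fourier gaussian \<xi> = of_real c * gaussian \<xi>"
    by (rule fourier_gaussian) blast
  obtain K where K: "0 < K" "\<And>f t x y. tempered f \<Longrightarrow> 0 < t \<Longrightarrow> norm (x - y) < t \<Longrightarrow>
      ennreal (cmod (convolve f (dilate t gaussian) y) / K)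
        \<le> grand_maximal (moment_order DIM('a) \<Psi>) f (x::'a)"
    by (rule grand_maximal_ge) blast
  have "0 < K * exp pi / c" using K(1) c(1) by simp
  then show ?thesis
    unfolding a_def using hardy_orlicz_fourier[OF assms(4,2) _ c K] by blast
qed

end
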